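(* Let $\mathcal{P}=\langle X^\sigma\mid V_P\mid\mathcal{R}\rangle$ be a pregroup presentation for a group $G$, and let $r$ be the maximum length of a relator in $\mathcal{R}$. Let $\mathcal{K}$ be a set of coloured van Kampen diagrams over $\mathcal{I}(\mathcal{P})$, and let $\Psi:\mathcal{K}\to\{\rho_\Gamma:\Gamma\in\mathcal{K}\}$ be a curvature distribution scheme. Assume that there exist constants $\varepsilon\in\mathbb{R}_{>0}$, $\lambda,\mu,m\in\mathbb{R}_{\ge 0}$ and $d\in\mathbb{Z}_{>0}$ such that the following conditions hold for all $\Gamma\in\mathcal{K}$: (a) $\rho_\Gamma(x)\le 0$ for all $x\in V(\Gamma)\cup E(\Gamma)\cup F_R(\Gamma)$; (b) $\rho_\Gamma(f)\le-\varepsilon$ for all faces $f\in F_G(\Gamma)$ that are at dual distance at least $d+1$ from the external face; (c) if $\mathrm{Area}(\Gamma)>1$, then $\rho_\Gamma(f)\le m$ for all faces $f\in F_G(\Gamma)$ that are at dual distance at most $d$ from the external face; (d) $\mathrm{Area}(\Gamma)\le\lambda|F_G(\Gamma)|+\mu|\partial(\Gamma)|$. Then each $\Gamma\in\mathcal{K}$ with boundary length $n$ and area greater than $1$ satisfies $$\mathrm{Area}(\Gamma)\le f(n)=\lambda\left(n\,\frac{(r-1)^d-1}{r-2}\left(1+\frac{m}{\varepsilon}\right)-\frac1\varepsilon\right)+\mu n.$$ Assume now that, in addition, the following holds: (e) if $w\in X^*$ is cyclically $P$-reduced and satisfies $w=_G1$, then there exists a diagram $\Gamma\in\mathcal{K}$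 with boundary word some $w'\in\mathcal{I}(w)$. Then the group $G$ is hyperbolic. In particular, if $\mathcal{I}(w)=\{w\}$ for all $w\in X^*$, then the pregroup Dehn function of $\mathcal{P}$ is bounded above by $\max\{f(n),1\}$.
   Context: A pregroup is a set $P$ with a distinguished element $1$, a partial multiplication $(x,y)\mapsto xy$ defined for $(x,y)\in D(P)\subseteq P\times P$, and an involution $x\mapsto x^\sigma$, such that for all $x,y,z,t\in P$: (P1) $(1,x),(x,1)\in D(P)$ and $1x=x1=x$; (P2) $(x,x^\sigma),(x^\sigma,x)\in D(P)$ and $xx^\sigma=x^\sigma x=1$; (P3) if $(x,y)\in D(P)$ then $(y^\sigma,x^\sigma)\in D(P)$ and $(xy)^\sigma=y^\sigma x^\sigma$; (P4) if $(x,y),(y,z)\in D(P)$ then $(xy,z)\in D(P)$ iff $(x,yz)\in D(P)$, in which case $(xy)z=x(yz)$; (P5) if $(x,y),(y,z),(z,t)\in D(P)$ then $(xy,z)\in D(P)$ or $(yz,t)\in D(P)$. Write $[xy]$ for a product evaluated in $P$. Put $X=P\setminus\{1\}$, $F(X^\sigma)=\langle X\mid xx^\sigma\ (x\in X)\rangle$, $V_P=\{xy[xy]^\sigma: x,y\in X,\ (x,y)\in D(P),\ x\ne y^\sigma\}$ and $U(P)=F(X^\sigma)/\langle\langle V_P\rangle\rangle$. A word over $X$ is $\sigma$-reduced if it has no two consecutive letters $xx^\sigma$; it is $P$-reduced if it has length at most $1$ or no two consecutive letters form a pair in $D(P)$; it is cyclically $P$-reduced if it has length at most $1$, or it is $P$-reduced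 and (last letter, first letter) $\notin D(P)$. A pregroup presentation $\mathcal{P}=\langle X^\sigma\mid V_P\mid\mathcal{R}\rangle$ consists of a finite pregroup $P$ (with $X=P\setminus\{1\}$) and a finite set $\mathcal{R}$ of cyclically $P$-reduced words, none of the form $x^2$ with $x\in X$; it defines the group $G=U(P)/\langle\langle\mathcal{R}\rangle\rangle$. Write $\mathcal{R}^{\pm}=\mathcal{R}\cup\{R^{-1}:R\in\mathcal{R}\}$. Cyclic interleaving: for $v=x_1\cdots x_n$ cyclically $P$-reduced and a word $w=y_1\cdots y_m\in X^*$, $v\approx^c w$ if $m=n$ and either $n\le1$ and $v=w$, or $n>1$ and there are $s_0,s_1,\dots,s_n=s_0\in P$ with $(s_{i-1}^\sigma,x_i),(x_i,s_i),([s_{i-1}^\sigma x_i],s_i)\in D(P)$ and $y_i=[s_{i-1}^\sigma x_is_i]$ for all $i$. For a cyclically $P$-reduced word $w$, $\mathcal{I}(w)$ is the set of $v\in X^*$ with $v\approx^c w$; $\mathcal{I}(\mathcal{R})=\bigcup_{R\in\mathcal{R}}\mathcal{I}(R)$ and $\mathcal{I}(\mathcal{P})=\langle X^\sigma\mid V_P\mid\mathcal{I}(\mathcal{R})\rangle$, which also defines $G$. A coloured (van Kampen) diagram over a pregroup presentation is a finite, simply connected planar van Kampen diagram with edge labels in $X$ (an edge read backwards has label $x^\sigma$), whose internal faces are labelled by elements of $V_P$ (coloured red; these are triangles) or by green relators (the third component of the presentation) or their inverses (coloured green); the unique external face is green and its label is the boundary word. $V(\Gamma),E(\Gamma)$ are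 the sets of vertices and edges, $F_R(\Gamma),F_G(\Gamma)$ the sets of internal red and internal green faces, $F(\Gamma)=F_R(\Gamma)\cup F_G(\Gamma)$, $\mathrm{Area}(\Gamma)=|F(\Gamma)|$, and $|\partial(\Gamma)|$ is the boundary length. The dual distance between two faces is their distance in the dual graph of $\Gamma$. A curvature distribution on $\Gamma$ is a function $\rho_\Gamma:V(\Gamma)\cup E(\Gamma)\cup F(\Gamma)\to\mathbb{R}$ whose values sum to $1$. A curvature distribution scheme on $\mathcal{K}$ associates a curvature distribution $\rho_\Gamma$ to each $\Gamma\in\mathcal{K}$. The pregroup Dehn function $\mathrm{PD}:\mathbb{Z}_{\ge0}\to\mathbb{Z}$ of $\mathcal{P}$ is defined as follows: for each $\sigma$-reduced word $w\in X^*$ with $w=_G1$, let $A(w)$ be the smallest area of a coloured diagram over $\mathcal{P}$ with boundary label $w$; then $\mathrm{PD}(n)=\max\{A(w): w\in X^*,\ w=_G1,\ |w|\le n\}$.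
   Formalization: The explicit area bound is claimed only if r ≥ 3 or V_P is empty (it fails for small r with red faces); at r = 2 the fraction is read as d; (e) is assumed only for non-empty w (else it contradicts (a)); I(w) = {w} is required for σ-reduced w. *)

theory Defs
  imports Complex_Main "HOL-Algebra.Generated_Groups" "HOL-Combinatorics.Orbits"
begin

section \<open>Pregroups\<close>

text \<open>The multiplication is only meaningful on pairs in \<open>pdom\<close>; its values elsewhere are junk
  and never used.\<close>

record 'a pregroup =
  pcarrier :: "'a set"
  pdom :: "('a \<times> 'a) set"
  pmult :: "'a \<Rightarrow> 'a \<Rightarrow> 'a"
  pone :: 'a
  psigma :: "'a \<Rightarrow> 'a"

locale pregroup =
  fixes P :: "'a pregroup"
  assumes dom_subset: "pdom P \<subseteq> pcarrier P \<times> pcarrier P"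
    and mult_closed: "(x, y) \<in> pdom P \<Longrightarrow> pmult P x y \<in> pcarrier P"
    and one_closed: "pone P \<in> pcarrier P"
    and sigma_closed: "x \<in> pcarrier P \<Longrightarrow> psigma P x \<in> pcarrier P"
    and sigma_sigma: "x \<in> pcarrier P \<Longrightarrow> psigma P (psigma P x) = x"
    and P1: "x \<in> pcarrier P \<Longrightarrow> (pone P, x) \<in> pdom P \<and> (x, pone P) \<in> pdom P
               \<and> pmult P (pone P) x = x \<and> pmult P x (pone P) = x"
    and P2: "x \<in> pcarrier P \<Longrightarrow> (x, psigma P x) \<in> pdom P \<and> (psigma P x, x) \<in> pdom P
               \<and> pmult P x (psigma P x) = pone P \<and> pmult P (psigma P x) x = pone P"
    and P3: "(x, y) \<in> pdom P \<Longrightarrow> (psigma P y, psigma P x) \<in> pdom P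
               \<and> psigma P (pmult P x y) = pmult P (psigma P y) (psigma P x)"
    and P4: "(x, y) \<in> pdom P \<Longrightarrow> (y, z) \<in> pdom P \<Longrightarrow>
               ((pmult P x y, z) \<in> pdom P \<longleftrightarrow> (x, pmult P y z) \<in> pdom P)
               \<and> ((pmult P x y, z) \<in> pdom P \<longrightarrow>
                    pmult P (pmult P x y) z = pmult P x (pmult P y z))"
    and P5: "(x, y) \<in> pdom P \<Longrightarrow> (y, z) \<in> pdom P \<Longrightarrow> (z, t) \<in> pdom P \<Longrightarrow>
               (pmult P x y, z) \<in> pdom P \<or> (pmult P y z, t) \<in> pdom P"

definition pgens :: "'a pregroup \<Rightarrow> 'a set" where
  "pgens P = pcarrier P - {pone P}"

definition VP :: "'a pregroup \<Rightarrow> 'a list set" where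
  "VP P = {[x, y, psigma P (pmult P x y)] | x y.
             x \<in> pgens P \<and> y \<in> pgens P \<and> (x, y) \<in> pdom P \<and> x \<noteq> psigma P y}"

definition inv_word :: "'a pregroup \<Rightarrow> 'a list \<Rightarrow> 'a list" where
  "inv_word P w = rev (map (psigma P) w)"

definition sym_words :: "'a pregroup \<Rightarrow> 'a list set \<Rightarrow> 'a list set" where
  "sym_words P S = S \<union> inv_word P ` S"

definition sigma_reduced :: "'a pregroup \<Rightarrow> 'a list \<Rightarrow> bool" where
  "sigma_reduced P w \<longleftrightarrow> w \<in> lists (pgens P) \<and> successively (\<lambda>x y. y \<noteq> psigma P x) w"

definition P_reduced :: "'a pregroup \<Rightarrow> 'a list \<Rightarrow> bool" where
  "P_reduced P w \<longleftrightarrow> w \<in> lists (pgens P) \<and> successively (\<lambda>x y. (x, y) \<notin> pdom P) w"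

definition cyc_P_reduced :: "'a pregroup \<Rightarrow> 'a list \<Rightarrow> bool" where
  "cyc_P_reduced P w \<longleftrightarrow> w \<in> lists (pgens P) \<and>
     (length w \<le> 1 \<or> P_reduced P w \<and> (last w, hd w) \<notin> pdom P)"

definition pregroup_presentation :: "'a pregroup \<Rightarrow> 'a list set \<Rightarrow> bool" where
  "pregroup_presentation P R \<longleftrightarrow> pregroup P \<and> finite (pcarrier P) \<and> finite R \<and>
     (\<forall>w\<in>R. cyc_P_reduced P w) \<and> (\<forall>x\<in>pgens P. [x, x] \<notin> R)"

text \<open>The maximum relator length, read as \<open>0\<close> if there are no relators.\<close>

definition max_relator_length :: "'a list set \<Rightarrow> nat" where
  "max_relator_length R = Max (insert 0 (length ` R))"

section \<open>The group defined by a presentation\<close>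

text \<open>\<open>X\<close> is closed under \<open>\<sigma>\<close> and the words \<open>x x\<^sup>\<sigma>\<close> are relators, so every element of the group
  \<open>\<langle>X | x x\<^sup>\<sigma>, V\<^sub>P, R\<rangle>\<close> is represented by a word over \<open>X\<close> without formal inverses. The group is
  therefore the quotient of \<open>X\<^sup>*\<close> by the least congruence that kills the relators.\<close>

inductive word_eq :: "'a pregroup \<Rightarrow> 'a list set \<Rightarrow> 'a list \<Rightarrow> 'a list \<Rightarrow> bool"
  for P R where
  refl: "u \<in> lists (pgens P) \<Longrightarrow> word_eq P R u u"
| sym: "word_eq P R u v \<Longrightarrow> word_eq P R v u"
| trans: "word_eq P R u v \<Longrightarrow> word_eq P R v w \<Longrightarrow> word_eq P R u w"
| relator: "u \<in> lists (pgens P) \<Longrightarrow> v \<in> lists (pgens P) \<Longrightarrow>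
    r \<in> {[x, psigma P x] | x. x \<in> pgens P} \<union> VP P \<union> R \<Longrightarrow>
    word_eq P R (u @ r @ v) (u @ v)"

definition word_class :: "'a pregroup \<Rightarrow> 'a list set \<Rightarrow> 'a list \<Rightarrow> 'a list set" where
  "word_class P R w = {v. word_eq P R w v}"

definition pres_group :: "'a pregroup \<Rightarrow> 'a list set \<Rightarrow> 'a list set monoid" where
  "pres_group P R = \<lparr>carrier = word_class P R ` lists (pgens P),
     monoid.mult = (\<lambda>A B. \<Union>a\<in>A. \<Union>b\<in>B. word_class P R (a @ b)),
     one = word_class P R []\<rparr>"

section \<open>Cyclic interleaving\<close>

text \<open>The defining formula makes sense for arbitrary words, so no reducedness is built in. The
  relation is symmetric and preserves cyclic \<open>P\<close>-reducedness, so \<open>interleaves P w\<close> consists of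
  cyclically \<open>P\<close>-reduced words if \<open>w\<close> is such a word.\<close>

definition cyc_interleave :: "'a pregroup \<Rightarrow> 'a list \<Rightarrow> 'a list \<Rightarrow> bool" where
  "cyc_interleave P v w \<longleftrightarrow> v \<in> lists (pgens P) \<and> w \<in> lists (pgens P) \<and> length v = length w \<and>
     (if length v \<le> 1 then v = w
      else \<exists>s :: nat \<Rightarrow> 'a. (\<forall>i\<le>length v. s i \<in> pcarrier P) \<and> s (length v) = s 0 \<and>
        (\<forall>i<length v.
           (psigma P (s i), v ! i) \<in> pdom P \<and>
           (v ! i, s (Suc i)) \<in> pdom P \<and>
           (pmult P (psigma P (s i)) (v ! i), s (Suc i)) \<in> pdom P \<and>
           w ! i = pmult P (pmult P (psigma P (s i)) (v ! i)) (s (Suc i))))"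

definition interleaves :: "'a pregroup \<Rightarrow> 'a list \<Rightarrow> 'a list set" where
  "interleaves P w = {v. cyc_interleave P v w}"

definition interleaves_set :: "'a pregroup \<Rightarrow> 'a list set \<Rightarrow> 'a list set" where
  "interleaves_set P R = (\<Union>w\<in>R. interleaves P w)"

section \<open>Distances in graphs\<close>

definition graph_dist :: "('b \<times> 'b) set \<Rightarrow> 'b \<Rightarrow> 'b \<Rightarrow> nat" where
  "graph_dist E x y = (LEAST k. (x, y) \<in> E ^^ k)"

definition geodesic :: "('b \<times> 'b) set \<Rightarrow> 'b list \<Rightarrow> 'b \<Rightarrow> 'b \<Rightarrow> bool" where
  "geodesic E p x y \<longleftrightarrow> p \<noteq> [] \<and> hd p = x \<and> last p = y \<and>
     successively (\<lambda>u v. (u, v) \<in> E) p \<and> length p = Suc (graph_dist E x y)"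

section \<open>Coloured diagrams\<close>

text \<open>
  A finite plane graph is encoded by a combinatorial map. Its darts are the directed edges:
  \<open>dinv\<close> reverses a dart, \<open>dtail\<close> is its initial vertex, and \<open>dnext\<close> is the next dart on the
  boundary of the face to its left. Hence a face is an orbit of \<open>dnext\<close>, and the darts leaving
  one vertex form one orbit of \<open>dnext \<circ> dinv\<close>. All faces, including the external one, are
  traversed with the face on the same side.

  The simply connected planar diagrams are the connected maps of genus \<open>0\<close> with one distinguished
  (external) face \<open>dext\<close>: leaving out that face, the Euler characteristic is \<open>1\<close>. The vertex set
  is a separate component so that the diagram with a single vertex and no edge is included; there,
  the external face is represented by \<open>{}\<close>. As diagrams are finite, vertices and darts may be
  taken to be natural numbers.
\<close>

record 'a diagram =
  dverts :: "nat set"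
  ddarts :: "nat set"
  dinv :: "nat \<Rightarrow> nat"
  dtail :: "nat \<Rightarrow> nat"
  dnext :: "nat \<Rightarrow> nat"
  dlab :: "nat \<Rightarrow> 'a"
  dext :: "nat set"

definition dedges :: "'a diagram \<Rightarrow> nat set set" where
  "dedges \<Gamma> = (\<lambda>e. {e, dinv \<Gamma> e}) ` ddarts \<Gamma>"

definition dfaces :: "'a diagram \<Rightarrow> nat set set" where
  "dfaces \<Gamma> = orbit (dnext \<Gamma>) ` ddarts \<Gamma>"

definition int_faces :: "'a diagram \<Rightarrow> nat set set" where
  "int_faces \<Gamma> = dfaces \<Gamma> - {dext \<Gamma>}"

definition planar_map :: "'a diagram \<Rightarrow> bool" where
  "planar_map \<Gamma> \<longleftrightarrow>
     finite (dverts \<Gamma>) \<and> dverts \<Gamma> \<noteq> {} \<and> finite (ddarts \<Gamma>) \<and>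
     dinv \<Gamma> permutes ddarts \<Gamma> \<and>
     (\<forall>e\<in>ddarts \<Gamma>. dinv \<Gamma> e \<noteq> e \<and> dinv \<Gamma> (dinv \<Gamma> e) = e) \<and>
     dnext \<Gamma> permutes ddarts \<Gamma> \<and>
     (\<forall>e\<in>ddarts \<Gamma>. dtail \<Gamma> e \<in> dverts \<Gamma> \<and> dtail \<Gamma> (dnext \<Gamma> e) = dtail \<Gamma> (dinv \<Gamma> e)) \<and>
     (\<forall>e\<in>ddarts \<Gamma>. \<forall>e'\<in>ddarts \<Gamma>. dtail \<Gamma> e = dtail \<Gamma> e' \<longrightarrow>
        e' \<in> orbit (dnext \<Gamma> \<circ> dinv \<Gamma>) e) \<and>
     (\<forall>u\<in>dverts \<Gamma>. \<forall>v\<in>dverts \<Gamma>.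
        (u, v) \<in> {(dtail \<Gamma> e, dtail \<Gamma> (dinv \<Gamma> e)) | e. e \<in> ddarts \<Gamma>}\<^sup>*) \<and>
     (if ddarts \<Gamma> = {} then dext \<Gamma> = {} else dext \<Gamma> \<in> dfaces \<Gamma>) \<and>
     int (card (dverts \<Gamma>)) - int (card (dedges \<Gamma>)) + int (card (int_faces \<Gamma>)) = 1"

text \<open>The label of a face is determined up to cyclic permutation; \<open>face_word \<Gamma> e\<close> is the label
  read from the dart \<open>e\<close>.\<close>

definition face_word :: "'a diagram \<Rightarrow> nat \<Rightarrow> 'a list" where
  "face_word \<Gamma> e = map (\<lambda>i. dlab \<Gamma> ((dnext \<Gamma> ^^ i) e)) [0..<card (orbit (dnext \<Gamma>) e)]"

definition boundary_word :: "'a diagram \<Rightarrow> 'a list \<Rightarrow> bool" where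
  "boundary_word \<Gamma> w \<longleftrightarrow> ddarts \<Gamma> = {} \<and> w = [] \<or> (\<exists>e\<in>dext \<Gamma>. face_word \<Gamma> e = w)"

text \<open>A cyclically \<open>P\<close>-reduced word is never a cyclic permutation of a word in \<open>V\<^sub>P\<close>, so for
  the sets \<open>S\<close> of green relators that occur here, the label of a face determines its colour.\<close>

definition red_faces :: "'a pregroup \<Rightarrow> 'a diagram \<Rightarrow> nat set set" where
  "red_faces P \<Gamma> = {f \<in> int_faces \<Gamma>. \<exists>e\<in>f. face_word \<Gamma> e \<in> VP P}"

definition green_faces :: "'a pregroup \<Rightarrow> 'a list set \<Rightarrow> 'a diagram \<Rightarrow> nat set set" where
  "green_faces P S \<Gamma> = {f \<in> int_faces \<Gamma>. \<exists>e\<in>f. face_word \<Gamma> e \<in> sym_words P S}"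

definition coloured_diagram :: "'a pregroup \<Rightarrow> 'a list set \<Rightarrow> 'a diagram \<Rightarrow> bool" where
  "coloured_diagram P S \<Gamma> \<longleftrightarrow> planar_map \<Gamma> \<and>
     (\<forall>e\<in>ddarts \<Gamma>. dlab \<Gamma> e \<in> pgens P \<and> dlab \<Gamma> (dinv \<Gamma> e) = psigma P (dlab \<Gamma> e)) \<and>
     int_faces \<Gamma> = red_faces P \<Gamma> \<union> green_faces P S \<Gamma>"

definition area :: "'a diagram \<Rightarrow> nat" where
  "area \<Gamma> = card (int_faces \<Gamma>)"

definition boundary_length :: "'a diagram \<Rightarrow> nat" where
  "boundary_length \<Gamma> = card (dext \<Gamma>)"

definition dual_graph :: "'a diagram \<Rightarrow> (nat set \<times> nat set) set" where
  "dual_graph \<Gamma> = {(f, g). f \<in> dfaces \<Gamma> \<and> g \<in> dfaces \<Gamma> \<and> (\<exists>e\<in>f. dinv \<Gamma> e \<in> g)}"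

definition ext_dist :: "'a diagram \<Rightarrow> nat set \<Rightarrow> nat" where
  "ext_dist \<Gamma> f = graph_dist (dual_graph \<Gamma>) f (dext \<Gamma>)"

section \<open>Curvature\<close>

text \<open>The tags keep the three kinds of cells apart: a set of darts can be both an edge and a face.\<close>

datatype cell = Vertex nat | Edge "nat set" | Face "nat set"

definition cells :: "'a diagram \<Rightarrow> cell set" where
  "cells \<Gamma> = Vertex ` dverts \<Gamma> \<union> Edge ` dedges \<Gamma> \<union> Face ` int_faces \<Gamma>"

definition curvature_distribution :: "'a diagram \<Rightarrow> (cell \<Rightarrow> real) \<Rightarrow> bool" where
  "curvature_distribution \<Gamma> \<rho> \<longleftrightarrow> (\<Sum>c\<in>cells \<Gamma>. \<rho> c) = 1"

definition curvature_scheme :: "'a diagram set \<Rightarrow> ('a diagram \<Rightarrow> cell \<Rightarrow> real) \<Rightarrow> bool" where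
  "curvature_scheme K \<Psi> \<longleftrightarrow> (\<forall>\<Gamma>\<in>K. curvature_distribution \<Gamma> (\<Psi> \<Gamma>))"

section \<open>The pregroup Dehn function\<close>

definition min_area :: "'a pregroup \<Rightarrow> 'a list set \<Rightarrow> 'a list \<Rightarrow> nat" where
  "min_area P R w =
     (LEAST a. \<exists>\<Gamma>. coloured_diagram P R \<Gamma> \<and> boundary_word \<Gamma> w \<and> area \<Gamma> = a)"

definition pregroup_dehn :: "'a pregroup \<Rightarrow> 'a list set \<Rightarrow> nat \<Rightarrow> nat" where
  "pregroup_dehn P R n =
     Max {min_area P R w | w. sigma_reduced P w \<and> word_eq P R w [] \<and> length w \<le> n}"

text \<open>The quotient is the geometric sum of the powers of \<open>r - 1\<close> with exponents below \<open>d\<close>; this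
  gives its value \<open>d\<close> at \<open>r = 2\<close>.\<close>

definition geom_quotient :: "nat \<Rightarrow> nat \<Rightarrow> real" where
  "geom_quotient r d = (if r = 2 then real d else ((real r - 1) ^ d - 1) / (real r - 2))"

definition area_bound ::
    "nat \<Rightarrow> nat \<Rightarrow> real \<Rightarrow> real \<Rightarrow> real \<Rightarrow> real \<Rightarrow> nat \<Rightarrow> real" where
  "area_bound r d \<epsilon> lam \<mu> m n =
     lam * (real n * geom_quotient r d * (1 + m / \<epsilon>) - 1 / \<epsilon>) + \<mu> * real n"

section \<open>Hyperbolic groups\<close>

definition cayley_graph :: "('g, 'm) monoid_scheme \<Rightarrow> 'g set \<Rightarrow> ('g \<times> 'g) set" where
  "cayley_graph G S = {(g, h). g \<in> carrier G \<and> h \<in> carrier G \<and>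
     (\<exists>s\<in>S. h = g \<otimes>\<^bsub>G\<^esub> s \<or> g = h \<otimes>\<^bsub>G\<^esub> s)}"

text \<open>Slim geodesic triangles. Points in the interior of edges are left out, both as corners and
  on the sides: this only changes the constant.\<close>

definition slim_triangles :: "'b set \<Rightarrow> ('b \<times> 'b) set \<Rightarrow> nat \<Rightarrow> bool" where
  "slim_triangles V E \<delta> \<longleftrightarrow>
     (\<forall>x\<in>V. \<forall>y\<in>V. \<forall>z\<in>V. \<forall>p q r.
        geodesic E p x y \<and> geodesic E q y z \<and> geodesic E r x z \<longrightarrow>
        (\<forall>a\<in>set p. \<exists>b\<in>set q \<union> set r. graph_dist E a b \<le> \<delta>))"

definition hyperbolic_group :: "('g, 'm) monoid_scheme \<Rightarrow> bool" where
  "hyperbolic_group G \<longleftrightarrow> group G \<and>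
     (\<exists>S. finite S \<and> S \<subseteq> carrier G \<and> generate G S = carrier G \<and>
        (\<exists>\<delta>. slim_triangles (carrier G) (cayley_graph G S) \<delta>))"

end

theory Submission
  imports Defs
begin

text \<open>
  The curvature sums to \<open>1\<close>, and only the green faces within dual distance \<open>d\<close> of the external face
  contribute positive amounts, at most \<open>m\<close> each. There are at most \<open>n (r - 1)\<^sup>k\<close> faces at dual distance
  \<open>k + 1\<close>, so this bounds the number of green faces, and hence the area, linearly in \<open>n\<close>.

  Hyperbolicity is derived from the linear area bound by the theorem of Stokes. For Lipschitz functions
  \<open>f\<close> and \<open>g\<close> on the Cayley graph, the integral of \<open>f dg\<close> around a closed path is the sum of the
  integrals around the faces of a diagram filling the path, hence at most linear in the length of the
  path. If a point \<open>a\<close> of a geodesic triangle is at distance \<open>D\<close> from the other two sides, where \<open>D\<close> is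
  the maximum over all three sides, there is a closed path of length at most \<open>26 D\<close> which follows the
  side of \<open>a\<close> near \<open>a\<close> and avoids the ball of radius \<open>D\<close> around \<open>a\<close> otherwise. With \<open>f\<close> a cone over this
  ball and \<open>g\<close> the distance from the initial point, the integral is at least \<open>D\<^sup>2\<close>, so \<open>D\<close> is bounded.
\<close>

section \<open>Linear fillings and slim triangles\<close>

text \<open>Integrals take the place of cutting and regluing diagrams. Condition (e) supplies
  diagrams only for cyclically \<open>P\<close>-reduced words, and only up to interleaving, whereas
  slimness needs a filling of every closed path. For integrals this gap is closed without any
  diagram: merging two letters, rotating a word and interleaving it change the integral by a bounded
  amount per letter. This is why \<open>linear_filling\<close> speaks of functions on a graph and
  not of areas. Stokes needs a map from the vertices of a diagram to the Cayley graph. As planarity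
  is only given as an Euler characteristic, the map is built from a spanning tree and the dual
  spanning tree. The Dehn function, in contrast, asks for actual diagrams for all \<sigma>-reduced
  words. There, trivial interleaving of these words forces \<open>VP P = {}\<close>, so that only
  inverse letters multiply, and the diagrams of (e) are extended by spurs.\<close>

definition edge_form :: "('b \<Rightarrow> int) \<Rightarrow> ('b \<Rightarrow> int) \<Rightarrow> 'b \<Rightarrow> 'b \<Rightarrow> int" where
  "edge_form f g a b = (f a + f b) * (g b - g a)"

definition lipschitz_on_edges :: "('b \<times> 'b) set \<Rightarrow> ('b \<Rightarrow> int) \<Rightarrow> bool" where
  "lipschitz_on_edges E f \<longleftrightarrow> (\<forall>(a, b)\<in>E. \<bar>f a - f b\<bar> \<le> 1)"

text \<open>\<open>edge_form\<close> is twice the trapezoidal value of the integral of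
  \<open>f dg\<close> over one edge; the doubling keeps it in the integers. The bound is a
  homological form of a linear isoperimetric inequality: the area that a closed path encloses in any
  two Lipschitz coordinates is at most linear in its length.\<close>

definition linear_filling :: "('b \<times> 'b) set \<Rightarrow> nat \<Rightarrow> bool" where
  "linear_filling E C \<longleftrightarrow> (\<forall>f g c n. lipschitz_on_edges E f \<longrightarrow> lipschitz_on_edges E g \<longrightarrow>
     (\<forall>i<n. (c i, c (Suc i)) \<in> E) \<longrightarrow> c n = c 0 \<longrightarrow>
     \<bar>\<Sum>i<n. edge_form f g (c i) (c (Suc i))\<bar> \<le> int (C * n))"

text \<open>Serves both the Cayley graph, where slimness is proved, and the dual graph of a diagram,
  where only distances matter.\<close>

locale connected_graph =
  fixes V :: "'b set" and E :: "('b \<times> 'b) set"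
  assumes E_sub: "E \<subseteq> V \<times> V"
    and E_sym: "sym E"
    and E_conn: "x \<in> V \<Longrightarrow> y \<in> V \<Longrightarrow> (x, y) \<in> E\<^sup>*"
begin

abbreviation "d \<equiv> graph_dist E"

lemma relpow_dist: "x \<in> V \<Longrightarrow> y \<in> V \<Longrightarrow> (x, y) \<in> E ^^ d x y"
  unfolding graph_dist_def by (rule LeastI_ex) (metis E_conn rtrancl_imp_relpow)

lemma dist_le: "(x, y) \<in> E ^^ k \<Longrightarrow> d x y \<le> k"
  unfolding graph_dist_def by (rule Least_le)

lemma dist_refl [simp]: "d x x = 0"
  using dist_le[of x x 0] by simp

lemma dist_triangle: "x \<in> V \<Longrightarrow> y \<in> V \<Longrightarrow> z \<in> V \<Longrightarrow> d x z \<le> d x y + d y z"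
  by (rule dist_le) (auto simp: relpow_add intro: relpow_dist)

lemma relpow_sym:
  assumes "sym A" "(x, y) \<in> A ^^ k" shows "(y, x) \<in> A ^^ k"
  using assms(2)
proof (induction k arbitrary: y)
  case (Suc k)
  then obtain w where "(x, w) \<in> A ^^ k" "(w, y) \<in> A" by auto
  with Suc.IH assms(1) show ?case
    by (meson relpow_Suc_I2 symD)
qed simp

lemma dist_sym: "x \<in> V \<Longrightarrow> y \<in> V \<Longrightarrow> d x y = d y x"
  by (meson dist_le E_sym relpow_dist relpow_sym order_antisym)

lemma dist_edge: "(x, y) \<in> E \<Longrightarrow> d x y \<le> 1"
  by (rule dist_le) simp

lemma dist_lipschitz: "a \<in> V \<Longrightarrow> lipschitz_on_edges E (\<lambda>b. int (d a b))"
  unfolding lipschitz_on_edges_def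
proof clarify
  fix x y assume "a \<in> V" and e: "(x, y) \<in> E"
  then have "x \<in> V" "y \<in> V" using E_sub by auto
  with \<open>a \<in> V\<close> dist_triangle[of a x y] dist_triangle[of a y x] dist_sym[of x y] dist_edge[OF e]
  show "\<bar>int (d a x) - int (d a y)\<bar> \<le> 1" by simp
qed

section \<open>Geodesic segments\<close>

lemma walk_nth:
  assumes "successively (\<lambda>u v. (u, v) \<in> E) p" "i \<le> j" "j < length p"
  shows "(p ! i, p ! j) \<in> E ^^ (j - i)"
  using assms(2,3)
proof (induction j)
  case (Suc j)
  show ?case
  proof (cases "i = Suc j")
    case False
    with Suc have ij: "i \<le> j" by simp
    have "(p ! j, p ! Suc j) \<in> E"
      using assms(1) Suc.prems(2) by (auto simp: successively_conv_nth)
    moreover have "(p ! i, p ! j) \<in> E ^^ (j - i)"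
      using Suc ij by simp
    ultimately show ?thesis
      using ij by (auto simp: Suc_diff_le)
  qed simp
qed simp

text \<open>Only the set of points is kept and not the list, so that a side of a triangle can be
  read in both directions and the three sides can exchange their roles.\<close>

definition segment :: "'b set \<Rightarrow> 'b \<Rightarrow> 'b \<Rightarrow> bool" where
  "segment T x y \<longleftrightarrow> x \<in> V \<and> y \<in> V \<and> (\<exists>p. geodesic E p x y \<and> set p = T)"

lemma successively_rev_sym:
  "successively (\<lambda>u v. (u, v) \<in> E) (rev p) = successively (\<lambda>u v. (u, v) \<in> E) p"
proof -
  have "(\<lambda>u v. (v, u) \<in> E) = (\<lambda>u v. (u, v) \<in> E)"
    using E_sym by (auto simp: sym_def fun_eq_iff)
  then show ?thesis unfolding successively_rev by metis
qed

lemma segment_sym: "segment T x y \<Longrightarrow> segment T y x"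
  unfolding segment_def geodesic_def
  by (metis dist_sym hd_rev last_rev length_rev rev_is_Nil_conv set_rev successively_rev_sym)

text \<open>If two points of a geodesic had a connection shorter than the part of \<open>p\<close>
  between them, inserting it would shorten \<open>p\<close>. Thus positions in \<open>p\<close>
  measure distances.\<close>

lemma segment_obtain:
  assumes "segment T x y"
  obtains p where "set p = T" "length p = Suc (d x y)" "successively (\<lambda>u v. (u, v) \<in> E) p"
    "p ! 0 = x" "p ! d x y = y"
    "\<And>i j. i \<le> j \<Longrightarrow> j \<le> d x y \<Longrightarrow> d (p ! i) (p ! j) = j - i"
    "set p \<subseteq> V"
proof -
  from assms obtain p where p: "geodesic E p x y" "set p = T" and V: "x \<in> V" "y \<in> V"
    by (auto simp: segment_def)
  have len: "length p = Suc (d x y)" and ne: "p \<noteq> []"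
    and suc: "successively (\<lambda>u v. (u, v) \<in> E) p"
    using p by (auto simp: geodesic_def)
  have x: "p ! 0 = x"
    using p ne by (auto simp: geodesic_def hd_conv_nth)
  have "last p = y" using p by (simp add: geodesic_def)
  then have y: "p ! d x y = y" using last_conv_nth[OF ne] len by simp
  have sub: "set p \<subseteq> V"
  proof
    fix w assume "w \<in> set p"
    then obtain i where i: "i < length p" "p ! i = w" by (auto simp: in_set_conv_nth)
    show "w \<in> V"
    proof (cases i)
      case 0 then show ?thesis using i x V by simp
    next
      case (Suc j)
      then have "(p ! j, p ! i) \<in> E" using suc i by (auto simp: successively_conv_nth)
      then show ?thesis using i E_sub by auto
    qed
  qed
  have "d (p ! i) (p ! j) = j - i" if "i \<le> j" "j \<le> d x y" for i j
  proof -
    have le: "d (p ! i') (p ! j') \<le> j' - i'" if "i' \<le> j'" "j' \<le> d x y" for i' j'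
      using walk_nth[OF suc, of i' j'] that len dist_le by simp
    have mem: "p ! i \<in> V" "p ! j \<in> V" using sub that len by (auto simp: subset_iff)
    have "d x y \<le> d (p ! 0) (p ! i) + (d (p ! i) (p ! j) + d (p ! j) (p ! d x y))"
      using dist_triangle[of x "p ! i" y] dist_triangle[of "p ! i" "p ! j" y] mem V x y by simp
    also have "\<dots> \<le> i + (d (p ! i) (p ! j) + (d x y - j))"
      using le[of 0 i] le[of j "d x y"] that by simp
    finally have "j - i \<le> d (p ! i) (p ! j)" using that by simp
    with le[OF that] show ?thesis by simp
  qed
  with that p len suc x y sub show thesis by blast
qed

lemma segment_sub: "segment T x y \<Longrightarrow> T \<subseteq> V"
  by (metis segment_obtain)

lemma segment_ends: "segment T x y \<Longrightarrow> x \<in> T \<and> y \<in> T"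
  unfolding segment_def geodesic_def by (metis hd_in_set last_in_set)

lemma segment_point:
  assumes "segment T x y" "t \<le> d x y" obtains u where "u \<in> T" "d x u = t"
proof -
  obtain p where p: "set p = T" "length p = Suc (d x y)" "p ! 0 = x"
    "\<And>i j. i \<le> j \<Longrightarrow> j \<le> d x y \<Longrightarrow> d (p ! i) (p ! j) = j - i"
    by (rule segment_obtain[OF assms(1)]) blast
  have "p ! t \<in> T" using p assms(2) by auto
  with that p(3) p(4)[of 0 t] assms(2) show thesis by simp
qed

lemma segment_dist:
  assumes "segment T x y" "u \<in> T"
  shows "d x u + d u y = d x y"
proof -
  obtain p where p: "set p = T" "length p = Suc (d x y)" "p ! 0 = x" "p ! d x y = y"
    "\<And>i j. i \<le> j \<Longrightarrow> j \<le> d x y \<Longrightarrow> d (p ! i) (p ! j) = j - i"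
    by (rule segment_obtain[OF assms(1)]) blast
  then obtain i where i: "i \<le> d x y" "p ! i = u"
    using assms(2) by (metis in_set_conv_nth less_Suc_eq_le)
  with p(3,4) p(5)[of 0 i] p(5)[of i "d x y"] show ?thesis by simp
qed

lemma segment_dist2:
  assumes "segment T x y" "u \<in> T" "v \<in> T" "d x u \<le> d x v"
  shows "d x u + d u v = d x v"
proof -
  obtain p where p: "set p = T" "length p = Suc (d x y)" "p ! 0 = x" "p ! d x y = y"
    "\<And>i j. i \<le> j \<Longrightarrow> j \<le> d x y \<Longrightarrow> d (p ! i) (p ! j) = j - i"
    by (rule segment_obtain[OF assms(1)]) blast
  then obtain i j where i: "i \<le> d x y" "p ! i = u" and j: "j \<le> d x y" "p ! j = v"
    using assms(2,3) by (metis in_set_conv_nth less_Suc_eq_le)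
  with p(3) p(5)[of 0 i] p(5)[of 0 j] p(5)[of i j] assms(4) show ?thesis by simp
qed

text \<open>The path is kept inside \<open>T\<close>, so that a lower bound on the distance of all
  points of \<open>T\<close> from \<open>a\<close> carries over to it.\<close>

lemma segment_path:
  assumes "segment T x y" "u \<in> T" "v \<in> T"
  shows "(u, v) \<in> (E \<inter> T \<times> T) ^^ d u v"
proof -
  obtain p where p: "set p = T" "length p = Suc (d x y)" "p ! 0 = x" "p ! d x y = y"
    "successively (\<lambda>u v. (u, v) \<in> E) p"
    "\<And>i j. i \<le> j \<Longrightarrow> j \<le> d x y \<Longrightarrow> d (p ! i) (p ! j) = j - i"
    by (rule segment_obtain[OF assms(1)]) blast
  have sub: "T \<subseteq> V" using segment_sub assms by blast
  have *: "(p ! i, p ! j) \<in> (E \<inter> T \<times> T) ^^ d (p ! i) (p ! j)" if "i \<le> j" "j \<le> d x y" for i j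
    unfolding p(6)[OF that] relpow_fun_conv
    using that p(1,2,5)
    by (intro exI[of _ "\<lambda>k. p ! (i + k)"]) (auto simp: successively_conv_nth)
  obtain i j where i: "i \<le> d x y" "p ! i = u" and j: "j \<le> d x y" "p ! j = v"
    using p assms(2,3) by (metis in_set_conv_nth less_Suc_eq_le)
  show ?thesis
  proof (cases "i \<le> j")
    case True then show ?thesis using * i j by blast
  next
    case False
    then have "(v, u) \<in> (E \<inter> T \<times> T) ^^ d v u" using *[of j i] i j by auto
    moreover have "sym (E \<inter> T \<times> T)" using E_sym by (auto simp: sym_def)
    ultimately show ?thesis
      using dist_sym[of u v] sub assms(2,3) relpow_sym by fastforce
  qed
qed

lemma segment_exists:
  assumes "x \<in> V" "y \<in> V" obtains T where "segment T x y"
proof -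
  obtain f where f: "f 0 = x" "f (d x y) = y" "\<And>i. i < d x y \<Longrightarrow> (f i, f (Suc i)) \<in> E"
    using relpow_dist[OF assms] by (auto simp: relpow_fun_conv)
  have "geodesic E (map f [0..<Suc (d x y)]) x y"
    unfolding geodesic_def using f
    by (auto simp: successively_conv_nth hd_map last_map simp del: upt_Suc)
  with that assms show thesis by (auto simp: segment_def)
qed

section \<open>Paths that avoid a ball\<close>

abbreviation outside :: "'b \<Rightarrow> nat \<Rightarrow> 'b set" where
  "outside a k \<equiv> {v \<in> V. k \<le> d a v}"

abbreviation outside_edges :: "'b \<Rightarrow> nat \<Rightarrow> ('b \<times> 'b) set" where
  "outside_edges a k \<equiv> E \<inter> outside a k \<times> outside a k"

lemma relpow_subset:
  fixes A B :: "('c \<times> 'c) set"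
  assumes "A \<subseteq> B" "(x, y) \<in> A ^^ k" shows "(x, y) \<in> B ^^ k"
  using assms(2,1) unfolding relpow_fun_conv by blast

lemma segment_outside:
  assumes "segment T x y" "u \<in> T" "v \<in> T" "\<forall>w\<in>T. k \<le> d a w"
  shows "(u, v) \<in> outside_edges a k ^^ d u v"
  by (rule relpow_subset[OF _ segment_path[OF assms(1-3)]])
    (use assms(4) segment_sub[OF assms(1)] in auto)

text \<open>By the triangle inequality, a geodesic of length at most \<open>l\<close> loses at most
  \<open>l\<close> of its initial distance from \<open>a\<close>.\<close>

lemma short_outside:
  assumes V: "a \<in> V" "u \<in> V" "v \<in> V" and k: "d u v \<le> l" "k + l \<le> d a u"
  shows "(u, v) \<in> outside_edges a k ^^ d u v"
proof -
  obtain T where T: "segment T u v" using segment_exists V by blast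
  have "\<forall>w\<in>T. k \<le> d a w"
  proof
    fix w assume w: "w \<in> T"
    then have "w \<in> V" using segment_sub T by blast
    then show "k \<le> d a w"
      using segment_dist[OF T w] dist_triangle[of a w u] dist_sym[of u w] V k by simp
  qed
  then show ?thesis using segment_outside T segment_ends by blast
qed

lemma outside_sym:
  assumes "(u, v) \<in> outside_edges a k ^^ n" shows "(v, u) \<in> outside_edges a k ^^ n"
  by (rule relpow_sym[OF _ assms]) (use E_sym in \<open>auto simp: sym_def\<close>)

lemma outside_trans:
  assumes "(u, v) \<in> outside_edges a k ^^ n" "(v, w) \<in> outside_edges a k ^^ n'"
  shows "(u, w) \<in> outside_edges a k ^^ (n + n')"
  using assms by (auto simp: relpow_add)

text \<open>The test function \<open>f\<close> is a cone of height \<open>D\<close> over the ball around \<open>a\<close>; it vanishes on the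
  return path, so only the segment through \<open>a\<close> contributes, and its contribution is quadratic.\<close>

lemma fat_loop:
  assumes lin: "linear_filling E C"
    and seg: "segment T x y" and mem: "u \<in> T" "a \<in> T" "v \<in> T"
    and ua: "d x u + D \<le> d x a" and av: "d x a + D \<le> d x v"
    and ret: "(v, u) \<in> outside_edges a D ^^ n"
  shows "D * D \<le> C * (d u v + n)"
proof -
  obtain p where p: "set p = T" "length p = Suc (d x y)" "p ! 0 = x" "p ! d x y = y"
    "successively (\<lambda>u v. (u, v) \<in> E) p"
    "\<And>i j. i \<le> j \<Longrightarrow> j \<le> d x y \<Longrightarrow> d (p ! i) (p ! j) = j - i"
    by (rule segment_obtain[OF seg]) blast
  have V: "u \<in> V" "a \<in> V" "v \<in> V" using segment_sub[OF seg] mem by auto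
  have idx: "p ! d x w = w \<and> d x w \<le> d x y" if w: "w \<in> T" for w
  proof -
    obtain i where "i < length p" "p ! i = w"
      using p(1) w by (metis in_set_conv_nth)
    then have i: "i \<le> d x y" "p ! i = w" using p(2) by auto
    with p(3) p(6)[of 0 i] show ?thesis by simp
  qed
  define i0 where "i0 = d x u"
  define ia where "ia = d x a"
  define k where "k = d x v - d x u"
  have k: "d u v = k" "i0 + k = d x v"
    using segment_dist2[OF seg mem(1,3)] ua av by (auto simp: k_def i0_def)
  obtain h where h: "h 0 = v" "h n = u" "\<And>i. i < n \<Longrightarrow> (h i, h (Suc i)) \<in> outside_edges a D"
    using ret by (auto simp: relpow_fun_conv)
  \<comment> \<open>The closed path: \<open>k\<close> steps along the segment from \<open>u\<close>
    to \<open>v\<close>, then the return path \<open>h\<close>.\<close>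
  define c where "c i = (if i \<le> k then p ! (i0 + i) else h (i - k))" for i
  have pk: "p ! (i0 + k) = v" and p0: "p ! i0 = u" and kle: "i0 + k \<le> d x y"
    using idx[OF mem(3)] idx[OF mem(1)] k by (auto simp: i0_def)
  have ch: "c (k + i) = h i" for i using pk h by (auto simp: c_def)
  define f where "f = (\<lambda>w. max 0 (int D - int (d a w)))"
  define g where "g = (\<lambda>w. int (d u w))"
  have lf: "lipschitz_on_edges E f"
    using dist_lipschitz[OF V(2)] by (fastforce simp: lipschitz_on_edges_def f_def)
  have lg: "lipschitz_on_edges E g"
    using dist_lipschitz[OF V(1)] by (simp add: g_def)
  have ce: "(c i, c (Suc i)) \<in> E" if "i < k + n" for i
  proof (cases "i < k")
    case True
    then show ?thesis using p(2,5) kle by (auto simp: c_def successively_conv_nth)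
  next
    case False
    then obtain j where "i = k + j" using le_Suc_ex not_less by blast
    then show ?thesis using ch[of j] ch[of "Suc j"] h(3)[of j] that by simp
  qed
  have cl: "c (k + n) = c 0" using ch[of n] h(2) p0 by (simp add: c_def)
  have "\<bar>\<Sum>i<k + n. edge_form f g (c i) (c (Suc i))\<bar> \<le> int (C * (k + n))"
    using lin lf lg ce cl unfolding linear_filling_def by blast
  moreover have "(\<Sum>i<k + n. edge_form f g (c i) (c (Suc i)))
      = (\<Sum>i<k. edge_form f g (c i) (c (Suc i))) + (\<Sum>i<n. edge_form f g (h i) (h (Suc i)))"
  proof -
    have "(\<Sum>i<k + n. F i) = (\<Sum>i<k. F i) + (\<Sum>i<n. F (k + i))" for F :: "nat \<Rightarrow> int"
      by (induction n) auto
    then show ?thesis by (simp add: ch flip: add_Suc_right)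
  qed
  moreover have "(\<Sum>i<n. edge_form f g (h i) (h (Suc i))) = 0"
    by (rule sum.neutral) (use h(3) in \<open>auto simp: edge_form_def f_def\<close>)
  moreover have "int (D * D) \<le> (\<Sum>i<k. edge_form f g (c i) (c (Suc i)))"
  proof -
    \<comment> \<open>Along a geodesic starting at \<open>u\<close> the function \<open>g\<close>
      increases by one with every edge, so only the factor of \<open>f\<close> is left.\<close>
    have summand: "edge_form f g (c i) (c (Suc i)) = f (p ! (i0 + i)) + f (p ! (i0 + Suc i))"
      if "i < k" for i
      using that p(6)[of i0 "i0 + i"] p(6)[of i0 "i0 + Suc i"] kle p0
      by (simp add: edge_form_def c_def g_def)
    define j where "j = ia - i0"
    have j: "i0 + j = ia" "j + D \<le> k" using ua av k by (auto simp: j_def ia_def i0_def)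
    have pa: "p ! ia = a" using idx mem(2) by (simp add: ia_def)
    have fa: "f (p ! (i0 + (j + t))) = int D - int t" if "t \<le> D" for t
      using p(6)[of ia "ia + t"] pa j kle that by (simp add: f_def add.assoc[symmetric])
    \<comment> \<open>As \<open>f\<close> is nonnegative, it suffices to count the \<open>D\<close>
      edges that follow \<open>a\<close>. They contribute 2 (D - t) - 1 for t < D, in total
      D^2.\<close>
    have "int (D * D) \<le> (\<Sum>t<D. f (p ! (i0 + (j + t))) + f (p ! (i0 + Suc (j + t))))"
    proof -
      have gs: "(\<Sum>t<m. (int D - int t) + (int D - int (Suc t))) = int m * (2 * int D - int m)" for m
        by (induction m) (auto simp: algebra_simps)
      have "(\<Sum>t<D. f (p ! (i0 + (j + t))) + f (p ! (i0 + Suc (j + t))))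
          = (\<Sum>t<D. (int D - int t) + (int D - int (Suc t)))"
        by (rule sum.cong) (use fa in \<open>auto simp flip: add_Suc_right\<close>)
      then show ?thesis using gs[of D] by (simp add: algebra_simps)
    qed
    also have "\<dots> = (\<Sum>i\<in>(\<lambda>t. j + t) ` {..<D}. f (p ! (i0 + i)) + f (p ! (i0 + Suc i)))"
      by (simp add: sum.reindex)
    also have "\<dots> \<le> (\<Sum>i<k. f (p ! (i0 + i)) + f (p ! (i0 + Suc i)))"
      by (rule sum_mono2) (use j in \<open>auto simp: f_def\<close>)
    finally show ?thesis using summand by simp
  qed
  ultimately have "int (D * D) \<le> int (C * (k + n))" by linarith
  then show ?thesis unfolding k(1) by (simp only: of_nat_le_iff)
qed

text \<open>\<open>U\<close> stands for the union of the other two sides. From a point at distance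
  \<open>2 * D\<close> from \<open>a\<close>, a connection to \<open>U\<close> of length at most
  \<open>D\<close> cannot enter the ball of radius \<open>D\<close>. If the side ends before such a
  point, its corner \<open>x\<close> already lies in \<open>U\<close> and takes the place of both
  \<open>u\<close> and \<open>u'\<close>.\<close>

lemma side_exit:
  assumes seg: "segment T x y" and a: "a \<in> T" and U: "x \<in> U" "U \<subseteq> V" "\<forall>b\<in>U. D \<le> d a b"
    and near: "\<forall>c\<in>T. \<exists>b\<in>U. d c b \<le> D"
  obtains u u' where "u \<in> T" "d x u + D \<le> d x a" "d x a \<le> d x u + 2 * D" "u' \<in> U" "d u u' \<le> D"
    "(u, u') \<in> outside_edges a D ^^ d u u'"
proof (cases "2 * D \<le> d x a")
  case True
  have V: "a \<in> V" "x \<in> V" using segment_sub[OF seg] a U by auto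
  have "d x a \<le> d x y" using segment_dist[OF seg a] by simp
  then obtain u where u: "u \<in> T" "d x u = d x a - 2 * D"
    by (meson diff_le_self le_trans segment_point[OF seg])
  obtain u' where u': "u' \<in> U" "d u u' \<le> D" using near u by blast
  have uV: "u \<in> V" "u' \<in> V" using u u' U segment_sub[OF seg] by auto
  have "d u a = 2 * D" using segment_dist2[OF seg u(1) a] u True by simp
  then have "(u, u') \<in> outside_edges a D ^^ d u u'"
    using short_outside[of a u u' D D] u' V uV dist_sym[of a u] by simp
  then show thesis using that[of u u'] u u' True by simp
next
  case False
  have V: "a \<in> V" "x \<in> V" using segment_sub[OF seg] a U by auto
  have "D \<le> d x a" using U V dist_sym by simp
  then show thesis using that[of x x] U segment_ends[OF seg] False by simp
qed

text \<open>The return path runs over \<open>Q\<close> and \<open>R\<close>, which are far from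
  \<open>a\<close> by assumption. The difficulty is that \<open>u'\<close> and \<open>v'\<close> may
  lie on different sides whose common corner is distant. Then the path leaves the side of
  \<open>u'\<close> after \<open>6 * D\<close> and crosses to another side: either to the side of
  \<open>v'\<close>, or back to \<open>P\<close> at a point beyond \<open>a\<close>, where the loop
  can be closed at once.\<close>

lemma thin_side:
  assumes lin: "linear_filling E C"
    and P: "segment P x y" and Q: "segment Q y z" and R: "segment R x z"
    and a: "a \<in> P" and far: "\<forall>b\<in>Q \<union> R. D \<le> d a b"
    and nP: "\<forall>c\<in>P. \<exists>b\<in>Q \<union> R. d c b \<le> D"
    and nQ: "\<forall>c\<in>Q. \<exists>b\<in>P \<union> R. d c b \<le> D"
    and nR: "\<forall>c\<in>R. \<exists>b\<in>P \<union> Q. d c b \<le> D"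
  shows "D \<le> 26 * C"
proof -
  have sub: "P \<subseteq> V" "Q \<subseteq> V" "R \<subseteq> V" using P Q R segment_sub by auto
  have ends: "x \<in> P" "y \<in> P" "y \<in> Q" "z \<in> Q" "x \<in> R" "z \<in> R"
    using P Q R segment_ends by auto
  note tri = dist_triangle and sym = dist_sym
  have aV: "a \<in> V" using a sub by auto
  obtain u u' where u: "u \<in> P" "d x u + D \<le> d x a" "d x a \<le> d x u + 2 * D"
    and u': "u' \<in> Q \<union> R" "d u u' \<le> D" and uu': "(u, u') \<in> outside_edges a D ^^ d u u'"
    by (rule side_exit[OF P a _ _ far nP]) (use ends sub in auto)
  obtain v v' where v: "v \<in> P" "d y v + D \<le> d y a" "d y a \<le> d y v + 2 * D"
    and v': "v' \<in> Q \<union> R" "d v v' \<le> D" and vv': "(v, v') \<in> outside_edges a D ^^ d v v'"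
    by (rule side_exit[OF segment_sym[OF P] a _ _ far nP]) (use ends sub in auto)
  have V: "u \<in> V" "u' \<in> V" "v \<in> V" "v' \<in> V" "x \<in> V" "y \<in> V" "z \<in> V"
    using u v u' v' ends sub by auto
  have xv: "d x a + D \<le> d x v" "d x v \<le> d x a + 2 * D"
    using segment_dist[OF P v(1)] segment_dist[OF P a] v(2,3) sym[of v y] sym[of a y] V aV by auto
  have uv: "d u v \<le> 4 * D" using segment_dist2[OF P u(1) v(1)] u xv by simp
  have ua: "d u a \<le> 2 * D" using segment_dist2[OF P u(1) a] u by simp
  have u'v': "d u' v' \<le> 6 * D"
    using tri[of u' u v'] tri[of u v v'] sym[of u u'] V u' v' uv by simp
  have concl: "D \<le> 26 * C" if "D * D \<le> C * l" "l \<le> 26 * D" for l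
  proof (cases "D = 0")
    case False
    have "D * D \<le> C * (26 * D)" using that by (meson le_trans mult_le_mono2)
    then have "D * D \<le> (26 * C) * D" by (simp add: algebra_simps)
    then show ?thesis using False by simp
  qed simp
  \<comment> \<open>The total 26 D consists of 4 D from \<open>u\<close> to \<open>v\<close>, D for
    each of the two exits, and 20 D = 6 D + D + 13 D for the longest detour below.\<close>
  have viaQR: "D \<le> 26 * C" if "(u', v') \<in> outside_edges a D ^^ n" "n \<le> 20 * D" for n
  proof (rule concl)
    have "(u, v) \<in> outside_edges a D ^^ (d u u' + n + d v v')"
      using uu' that(1) vv' outside_trans outside_sym by blast
    then show "D * D \<le> C * (d u v + (d u u' + n + d v v'))"
      using fat_loop[OF lin P u(1) a v(1) u(2) xv(1)] outside_sym by blast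
    show "d u v + (d u u' + n + d v v') \<le> 26 * D" using uv u' v' that(2) by simp
  qed
  \<comment> \<open>Here \<open>w\<close> replaces \<open>v\<close> as the end of the part of the
    loop on \<open>P\<close>.\<close>
  have viaP: "D \<le> 26 * C"
    if "w \<in> P" "d x a + D \<le> d x w" "(u', w) \<in> outside_edges a D ^^ n" "n \<le> 7 * D" for w n
  proof (rule concl)
    have wV: "w \<in> V" using that sub by auto
    have "(u, w) \<in> outside_edges a D ^^ (d u u' + n)"
      using uu' that(3) outside_trans by blast
    then show "D * D \<le> C * (d u w + (d u u' + n))"
      using fat_loop[OF lin P u(1) a that(1) u(2) that(2)] outside_sym by blast
    have "d u' w \<le> n"
      using that(3) by (intro dist_le) (rule relpow_subset[of "outside_edges a D"], auto)
    then have "d u w \<le> 8 * D" using tri[of u u' w] V wV u' that(4) by simp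
    then show "d u w + (d u u' + n) \<le> 26 * D" using u' that(4) by simp
  qed
  \<comment> \<open>The length 6 D serves two purposes: \<open>u''\<close> is at distance at least 3
    D from \<open>a\<close>, so that the jump to \<open>w\<close> of length at most D avoids the
    ball, and a jump back to \<open>P\<close> lands beyond \<open>a\<close>.\<close>
  have step: "(u', u'') \<in> outside_edges a D ^^ (6 * D) \<and> (u'', w) \<in> outside_edges a D ^^ d u'' w
      \<and> d w v' \<le> 13 * D"
    if "segment S b c" "u' \<in> S" "u'' \<in> S" "S \<subseteq> Q \<union> R" "d u' u'' = 6 * D" "w \<in> V" "d u'' w \<le> D"
    for S b c u'' w
  proof -
    have u''V: "u'' \<in> V" using that sub by auto
    have "d u' a \<le> 3 * D" using tri[of u' u a] sym[of u u'] V aV u' ua by simp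
    then have "3 * D \<le> d a u''"
      using tri[of u' a u''] V aV u''V that(5) by simp
    then have "(u'', w) \<in> outside_edges a D ^^ d u'' w"
      using short_outside[of a u'' w D D] aV u''V that by simp
    moreover have "(u', u'') \<in> outside_edges a D ^^ (6 * D)"
      using segment_outside[OF that(1-3), of D a] far that(4,5) by (auto simp: subset_iff)
    moreover have "d w v' \<le> 13 * D"
      using tri[of w u'' v'] tri[of u'' u' v'] sym[of u' u''] sym[of w u''] V u''V that u'v' by simp
    ultimately show ?thesis by blast
  qed
  have onQ: "(b, c) \<in> outside_edges a D ^^ d b c" if "b \<in> Q" "c \<in> Q" for b c
    using segment_outside[OF Q that] far by auto
  have onR: "(b, c) \<in> outside_edges a D ^^ d b c" if "b \<in> R" "c \<in> R" for b c
    using segment_outside[OF R that] far by auto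
  consider "u' \<in> Q" "v' \<in> Q" | "u' \<in> R" "v' \<in> R" | "u' \<in> R" "v' \<in> Q" | "u' \<in> Q" "v' \<in> R"
    using u' v' by blast
  then show ?thesis
  proof cases
    case 1 then show ?thesis using viaQR[OF onQ[of u' v']] u'v' by simp
  next
    case 2 then show ?thesis using viaQR[OF onR[of u' v']] u'v' by simp
  next
    case 3
    show ?thesis
    proof (cases "d u' z \<le> 6 * D")
      case True
      have "d z v' \<le> 12 * D" using tri[of z u' v'] sym[of u' z] V True u'v' by simp
      moreover have "(u', v') \<in> outside_edges a D ^^ (d u' z + d z v')"
        using onR[of u' z] onQ[of z v'] 3 ends outside_trans by blast
      ultimately show ?thesis using viaQR[of "d u' z + d z v'"] True by simp
    next
      case False
      have "d x u' + 6 * D \<le> d x z" using segment_dist[OF R 3(1)] False by simp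
      then obtain u'' where u'': "u'' \<in> R" "d x u'' = d x u' + 6 * D"
        using segment_point[OF R] by blast
      have 6: "d u' u'' = 6 * D" using segment_dist2[OF R 3(1) u''(1)] u'' by simp
      obtain w where w: "w \<in> P \<union> Q" "d u'' w \<le> D" using nR u'' by blast
      have wV: "w \<in> V" "u'' \<in> V" using w sub u'' by auto
      note st = step[OF R 3(1) u''(1) _ 6 wV(1) w(2)]
      show ?thesis
      proof (cases "w \<in> Q")
        case True
        then have "(u', v') \<in> outside_edges a D ^^ (6 * D + d u'' w + d w v')"
          using st onQ[of w v'] 3 outside_trans by blast
        then show ?thesis using viaQR[of "6 * D + d u'' w + d w v'"] st w(2) by simp
      next
        case False
        then have wP: "w \<in> P" using w by simp
        \<comment> \<open>Of the 6 D walked, at most D is lost between \<open>u\<close> and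
          \<open>u'\<close> and at most D in the jump to \<open>w\<close>. So \<open>w\<close> is at
          least 4 D ahead of \<open>u\<close>, whereas \<open>a\<close> is at most 2 D ahead of
          it.\<close>
        have "d x u'' \<le> d x w + D" using tri[of x w u''] sym[of w u''] V wV w by simp
        moreover have "d x u \<le> d x u' + D" using tri[of x u' u] sym[of u u'] V u' by simp
        ultimately have "d x a + D \<le> d x w" using u'' u by simp
        moreover have "(u', w) \<in> outside_edges a D ^^ (6 * D + d u'' w)"
          using st outside_trans by blast
        ultimately show ?thesis using viaP[OF wP, of "6 * D + d u'' w"] w(2) by simp
      qed
    qed
  next
    case 4
    show ?thesis
    proof (cases "d u' y \<le> 6 * D")
      case True
      \<comment> \<open>The corner \<open>y\<close> lies on \<open>Q\<close>, hence at distance at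
        least D from \<open>a\<close>, and serves as the point \<open>w\<close> of
        \<open>viaP\<close>.\<close>
      have "d x a + D \<le> d x y" using segment_dist[OF P a] far ends(3) by (metis UnI1 add_left_mono)
      then show ?thesis using viaP[of y] onQ[of u' y] 4 ends True by simp
    next
      case False
      have "d y u' - 6 * D \<le> d y z" using segment_dist[OF Q 4(1)] by simp
      then obtain u'' where u'': "u'' \<in> Q" "d y u'' = d y u' - 6 * D"
        using segment_point[OF Q] by blast
      have u''V: "u'' \<in> V" using u'' sub by auto
      have yu': "6 * D \<le> d y u'" using False sym V by simp
      have 6: "d u' u'' = 6 * D"
        using segment_dist2[OF Q u''(1) 4(1)] u'' yu' sym[of u' u''] V u''V by simp
      obtain w where w: "w \<in> P \<union> R" "d u'' w \<le> D" using nQ u'' by blast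
      have wV: "w \<in> V" using w sub by auto
      note st = step[OF Q 4(1) u''(1) _ 6 wV w(2)]
      show ?thesis
      proof (cases "w \<in> R")
        case True
        then have "(u', v') \<in> outside_edges a D ^^ (6 * D + d u'' w + d w v')"
          using st onR[of w v'] 4 outside_trans by blast
        then show ?thesis using viaQR[of "6 * D + d u'' w + d w v'"] st w(2) by simp
      next
        case False
        then have wP: "w \<in> P" using w by simp
        have "d y w \<le> d y u'' + D" using tri[of y u'' w] V wV u''V w by simp
        moreover have "d y u' \<le> d y u + D" using tri[of y u u'] V u' by simp
        ultimately have "d y w + 4 * D \<le> d y u" using u'' u yu' by simp
        then have "d x u + 4 * D \<le> d x w"
          using segment_dist[OF P wP] segment_dist[OF P u(1)] sym[of w y] sym[of u y] V wV by simp
        then have "d x a + D \<le> d x w" using u by simp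
        moreover have "(u', w) \<in> outside_edges a D ^^ (6 * D + d u'' w)"
          using st outside_trans by blast
        ultimately show ?thesis using viaP[OF wP, of "6 * D + d u'' w"] w(2) by simp
      qed
    qed
  qed
qed

lemma linear_filling_slim:
  assumes lin: "linear_filling E C"
  shows "slim_triangles V E (26 * C)"
  unfolding slim_triangles_def
proof (intro ballI allI impI; elim conjE)
  fix x y z p q r a
  assume V: "x \<in> V" "y \<in> V" "z \<in> V"
    and geo: "geodesic E p x y" "geodesic E q y z" "geodesic E r x z" and a: "a \<in> set p"
  have seg: "segment (set p) x y" "segment (set q) y z" "segment (set r) x z"
    using V geo by (auto simp: segment_def)
  have ne: "set p \<noteq> {}" "set q \<noteq> {}" "set r \<noteq> {}" using geo by (auto simp: geodesic_def)
  define D where "D c T = Min (d c ` T)" for c and T :: "'b set"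
  have D: "\<forall>b\<in>T. D c T \<le> d c b" "\<exists>b\<in>T. d c b = D c T" if "finite T" "T \<noteq> {}" for c T
  proof -
    have "Min (d c ` T) \<in> d c ` T" using that by (intro Min_in) auto
    then show "\<exists>b\<in>T. d c b = D c T" by (auto simp: D_def)
    show "\<forall>b\<in>T. D c T \<le> d c b" using that by (auto simp: D_def)
  qed
  \<comment> \<open>With the maximum over all three sides, each side is within \<open>M\<close> of
    the other two, as \<open>thin_side\<close> requires. The side on which it is attained then plays
    the role of \<open>P\<close>.\<close>
  define W where "W = (\<lambda>c. D c (set q \<union> set r)) ` set p \<union> (\<lambda>c. D c (set p \<union> set r)) ` set q
      \<union> (\<lambda>c. D c (set p \<union> set q)) ` set r"
  define M where "M = Max W"
  have fin: "finite W" "W \<noteq> {}" using ne by (auto simp: W_def)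
  then have "M \<in> W" by (simp add: M_def)
  have leM: "D c (set q \<union> set r) \<le> M" if "c \<in> set p" for c
    using fin that by (auto simp: M_def W_def)
  have leM2: "D c (set p \<union> set r) \<le> M" if "c \<in> set q" for c
    using fin that by (auto simp: M_def W_def)
  have leM3: "D c (set p \<union> set q) \<le> M" if "c \<in> set r" for c
    using fin that by (auto simp: M_def W_def)
  have n1: "\<forall>c\<in>set p. \<exists>b\<in>set q \<union> set r. d c b \<le> M"
    using D(2)[of "set q \<union> set r"] ne leM by (metis List.finite_set finite_UnI Un_empty)
  have n2: "\<forall>c\<in>set q. \<exists>b\<in>set p \<union> set r. d c b \<le> M"
    using D(2)[of "set p \<union> set r"] ne leM2 by (metis List.finite_set finite_UnI Un_empty)
  have n3: "\<forall>c\<in>set r. \<exists>b\<in>set p \<union> set q. d c b \<le> M"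
    using D(2)[of "set p \<union> set q"] ne leM3 by (metis List.finite_set finite_UnI Un_empty)
  have "M \<le> 26 * C"
  proof -
    consider c where "c \<in> set p" "M = D c (set q \<union> set r)" | c where "c \<in> set q" "M = D c (set p \<union> set r)"
      | c where "c \<in> set r" "M = D c (set p \<union> set q)"
      using \<open>M \<in> W\<close> by (auto simp: W_def)
    then show ?thesis
    proof cases
      case 1
      then show ?thesis
        using thin_side[OF lin seg 1(1) _ n1 n2 n3] D(1)[of "set q \<union> set r"] ne by auto
    next
      case (2 c)
      have "\<forall>b\<in>set r \<union> set p. M \<le> d c b" using 2 D(1)[of "set p \<union> set r" c] ne by auto
      then show ?thesis
        using thin_side[OF lin seg(2) segment_sym[OF seg(3)] segment_sym[OF seg(1)] 2(1)] n1 n2 n3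
        by (simp add: Un_commute)
    next
      case (3 c)
      have "\<forall>b\<in>set q \<union> set p. M \<le> d c b" using 3 D(1)[of "set p \<union> set q" c] ne by auto
      then show ?thesis
        using thin_side[OF lin seg(3) segment_sym[OF seg(2)] seg(1) 3(1)] n1 n2 n3
        by (simp add: Un_commute)
    qed
  qed
  then show "\<exists>b\<in>set q \<union> set r. d a b \<le> 26 * C" using n1 a by (meson le_trans)
qed

end

section \<open>The group of a pregroup presentation\<close>

declare in_listsD [rule del] in_listsI [rule del]

lemma lists_append_iff: "u @ v \<in> lists A \<longleftrightarrow> u \<in> lists A \<and> v \<in> lists A"
  by auto

context pregroup
begin

abbreviation "X \<equiv> pgens P"
abbreviation "D \<equiv> pdom P"
abbreviation "mul \<equiv> pmult P"
abbreviation "idt \<equiv> pone P"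
abbreviation "sg \<equiv> psigma P"

lemma gen_carrier: "x \<in> X \<Longrightarrow> x \<in> pcarrier P"
  by (simp add: pgens_def)

lemma dom_carrier: "(x, y) \<in> D \<Longrightarrow> x \<in> pcarrier P \<and> y \<in> pcarrier P"
  using dom_subset by auto

lemma inv_one: "sg idt = idt"
  using P1[of "sg idt"] P2[OF one_closed] sigma_closed[OF one_closed] by simp

lemma inv_eq_one_iff: "x \<in> pcarrier P \<Longrightarrow> sg x = idt \<longleftrightarrow> x = idt"
  using inv_one sigma_sigma by metis

lemma inv_gen: "x \<in> X \<Longrightarrow> sg x \<in> X"
  by (simp add: pgens_def sigma_closed inv_eq_one_iff)

lemma mult_one_imp_inv: "(x, y) \<in> D \<Longrightarrow> mul x y = idt \<Longrightarrow> x = sg y"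
  using P4[of x y "sg y"] P1 P2 dom_carrier sigma_closed by metis

lemma mult_eq_one_iff: "(x, y) \<in> D \<Longrightarrow> mul x y = idt \<longleftrightarrow> x = sg y"
  using mult_one_imp_inv P2 dom_carrier by blast

lemma mult_gen: "(x, y) \<in> D \<Longrightarrow> x \<noteq> sg y \<Longrightarrow> mul x y \<in> X"
  by (simp add: pgens_def mult_closed mult_eq_one_iff)

lemma VP_words: "VP P \<subseteq> lists X"
  by (auto simp: VP_def inv_gen mult_gen)

lemma inv_word_lists: "w \<in> lists X \<Longrightarrow> inv_word P w \<in> lists X"
  by (auto simp: inv_word_def inv_gen in_lists_conv_set)

lemma inv_word_inv_word: "w \<in> lists X \<Longrightarrow> inv_word P (inv_word P w) = w"
  by (induction w) (auto simp: inv_word_def rev_map sigma_sigma gen_carrier)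

text \<open>The identity is not a letter. Statements about arbitrary pregroup elements, such as the
  elements \<open>s i\<close> of an interleaving, need the empty word in its place.\<close>

definition elt_word :: "'a \<Rightarrow> 'a list" where
  "elt_word x = (if x = idt then [] else [x])"

lemma elt_word_lists: "x \<in> pcarrier P \<Longrightarrow> elt_word x \<in> lists X"
  by (simp add: elt_word_def pgens_def)

lemma elt_word_gen: "x \<in> X \<Longrightarrow> elt_word x = [x]"
  by (simp add: elt_word_def pgens_def)

end

locale word_presentation = pregroup P for P :: "'a pregroup" +
  fixes R :: "'a list set"
  assumes R_words: "R \<subseteq> lists (pgens P)"
begin

abbreviation weq (infix "\<approx>" 50) where "u \<approx> v \<equiv> word_eq P R u v"
abbreviation "cls \<equiv> word_class P R"
abbreviation "G \<equiv> pres_group P R"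
abbreviation "gens \<equiv> (\<lambda>x. cls [x]) ` X"
abbreviation "cay \<equiv> cayley_graph G gens"

lemma relator_words:
  assumes "r \<in> {[x, sg x] | x. x \<in> X} \<union> VP P \<union> R" shows "r \<in> lists X"
  using assms VP_words R_words inv_gen by auto

lemma word_eq_lists: "u \<approx> v \<Longrightarrow> u \<in> lists X \<and> v \<in> lists X"
  by (induction rule: word_eq.induct) (use relator_words in auto)

lemma word_eq_context:
  assumes "u \<approx> v" "a \<in> lists X" "b \<in> lists X" shows "a @ u @ b \<approx> a @ v @ b"
  using assms(1)
proof (induction rule: word_eq.induct)
  case (refl u) then show ?case using assms by (intro word_eq.refl) auto
next
  case (sym u v) then show ?case using word_eq.sym by blast
next
  case (trans u v w) then show ?case using word_eq.trans by blast
next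
  case (relator u v r)
  then show ?case using word_eq.relator[of "a @ u" P "v @ b" r R] assms by simp
qed

lemma word_eq_append: "u \<approx> u' \<Longrightarrow> v \<approx> v' \<Longrightarrow> u @ v \<approx> u' @ v'"
  using word_eq_context[of u u' "[]" v] word_eq_context[of v v' u' "[]"] word_eq_lists word_eq.trans
  by (metis append.right_neutral append_Nil lists.Nil)

lemma relator_trivial: "r \<in> {[x, sg x] | x. x \<in> X} \<union> VP P \<union> R \<Longrightarrow> r \<approx> []"
  using word_eq.relator[of "[]" P "[]" r R] by simp

lemma inv_word_right: "w \<in> lists X \<Longrightarrow> w @ inv_word P w \<approx> []"
proof (induction w)
  case Nil then show ?case by (simp add: inv_word_def word_eq.refl)
next
  case (Cons x w)
  then have "[x] @ (w @ inv_word P w) @ [sg x] \<approx> [x] @ [] @ [sg x]"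
    by (intro word_eq_context) (auto intro: inv_gen)
  moreover have "[x, sg x] \<approx> []" using Cons.prems by (intro relator_trivial) auto
  ultimately show ?case by (simp add: inv_word_def) (meson word_eq.trans)
qed

lemma inv_word_left: "w \<in> lists X \<Longrightarrow> inv_word P w @ w \<approx> []"
  using inv_word_right[of "inv_word P w"] inv_word_lists[of w] inv_word_inv_word by simp

lemma word_eq_cancel_left:
  assumes "u @ v \<approx> u @ v'" shows "v \<approx> v'"
proof -
  have l: "u \<in> lists X" "v \<in> lists X" "v' \<in> lists X"
    using word_eq_lists[OF assms] by (auto simp: lists_append_iff)
  have *: "inv_word P u @ u @ w \<approx> w" if "w \<in> lists X" for w
    using word_eq_append[OF inv_word_left[OF l(1)] word_eq.refl[OF that]] by simp
  have "inv_word P u @ u @ v \<approx> inv_word P u @ u @ v'"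
    using word_eq_append[OF word_eq.refl[OF inv_word_lists[OF l(1)]] assms] .
  then show ?thesis using * l word_eq.sym word_eq.trans by metis
qed

lemma trivial_conj:
  assumes "u \<in> lists X" "v \<in> lists X" "u @ v \<approx> []" shows "v @ u \<approx> []"
proof -
  have "u @ (v @ u) \<approx> u @ []"
    using word_eq_append[OF assms(3) word_eq.refl[OF assms(1)]] by simp
  then show ?thesis by (rule word_eq_cancel_left)
qed

lemma trivial_inv_word:
  assumes "w \<approx> []" shows "inv_word P w \<approx> []"
proof -
  have w: "w \<in> lists X" using word_eq_lists assms by blast
  have "inv_word P w @ w \<approx> inv_word P w @ []"
    using word_eq_append[OF word_eq.refl[OF inv_word_lists[OF w]] assms] .
  then show ?thesis using inv_word_left[OF w] word_eq.sym word_eq.trans by (metis append_Nil2)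
qed

text \<open>Products with the identity are trivial, inverse letters cancel, and every other product
  of the pregroup is given by a relator in \<open>VP P\<close>.\<close>

lemma elt_word_mult:
  assumes "(x, y) \<in> D" shows "elt_word x @ elt_word y \<approx> elt_word (mul x y)"
proof -
  have c: "x \<in> pcarrier P" "y \<in> pcarrier P" using dom_carrier[OF assms] by auto
  then have e: "elt_word x \<in> lists X" "elt_word y \<in> lists X" using elt_word_lists by auto
  consider "x = idt" | "y = idt" | "x \<in> X" "y \<in> X" "x = sg y" | "x \<in> X" "y \<in> X" "x \<noteq> sg y"
    using c by (auto simp: pgens_def)
  then show ?thesis
  proof cases
    case 1
    then have "elt_word x @ elt_word y = elt_word (mul x y)" using P1 c by (simp add: elt_word_def)
    then show ?thesis using word_eq.refl e by (metis lists_append_iff)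
  next
    case 2
    then have "elt_word x @ elt_word y = elt_word (mul x y)" using P1 c by (simp add: elt_word_def)
    then show ?thesis using word_eq.refl e by (metis lists_append_iff)
  next
    case 3
    have "y = sg x" using 3 c sigma_sigma by simp
    then have "[x, y] \<approx> []" using 3 by (intro relator_trivial) auto
    moreover have "mul x y = idt" using 3 P2 c by simp
    ultimately show ?thesis using 3 by (simp add: elt_word_gen) (simp add: elt_word_def)
  next
    case 4
    define z where "z = mul x y"
    have z: "z \<in> X" using 4 assms mult_gen by (simp add: z_def)
    have "[x, y, sg z] \<approx> []" using 4 assms by (intro relator_trivial) (auto simp: VP_def z_def)
    then have "([x, y] @ [sg z]) @ [z] \<approx> [] @ [z]"
      using z by (intro word_eq_append word_eq.refl) auto
    moreover have "[sg z, z] \<approx> []" using inv_word_left[of "[z]"] z by (simp add: inv_word_def)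
    then have "[x, y] @ [sg z, z] \<approx> [x, y] @ []"
      using 4 by (intro word_eq_append word_eq.refl) auto
    ultimately have "[x, y] \<approx> [z]" by simp (meson word_eq.sym word_eq.trans)
    then show ?thesis using 4 z by (simp add: elt_word_gen z_def)
  qed
qed

lemma cls_eq_iff: "u \<in> lists X \<Longrightarrow> cls u = cls v \<longleftrightarrow> u \<approx> v"
  unfolding word_class_def
  by (metis (mono_tags, lifting) Collect_cong mem_Collect_eq word_eq.refl word_eq.sym word_eq.trans)

lemma cls_mem: "v \<in> cls u \<longleftrightarrow> u \<approx> v"
  by (simp add: word_class_def)

lemma cls_mult:
  assumes "u \<in> lists X" "v \<in> lists X" shows "cls u \<otimes>\<^bsub>G\<^esub> cls v = cls (u @ v)"
proof -
  have "cls (a @ b) = cls (u @ v)" if "a \<in> cls u" "b \<in> cls v" for a b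
    using that word_eq_append[of u a v b] cls_eq_iff[of "u @ v"] assms
    by (metis cls_mem lists_append_iff)
  then have "(\<Union>a\<in>cls u. \<Union>b\<in>cls v. cls (a @ b)) = (\<Union>a\<in>cls u. \<Union>b\<in>cls v. cls (u @ v))"
    by (intro SUP_cong HOL.refl) blast
  moreover have "u \<in> cls u" "v \<in> cls v" using assms by (auto simp: cls_mem word_eq.refl)
  then have "cls u \<noteq> {}" "cls v \<noteq> {}" by blast+
  ultimately show ?thesis by (simp add: pres_group_def)
qed

lemma carrier_G: "carrier G = cls ` lists X" and one_G: "\<one>\<^bsub>G\<^esub> = cls []"
  by (simp_all add: pres_group_def)

lemma group_G: "group G"
proof (rule groupI)
  fix g h assume "g \<in> carrier G" "h \<in> carrier G"
  then show "g \<otimes>\<^bsub>G\<^esub> h \<in> carrier G" by (auto simp: carrier_G cls_mult)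
next
  fix g h k assume "g \<in> carrier G" "h \<in> carrier G" "k \<in> carrier G"
  then show "g \<otimes>\<^bsub>G\<^esub> h \<otimes>\<^bsub>G\<^esub> k = g \<otimes>\<^bsub>G\<^esub> (h \<otimes>\<^bsub>G\<^esub> k)"
    by (auto simp: carrier_G cls_mult lists_append_iff simp del: append_in_lists_conv)
next
  fix g assume "g \<in> carrier G"
  then show "\<one>\<^bsub>G\<^esub> \<otimes>\<^bsub>G\<^esub> g = g" by (auto simp: carrier_G one_G cls_mult)
next
  fix g assume "g \<in> carrier G"
  then obtain w where w: "w \<in> lists X" "g = cls w" by (auto simp: carrier_G)
  then have "cls (inv_word P w) \<otimes>\<^bsub>G\<^esub> g = \<one>\<^bsub>G\<^esub>"
    using inv_word_left inv_word_lists by (simp add: cls_mult one_G cls_eq_iff lists_append_iff)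
  then show "\<exists>h\<in>carrier G. h \<otimes>\<^bsub>G\<^esub> g = \<one>\<^bsub>G\<^esub>"
    using w inv_word_lists by (auto simp: carrier_G)
qed (auto simp: carrier_G one_G)

lemma gens_sub: "gens \<subseteq> carrier G"
  by (auto simp: carrier_G)

lemma generate_gens: "generate G gens = carrier G"
proof
  show "generate G gens \<subseteq> carrier G"
    using group.generate_incl[OF group_G gens_sub] .
  have "cls w \<in> generate G gens" if "w \<in> lists X" for w
    using that
  proof (induction w)
    case Nil then show ?case using generate.one[of G gens] by (simp add: one_G)
  next
    case (Cons x w)
    then have "cls [x] \<otimes>\<^bsub>G\<^esub> cls w \<in> generate G gens"
      by (intro generate.eng[OF generate.incl]) auto
    then show ?case using Cons by (simp add: cls_mult)
  qed
  then show "carrier G \<subseteq> generate G gens" by (auto simp: carrier_G)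
qed

lemma cay_edge: "u \<in> lists X \<Longrightarrow> x \<in> X \<Longrightarrow> (cls u, cls (u @ [x])) \<in> cay"
  by (auto simp: cayley_graph_def carrier_G cls_mult lists_append_iff intro!: bexI[of _ x])

text \<open>The edge may come from a generator applied at its other end; read from this end, it
  carries the inverse letter.\<close>

lemma cay_edge_word:
  assumes "(cls u, h) \<in> cay" "u \<in> lists X"
  obtains x where "x \<in> X" "h = cls (u @ [x])"
proof -
  obtain x v where xv: "x \<in> X" "v \<in> lists X" "h = cls v"
    "cls v = cls (u @ [x]) \<or> cls u = cls (v @ [x])"
    using assms by (auto simp: cayley_graph_def carrier_G cls_mult)
  show thesis
  proof (cases "cls v = cls (u @ [x])")
    case False
    then have "u \<approx> v @ [x]" using xv assms cls_eq_iff by blast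
    moreover have ix: "sg x \<in> X" using xv inv_gen by blast
    ultimately have "u @ [sg x] \<approx> (v @ [x]) @ [sg x]"
      by (intro word_eq_append word_eq.refl) auto
    moreover have "[x, sg x] \<approx> []" using xv by (intro relator_trivial) auto
    then have "v @ [x, sg x] \<approx> v @ []" using xv by (intro word_eq_append word_eq.refl) auto
    ultimately have "v \<approx> u @ [sg x]" by simp (meson word_eq.sym word_eq.trans)
    then have "h = cls (u @ [sg x])" using xv cls_eq_iff by blast
    then show thesis using that ix by blast
  qed (use xv that in blast)
qed

lemma cay_graph: "connected_graph (carrier G) cay"
proof
  show "cay \<subseteq> carrier G \<times> carrier G" by (auto simp: cayley_graph_def)
  show sym: "sym cay" by (auto simp: cayley_graph_def sym_def)
  have from_one: "(cls [], cls w) \<in> cay\<^sup>*" if "w \<in> lists X" for w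
    using that
  proof (induction w rule: rev_induct)
    case (snoc x w)
    then have "(cls [], cls w) \<in> cay\<^sup>*" "(cls w, cls (w @ [x])) \<in> cay"
      using cay_edge by auto
    then show ?case by (rule rtrancl.rtrancl_into_rtrancl)
  qed simp
  have "sym (cay\<^sup>*)" using sym by (rule sym_rtrancl)
  then show "(g, h) \<in> cay\<^sup>*" if "g \<in> carrier G" "h \<in> carrier G" for g h
    using that from_one by (clarsimp simp: carrier_G) (meson rtrancl_trans symD)
qed

text \<open>The integral along the path in the Cayley graph that starts at the class of
  \<open>u\<close> and reads \<open>w\<close>.\<close>

definition word_sum :: "('a list set \<Rightarrow> int) \<Rightarrow> ('a list set \<Rightarrow> int) \<Rightarrow> 'a list \<Rightarrow> 'a list \<Rightarrow> int" where
  "word_sum f g u w = (\<Sum>i<length w. edge_form f g (cls (u @ take i w)) (cls (u @ take (Suc i) w)))"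

lemma walk_word:
  assumes "\<And>i. i < n \<Longrightarrow> (c i, c (Suc i)) \<in> cay" "c 0 \<in> carrier G"
  obtains u w where "u \<in> lists X" "w \<in> lists X" "length w = n"
    "\<And>i. i \<le> n \<Longrightarrow> c i = cls (u @ take i w)"
proof -
  obtain u where u: "u \<in> lists X" "c 0 = cls u" using assms by (auto simp: carrier_G)
  have "\<exists>w\<in>lists X. length w = n \<and> (\<forall>i\<le>n. c i = cls (u @ take i w))"
    using assms(1)
  proof (induction n)
    case 0 then show ?case using u by auto
  next
    case (Suc n)
    then obtain w where w: "w \<in> lists X" "length w = n" "\<forall>i\<le>n. c i = cls (u @ take i w)"
      by (metis less_Suc_eq)
    have "(cls (u @ w), c (Suc n)) \<in> cay" using Suc.prems[of n] w by simp
    then obtain x where x: "x \<in> X" "c (Suc n) = cls (u @ w @ [x])"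
      using cay_edge_word[of "u @ w"] u w by (metis append.assoc lists_append_iff)
    show ?case using w x by (intro bexI[of _ "w @ [x]"]) (auto simp: le_Suc_eq)
  qed
  with u that show thesis by blast
qed

text \<open>Every walk in the Cayley graph reads some word, and if the walk is closed, this word is
  trivial in \<open>G\<close> by cancellation on the left.\<close>

lemma linear_fillingI:
  assumes "\<And>f g u w. lipschitz_on_edges cay f \<Longrightarrow> lipschitz_on_edges cay g \<Longrightarrow> u \<in> lists X \<Longrightarrow>
    w \<approx> [] \<Longrightarrow> \<bar>word_sum f g u w\<bar> \<le> int (C * length w)"
  shows "linear_filling cay C"
  unfolding linear_filling_def
proof (intro allI impI)
  fix f g c n
  assume lip: "lipschitz_on_edges cay f" "lipschitz_on_edges cay g"
    and c: "\<forall>i<n. (c i, c (Suc i)) \<in> cay" "c n = c 0"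
  show "\<bar>\<Sum>i<n. edge_form f g (c i) (c (Suc i))\<bar> \<le> int (C * n)"
  proof (cases n)
    case (Suc m)
    then have "c 0 \<in> carrier G" using c by (auto simp: cayley_graph_def)
    then obtain u w where w: "u \<in> lists X" "w \<in> lists X" "length w = n"
      "\<And>i. i \<le> n \<Longrightarrow> c i = cls (u @ take i w)"
      using walk_word c(1) by blast
    have "cls (u @ w) = cls (u @ [])" using c(2) w(3) w(4)[of 0] w(4)[of n] by simp
    then have "w \<approx> []" using cls_eq_iff word_eq_cancel_left w by (metis lists_append_iff)
    moreover have "word_sum f g u w = (\<Sum>i<n. edge_form f g (c i) (c (Suc i)))"
      unfolding word_sum_def w(3) by (rule sum.cong) (auto simp: w(4))
    ultimately show ?thesis using assms[OF lip w(1), of w] w(3) by simp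
  qed simp
qed

lemma hyperbolic_of_linear_filling:
  assumes "finite (pcarrier P)" "linear_filling cay C"
  shows "hyperbolic_group G"
  unfolding hyperbolic_group_def
  using group_G generate_gens gens_sub assms
    connected_graph.linear_filling_slim[OF cay_graph assms(2)]
  by (intro conjI exI[of _ gens]) (auto simp: pgens_def)

end

section \<open>Spanning trees of planar maps\<close>

lemma orbit_cycle:
  assumes "permutation f"
  shows "card (orbit f x) > 0" "(f ^^ card (orbit f x)) x = x"
    "inj_on (\<lambda>i. (f ^^ i) x) {..<card (orbit f x)}"
    "orbit f x = (\<lambda>i. (f ^^ i) x) ` {..<card (orbit f x)}"
proof -
  have self: "x \<in> orbit f x" by (rule permutation_self_in_orbit[OF assms])
  define n where "n = funpow_dist1 f x x"
  have img: "orbit f x = (\<lambda>i. (f ^^ i) x) ` {..<n}"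
    using orbit_conv_funpow_dist1[OF self] by (simp add: n_def lessThan_atLeast0)
  have inj: "inj_on (\<lambda>i. (f ^^ i) x) {..<n}"
    using inj_on_funpow_dist1[OF self] by (simp add: n_def lessThan_atLeast0)
  have n: "card (orbit f x) = n" using card_image[OF inj] img by simp
  show "card (orbit f x) > 0" using n by (simp add: n_def)
  show "(f ^^ card (orbit f x)) x = x" unfolding n n_def using funpow_dist1_prop[OF self] .
  show "inj_on (\<lambda>i. (f ^^ i) x) {..<card (orbit f x)}" using inj n by simp
  show "orbit f x = (\<lambda>i. (f ^^ i) x) ` {..<card (orbit f x)}" using img n by simp
qed

lemma finite_max_ex:
  fixes h :: "'v \<Rightarrow> nat"
  assumes "finite W" "W \<noteq> {}" obtains v where "v \<in> W" "\<And>w. w \<in> W \<Longrightarrow> h w \<le> h v"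
proof -
  have "Max (h ` W) \<in> h ` W" using assms by (intro Max_in) auto
  then obtain v where "v \<in> W" "h v = Max (h ` W)" by auto
  with that assms show thesis by simp
qed

text \<open>Breadth-first search: \<open>p v\<close> is a dart of \<open>B\<close> leaving \<open>v\<close> towards the root.\<close>

lemma spanning_tree:
  fixes s :: "'d \<Rightarrow> 'v" and r :: "'d \<Rightarrow> 'd"
  assumes invol: "\<And>e. e \<in> B \<Longrightarrow> r e \<in> B \<and> r (r e) = e"
    and conn: "\<And>v. v \<in> N \<Longrightarrow> (v0, v) \<in> {(s e, s (r e)) | e. e \<in> B}\<^sup>*"
  obtains h :: "'v \<Rightarrow> nat" and p where
    "\<And>v. v \<in> N \<Longrightarrow> v \<noteq> v0 \<Longrightarrow> p v \<in> B \<and> s (p v) = v \<and> Suc (h (s (r (p v)))) = h v"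
proof -
  define rel where "rel = {(s e, s (r e)) | e. e \<in> B}"
  define h where "h v = (LEAST k. (v0, v) \<in> rel ^^ k)" for v
  have le: "h v \<le> k" if "(v0, v) \<in> rel ^^ k" for v k
    using that by (auto simp: h_def intro: Least_le)
  have "\<exists>e. e \<in> B \<and> s e = v \<and> Suc (h (s (r e))) = h v" if v: "v \<in> N" "v \<noteq> v0" for v
  proof -
    have "\<exists>k. (v0, v) \<in> rel ^^ k"
      using conn[OF v(1)] by (simp add: rel_def rtrancl_imp_relpow)
    then have hv: "(v0, v) \<in> rel ^^ h v" unfolding h_def by (rule LeastI_ex)
    then have "h v \<noteq> 0" using v by (metis relpow_0_E)
    then obtain j where j: "h v = Suc j" using not0_implies_Suc by blast
    then obtain u where u: "(v0, u) \<in> rel ^^ j" "(u, v) \<in> rel" using hv by auto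
    then obtain e where e: "e \<in> B" "u = s e" "v = s (r e)" by (auto simp: rel_def)
    have root_u: "(v0, u) \<in> rel ^^ h u" unfolding h_def by (rule LeastI[of _ j]) (rule u)
    have "h u \<le> j" using le u by blast
    moreover have "h v \<le> Suc (h u)"
      by (rule le) (use root_u u(2) in auto)
    ultimately show ?thesis using e invol[of e] j by (intro exI[of _ "r e"]) simp
  qed
  then show thesis using that by metis
qed

locale plane_map =
  fixes \<Gamma> :: "'a diagram"
  assumes planar: "planar_map \<Gamma>"
begin

abbreviation "A \<equiv> ddarts \<Gamma>"
abbreviation "rv \<equiv> dinv \<Gamma>"
abbreviation "nx \<equiv> dnext \<Gamma>"
abbreviation "tl_v \<equiv> dtail \<Gamma>"
abbreviation "V \<equiv> dverts \<Gamma>"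
abbreviation "fc \<equiv> orbit nx"
abbreviation "edge \<equiv> (\<lambda>e. {e, rv e})"

lemma fin: "finite V" "V \<noteq> {}" "finite A"
  and rv: "\<And>e. e \<in> A \<Longrightarrow> rv e \<in> A \<and> rv e \<noteq> e \<and> rv (rv e) = e"
  and nx_permutes: "nx permutes A"
  and tail: "\<And>e. e \<in> A \<Longrightarrow> tl_v e \<in> V \<and> tl_v (nx e) = tl_v (rv e)"
  and vertex_orbit: "\<And>e e'. e \<in> A \<Longrightarrow> e' \<in> A \<Longrightarrow> tl_v e = tl_v e' \<Longrightarrow> e' \<in> orbit (nx \<circ> rv) e"
  and vertex_conn: "\<And>u v. u \<in> V \<Longrightarrow> v \<in> V \<Longrightarrow> (u, v) \<in> {(tl_v e, tl_v (rv e)) | e. e \<in> A}\<^sup>*"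
  and ext: "A \<noteq> {} \<Longrightarrow> dext \<Gamma> \<in> dfaces \<Gamma>" "A = {} \<Longrightarrow> dext \<Gamma> = {}"
  and euler: "int (card V) - int (card (dedges \<Gamma>)) + int (card (int_faces \<Gamma>)) = 1"
  using planar unfolding planar_map_def by (auto simp: permutes_in_image split: if_splits)

lemma nx_perm: "permutation nx"
  using nx_permutes fin by (auto simp: permutation_permutes)

lemma nx_in: "e \<in> A \<Longrightarrow> nx e \<in> A"
  using nx_permutes by (simp add: permutes_in_image)

lemma self_fc: "e \<in> fc e"
  by (rule permutation_self_in_orbit[OF nx_perm])

lemma fc_eqI: "e' \<in> fc e \<Longrightarrow> fc e' = fc e"
  by (meson cyclic_on_orbit' nx_perm orbit_cyclic_eq3)

lemma fc_nx: "fc (nx e) = fc e"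
  by (rule permutation_orbit_step[OF nx_perm])

lemma fc_sub: "e \<in> A \<Longrightarrow> fc e \<subseteq> A"
  by (rule permutes_orbit_subset[OF nx_permutes])

lemma face_of: "f \<in> dfaces \<Gamma> \<Longrightarrow> e \<in> f \<Longrightarrow> f = fc e \<and> e \<in> A"
  unfolding dfaces_def using fc_eqI fc_sub by blast

lemma fc_face: "e \<in> A \<Longrightarrow> fc e \<in> dfaces \<Gamma>"
  by (simp add: dfaces_def)

lemma face_nonempty: "f \<in> dfaces \<Gamma> \<Longrightarrow> f \<noteq> {}"
  using self_fc by (auto simp: dfaces_def)

lemma face_sub: "f \<in> dfaces \<Gamma> \<Longrightarrow> f \<subseteq> A"
  using face_of by auto

lemma fin_faces: "finite (dfaces \<Gamma>)" "finite (int_faces \<Gamma>)" "finite (dedges \<Gamma>)"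
  using fin by (auto simp: dfaces_def int_faces_def dedges_def)

lemma fin_face: "f \<in> dfaces \<Gamma> \<Longrightarrow> finite f"
  using face_sub fin finite_subset by blast

lemma int_face: "f \<in> int_faces \<Gamma> \<longleftrightarrow> f \<in> dfaces \<Gamma> \<and> f \<noteq> dext \<Gamma>"
  by (simp add: int_faces_def)

lemma rv_fixed: "e \<notin> A \<Longrightarrow> rv e = e"
  using planar by (auto simp: planar_map_def permutes_def)

lemma edge_eq_iff: "e \<in> A \<Longrightarrow> e' \<in> A \<Longrightarrow> edge e = edge e' \<longleftrightarrow> e = e' \<or> e = rv e'"
  using rv by (auto simp: doubleton_eq_iff)

lemma edge_rv: "e \<in> A \<Longrightarrow> edge (rv e) = edge e"
  using rv by auto

text \<open>The map \<open>nx \<circ> rv\<close> turns around a vertex. So such a set contains all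
  darts at a vertex as soon as it contains one of them, and reversal carries it to the neighbouring
  vertices.\<close>

lemma darts_connected:
  assumes S: "S \<subseteq> A" "S \<noteq> {}" and cl: "\<And>e. e \<in> S \<Longrightarrow> nx e \<in> S" "\<And>e. e \<in> S \<Longrightarrow> rv e \<in> S"
  shows "S = A"
proof -
  have orb: "e' \<in> S" if "e \<in> S" "e' \<in> orbit (nx \<circ> rv) e" for e e'
    using that(2,1) by induction (auto intro: cl)
  have same: "e' \<in> S" if "e \<in> S" "e' \<in> A" "tl_v e = tl_v e'" for e e'
    using orb vertex_orbit that S by blast
  obtain e0 where e0: "e0 \<in> S" using S by blast
  have reach: "\<forall>e\<in>A. tl_v e = v \<longrightarrow> e \<in> S"
    if "(tl_v e0, v) \<in> {(tl_v e, tl_v (rv e)) | e. e \<in> A}\<^sup>*" for v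
    using that
  proof induction
    case base then show ?case using same e0 by metis
  next
    case (step u v)
    then obtain e where "e \<in> A" "u = tl_v e" "v = tl_v (rv e)" by auto
    then show ?case using step.IH same[of "rv e"] cl rv by (metis (no_types))
  qed
  have "e \<in> S" if "e \<in> A" for e
    using reach[of "tl_v e"] vertex_conn[of "tl_v e0" "tl_v e"] tail e0 S that by auto
  then show ?thesis using S by auto
qed

text \<open>Whether the face of a dart can be reached is not changed by \<open>nx\<close>, which
  stays in the face, or by \<open>rv\<close>, which crosses an edge. So
  \<open>darts_connected\<close> applies.\<close>

lemma dual_connected:
  assumes "f \<in> dfaces \<Gamma>"
  shows "(dext \<Gamma>, f) \<in> {(fc e, fc (rv e)) | e. e \<in> A}\<^sup>*"
proof -
  define S where "S = {e \<in> A. (dext \<Gamma>, fc e) \<in> {(fc e, fc (rv e)) | e. e \<in> A}\<^sup>*}"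
  have "A \<noteq> {}" using assms by (auto simp: dfaces_def)
  then obtain e0 where e0: "e0 \<in> A" "dext \<Gamma> = fc e0" using ext by (auto simp: dfaces_def)
  then have "e0 \<in> S" by (auto simp: S_def)
  then have "S = A"
  proof (intro darts_connected)
    show "nx e \<in> S" if "e \<in> S" for e using that fc_nx nx_in by (auto simp: S_def)
    show "rv e \<in> S" if "e \<in> S" for e
      using that rv unfolding S_def by (auto intro: rtrancl_into_rtrancl)
  qed (auto simp: S_def)
  then show ?thesis using assms by (auto simp: dfaces_def S_def)
qed

text \<open>An edge chosen by both of its ends would make each of them higher than the
  other.\<close>

lemma edge_injective:
  fixes h :: "'v \<Rightarrow> nat"
  assumes p: "\<And>v. v \<in> N \<Longrightarrow> p v \<in> A \<and> s (p v) = v \<and> Suc (h (s (rv (p v)))) = h v"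
  shows "inj_on (\<lambda>v. edge (p v)) N"
proof (rule inj_onI)
  fix v w assume vw: "v \<in> N" "w \<in> N" and eq: "edge (p v) = edge (p w)"
  then consider "p v = p w" | "p v = rv (p w)" using p edge_eq_iff by blast
  then show "v = w"
  proof cases
    case 1 then show ?thesis using p vw by metis
  next
    case 2
    then have "rv (p v) = p w" using p vw rv by simp
    then have "Suc (h w) = h v" "Suc (h v) = h w" using p[OF vw(1)] p[OF vw(2)] 2 by auto
    then show ?thesis by simp
  qed
qed

text \<open>Suppose that some faces cannot be reached from the external one without crossing the spanning
  tree, and let \<open>v\<close> be the deepest vertex whose tree edge separates the reached faces from the
  others. Then exactly one of the edges at \<open>v\<close> separates the two classes, which is absurd, as the
  faces around \<open>v\<close> are in cyclic order.\<close>

lemma dual_of_tree_connected: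
  fixes h :: "nat \<Rightarrow> nat"
  assumes p: "\<And>v. v \<in> V - {v0} \<Longrightarrow> p v \<in> A \<and> tl_v (p v) = v \<and> Suc (h (tl_v (rv (p v)))) = h v"
    and f: "f \<in> dfaces \<Gamma>"
  shows "(dext \<Gamma>, f) \<in> {(fc e, fc (rv e)) | e. e \<in> A \<and> edge e \<notin> (\<lambda>v. edge (p v)) ` (V - {v0})}\<^sup>*"
proof -
  define T where "T = (\<lambda>v. edge (p v)) ` (V - {v0})"
  define rel where "rel = {(fc e, fc (rv e)) | e. e \<in> A \<and> edge e \<notin> T}"
  define S where "S = {e \<in> A. (dext \<Gamma>, fc e) \<in> rel\<^sup>*}"
  define W where "W = {v \<in> V - {v0}. (p v \<in> S) \<noteq> (rv (p v) \<in> S)}"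
  have "A \<noteq> {}" using f by (auto simp: dfaces_def)
  then obtain e0 where e0: "e0 \<in> A" "dext \<Gamma> = fc e0" using ext by (auto simp: dfaces_def)
  then have "e0 \<in> S" by (auto simp: S_def)
  have S_nx: "nx e \<in> S \<longleftrightarrow> e \<in> S" if "e \<in> A" for e using that fc_nx nx_in by (auto simp: S_def)
  have cross: "rv e \<in> S" if "e \<in> S" "edge e \<notin> T" for e
    using that rv unfolding S_def rel_def by (auto intro: rtrancl_into_rtrancl)
  \<comment> \<open>An edge outside the tree can be crossed, so its two sides are in the same class;
    a separating dart is therefore the tree edge of some vertex in \<open>W\<close>.\<close>
  have sep: "\<exists>v\<in>W. e = p v \<or> e = rv (p v)" if e: "e \<in> A" "(e \<in> S) \<noteq> (rv e \<in> S)" for e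
  proof -
    have "edge e \<in> T" using cross[of e] cross[of "rv e"] e rv edge_rv by metis
    then obtain v where v: "v \<in> V - {v0}" "edge e = edge (p v)" by (auto simp: T_def)
    then have "e = p v \<or> e = rv (p v)" using edge_eq_iff p e by blast
    moreover have "v \<in> W" using v calculation e(2) p rv unfolding W_def by auto
    ultimately show ?thesis by blast
  qed
  have "W = {}"
  proof (rule ccontr)
    assume "W \<noteq> {}"
    moreover have "finite W" using fin by (simp add: W_def)
    ultimately obtain v where v: "v \<in> W" "\<And>w. w \<in> W \<Longrightarrow> h w \<le> h v"
      using finite_max_ex[of W h] by blast
    define \<rho> where "\<rho> = nx \<circ> rv"
    define d0 where "d0 = p v"
    have v': "v \<in> V - {v0}" using v by (simp add: W_def)
    have d0: "d0 \<in> A" "tl_v d0 = v" "(d0 \<in> S) \<noteq> (rv d0 \<in> S)"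
      using v p by (auto simp: d0_def W_def)
    have at_v: "\<rho> d \<in> A \<and> tl_v (\<rho> d) = v \<and> (\<rho> d \<in> S \<longleftrightarrow> rv d \<in> S)"
      if "d \<in> A" "tl_v d = v" for d
      using that rv[of d] nx_in[of "rv d"] tail[of "rv d"] S_nx[of "rv d"] by (simp add: \<rho>_def)
    \<comment> \<open>Any other tree edge at \<open>v\<close> belongs to a child of
      \<open>v\<close>, which is deeper than \<open>v\<close> and hence not in
      \<open>W\<close>.\<close>
    have keep: "rv d \<in> S \<longleftrightarrow> d \<in> S" if d: "d \<in> A" "tl_v d = v" "d \<noteq> d0" for d
    proof (rule ccontr)
      assume "(rv d \<in> S) \<noteq> (d \<in> S)"
      then obtain w where w: "w \<in> W" "d = p w \<or> d = rv (p w)" using sep[of d] d by auto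
      have w': "w \<in> V - {v0}" using w by (simp add: W_def)
      from w(2) show False
      proof
        assume "d = p w"
        then show False using p[OF w'] d by (simp add: d0_def)
      next
        assume "d = rv (p w)"
        then have "Suc (h v) = h w" using p[OF w'] d by simp
        then show False using v(2)[OF w(1)] by simp
      qed
    qed
    \<comment> \<open>Turning around \<open>v\<close> from \<open>\<rho> d0\<close> until the first
      return to \<open>d0\<close> crosses no separating edge, so the class never changes. But
      \<open>\<rho> d0\<close> is in the face of \<open>rv d0\<close>, which the edge of
      \<open>d0\<close> separates from the face of \<open>d0\<close>.\<close>
    have "d0 \<in> orbit \<rho> (\<rho> d0)"
      using vertex_orbit[of "\<rho> d0" d0] at_v[OF d0(1,2)] d0 by (simp add: \<rho>_def)
    then have ex: "\<exists>n. (\<rho> ^^ n) (\<rho> d0) = d0" by (auto simp: orbit_altdef) metis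
    define n where "n = (LEAST n. (\<rho> ^^ n) (\<rho> d0) = d0)"
    have n: "(\<rho> ^^ n) (\<rho> d0) = d0" unfolding n_def by (rule LeastI_ex[OF ex])
    have "(\<rho> ^^ i) (\<rho> d0) \<in> A \<and> tl_v ((\<rho> ^^ i) (\<rho> d0)) = v \<and> ((\<rho> ^^ i) (\<rho> d0) \<in> S \<longleftrightarrow> \<rho> d0 \<in> S)"
      if "i \<le> n" for i
      using that
    proof (induction i)
      case 0 then show ?case using at_v d0 by simp
    next
      case (Suc i)
      have "(\<rho> ^^ i) (\<rho> d0) \<noteq> d0"
        using not_less_Least[of i "\<lambda>n. (\<rho> ^^ n) (\<rho> d0) = d0"] Suc.prems by (simp add: n_def)
      then show ?case using at_v keep Suc by simp
    qed
    from this[of n] n have "d0 \<in> S \<longleftrightarrow> \<rho> d0 \<in> S" by simp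
    then show False using d0 at_v by blast
  qed
  then have "S = A"
    using \<open>e0 \<in> S\<close> S_nx sep by (intro darts_connected) (auto simp: S_def)
  then show ?thesis using f unfolding S_def rel_def T_def by (auto simp: dfaces_def)
qed

text \<open>The edges outside a spanning tree form a spanning tree of the dual graph, by the formula of
  Euler. If a set \<open>B\<close> of such edges is not empty, the deepest face whose dual tree edge lies in \<open>B\<close>
  has only this dart in \<open>B\<close>.\<close>

lemma tree_cotree:
  obtains v0 p and h :: "nat \<Rightarrow> nat" where
    "v0 \<in> V" "\<forall>v\<in>V - {v0}. p v \<in> A \<and> tl_v (p v) = v \<and> Suc (h (tl_v (rv (p v)))) = h v"
    "\<forall>B. B \<noteq> {} \<longrightarrow> B \<subseteq> A \<longrightarrow> (\<forall>e\<in>B. rv e \<in> B) \<longrightarrow> (\<forall>v\<in>V - {v0}. p v \<notin> B) \<longrightarrow>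
       (\<exists>f\<in>int_faces \<Gamma>. \<exists>d\<in>f. f \<inter> B = {d})"
proof -
  obtain v0 where v0: "v0 \<in> V" using fin by blast
  obtain h :: "nat \<Rightarrow> nat" and p where
    p0: "\<And>v. v \<in> V \<Longrightarrow> v \<noteq> v0 \<Longrightarrow> p v \<in> A \<and> tl_v (p v) = v \<and> Suc (h (tl_v (rv (p v)))) = h v"
  proof (rule spanning_tree[of A rv V v0 tl_v])
    show "rv e \<in> A \<and> rv (rv e) = e" if "e \<in> A" for e using rv that by blast
    show "(v0, v) \<in> {(tl_v e, tl_v (rv e)) | e. e \<in> A}\<^sup>*" if "v \<in> V" for v
      using vertex_conn v0 that by blast
  qed (blast intro: that)
  then have p: "\<And>v. v \<in> V - {v0} \<Longrightarrow> p v \<in> A \<and> tl_v (p v) = v \<and> Suc (h (tl_v (rv (p v)))) = h v"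
    by auto
  define T where "T = (\<lambda>v. edge (p v)) ` (V - {v0})"
  have T: "T \<subseteq> dedges \<Gamma>" using p by (auto simp: T_def dedges_def)
  have "inj_on (\<lambda>v. edge (p v)) (V - {v0})"
    using edge_injective[of "V - {v0}" p tl_v h] p by blast
  then have cT: "card T = card V - 1" using card_image v0 fin by (fastforce simp: T_def)
  have "\<exists>f\<in>int_faces \<Gamma>. \<exists>d\<in>f. f \<inter> B = {d}"
    if B: "e0 \<in> B" "B \<subseteq> A" "\<And>e. e \<in> B \<Longrightarrow> rv e \<in> B" "\<And>v. v \<in> V - {v0} \<Longrightarrow> p v \<notin> B" for B e0
  proof -
    define A' where "A' = {e \<in> A. edge e \<notin> T}"
    have A': "rv e \<in> A' \<and> rv (rv e) = e" if "e \<in> A'" for e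
      using that rv edge_rv unfolding A'_def by auto
    have "{(fc e, fc (rv e)) | e. e \<in> A'} = {(fc e, fc (rv e)) | e. e \<in> A \<and> edge e \<notin> T}"
      by (auto simp: A'_def)
    then have conn: "(dext \<Gamma>, f) \<in> {(fc e, fc (rv e)) | e. e \<in> A'}\<^sup>*" if "f \<in> dfaces \<Gamma>" for f
      using dual_of_tree_connected[OF p that] by (simp add: T_def)
    obtain h' :: "nat set \<Rightarrow> nat" and q where
      q0: "\<And>f. f \<in> dfaces \<Gamma> \<Longrightarrow> f \<noteq> dext \<Gamma> \<Longrightarrow> q f \<in> A' \<and> fc (q f) = f \<and> Suc (h' (fc (rv (q f)))) = h' f"
    proof (rule spanning_tree[of A' rv "dfaces \<Gamma>" "dext \<Gamma>" fc])
      show "rv e \<in> A' \<and> rv (rv e) = e" if "e \<in> A'" for e by (rule A'[OF that])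
      show "(dext \<Gamma>, f) \<in> {(fc e, fc (rv e)) | e. e \<in> A'}\<^sup>*" if "f \<in> dfaces \<Gamma>" for f
        by (rule conn[OF that])
    qed (blast intro: that)
    then have q: "q f \<in> A \<and> fc (q f) = f \<and> Suc (h' (fc (rv (q f)))) = h' f" "edge (q f) \<notin> T"
      if "f \<in> int_faces \<Gamma>" for f
      using that by (auto simp: int_face A'_def)
    have inj: "inj_on (\<lambda>f. edge (q f)) (int_faces \<Gamma>)"
      using edge_injective[of "int_faces \<Gamma>" q fc h'] q by blast
    have sub: "(\<lambda>f. edge (q f)) ` int_faces \<Gamma> \<subseteq> dedges \<Gamma> - T"
      using q by (auto simp: dedges_def)
    have "card (dedges \<Gamma> - T) = card (int_faces \<Gamma>)"
    proof -
      have "card (dedges \<Gamma> - T) = card (dedges \<Gamma>) - card T"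
        using T fin_faces by (meson card_Diff_subset finite_subset)
      moreover have "card T \<le> card (dedges \<Gamma>)" using T fin_faces by (simp add: card_mono)
      moreover have "card V \<ge> 1" using fin by (simp add: Suc_le_eq card_gt_0_iff)
      ultimately show ?thesis using euler cT by simp
    qed
    \<comment> \<open>Injectivity and equal cardinality: every edge outside the tree is the dual
      tree edge of exactly one internal face.\<close>
    then have onto: "(\<lambda>f. edge (q f)) ` int_faces \<Gamma> = dedges \<Gamma> - T"
      using card_subset_eq[OF _ sub] fin_faces card_image[OF inj] by simp
    have dual_edge: "\<exists>f\<in>int_faces \<Gamma>. (d = q f \<or> d = rv (q f)) \<and> q f \<in> B" if d: "d \<in> B" for d
    proof -
      have dA: "d \<in> A" using d B by auto
      have "edge d \<notin> T"
      proof
        assume "edge d \<in> T"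
        then obtain v where v: "v \<in> V - {v0}" "edge d = edge (p v)" by (auto simp: T_def)
        then have "d = p v \<or> d = rv (p v)" using edge_eq_iff p dA by blast
        then have "p v \<in> B" using d B(3)[of d] p[OF v(1)] rv by auto
        then show False using B(4) v by blast
      qed
      then have "edge d \<in> (\<lambda>f. edge (q f)) ` int_faces \<Gamma>" using onto dA by (auto simp: dedges_def)
      then obtain f where f: "f \<in> int_faces \<Gamma>" "edge d = edge (q f)" by blast
      then have "d = q f \<or> d = rv (q f)" using edge_eq_iff q dA by blast
      moreover have "q f \<in> B" using calculation d B(3)[of d] q[OF f(1)] rv by auto
      ultimately show ?thesis using f by blast
    qed
    define F where "F = {f \<in> int_faces \<Gamma>. q f \<in> B}"
    have "F \<noteq> {}" "finite F" using dual_edge[OF B(1)] fin_faces by (auto simp: F_def)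
    then obtain f where f: "f \<in> F" "\<And>g. g \<in> F \<Longrightarrow> h' g \<le> h' f"
      using finite_max_ex[of F h'] by blast
    have fi: "f \<in> int_faces \<Gamma>" "q f \<in> B" using f by (auto simp: F_def)
    have "q f \<in> f" using q[OF fi(1)] self_fc by metis
    moreover have "d = q f" if d: "d \<in> f" "d \<in> B" for d
    proof -
      obtain g where g: "g \<in> int_faces \<Gamma>" "d = q g \<or> d = rv (q g)" "q g \<in> B"
        using dual_edge d by blast
      have fd: "fc d = f" using face_of[of f d] fi d by (simp add: int_face)
      from g(2) show ?thesis
      proof
        assume "d = q g" then show ?thesis using q[OF g(1)] fd by simp
      next
        \<comment> \<open>Then \<open>f\<close> is the parent of \<open>g\<close> in the dual tree,
          so \<open>g\<close> is deeper than \<open>f\<close>, against the choice of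
          \<open>f\<close>.\<close>
        assume "d = rv (q g)"
        then have "Suc (h' f) = h' g" using q[OF g(1)] fd by simp
        then show ?thesis using f(2)[of g] g by (simp add: F_def)
      qed
    qed
    ultimately show ?thesis using fi by blast
  qed
  note main = this
  show thesis
  proof (rule that)
    show "v0 \<in> V" by (rule v0)
    show "\<forall>v\<in>V - {v0}. p v \<in> A \<and> tl_v (p v) = v \<and> Suc (h (tl_v (rv (p v)))) = h v"
      using p by blast
    show "\<forall>B. B \<noteq> {} \<longrightarrow> B \<subseteq> A \<longrightarrow> (\<forall>e\<in>B. rv e \<in> B) \<longrightarrow> (\<forall>v\<in>V - {v0}. p v \<notin> B) \<longrightarrow>
       (\<exists>f\<in>int_faces \<Gamma>. \<exists>d\<in>f. f \<inter> B = {d})"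
    proof (intro allI impI)
      fix B assume B: "B \<noteq> {}" "B \<subseteq> A" "\<forall>e\<in>B. rv e \<in> B" "\<forall>v\<in>V - {v0}. p v \<notin> B"
      then obtain e where "e \<in> B" by blast
      then show "\<exists>f\<in>int_faces \<Gamma>. \<exists>d\<in>f. f \<inter> B = {d}"
        by (rule main) (use B in blast)+
    qed
  qed
qed

section \<open>Labels of faces\<close>

lemma face_word_length: "length (face_word \<Gamma> e) = card (fc e)"
  by (simp add: face_word_def)

lemma face_word_nth: "i < card (fc e) \<Longrightarrow> face_word \<Gamma> e ! i = dlab \<Gamma> ((nx ^^ i) e)"
  by (simp add: face_word_def)

lemma face_word_nx: "face_word \<Gamma> (nx e) = rotate1 (face_word \<Gamma> e)"
proof (rule nth_equalityI)
  fix i assume "i < length (face_word \<Gamma> (nx e))"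
  then have i: "i < card (fc e)" by (simp add: face_word_length fc_nx)
  have "(nx ^^ i) (nx e) = (nx ^^ (Suc i mod card (fc e))) e"
  proof (cases "Suc i = card (fc e)")
    case True
    then show ?thesis using orbit_cycle(2)[OF nx_perm, of e] by (metis funpow_swap1 funpow_0 funpow.simps(2) comp_apply mod_self)
  next
    case False
    then show ?thesis using i by (simp add: funpow_swap1)
  qed
  then show "face_word \<Gamma> (nx e) ! i = rotate1 (face_word \<Gamma> e) ! i"
    using i by (simp add: face_word_nth fc_nx nth_rotate1 face_word_length)
qed (simp add: face_word_length fc_nx)

end

section \<open>The potential of a diagram\<close>

text \<open>Around a closed path the increments of \<open>g\<close> cancel, so \<open>f\<close> may
  be lowered by the constant \<open>f (c 0)\<close>. After that each of the \<open>n\<close> edges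
  contributes at most \<open>2 * n\<close>, because \<open>f\<close> changes by at most one per
  edge.\<close>

lemma short_loop:
  fixes f g :: "'b \<Rightarrow> int"
  assumes f: "\<And>i. i < n \<Longrightarrow> \<bar>f (c i) - f (c (Suc i))\<bar> \<le> 1"
    and g: "\<And>i. i < n \<Longrightarrow> \<bar>g (c i) - g (c (Suc i))\<bar> \<le> 1"
    and closed: "c n = c 0"
  shows "\<bar>\<Sum>i<n. edge_form f g (c i) (c (Suc i))\<bar> \<le> 2 * int n ^ 2"
proof -
  have near: "\<bar>f (c i) - f (c 0)\<bar> \<le> int i" if "i \<le> n" for i
    using that
  proof (induction i)
    case (Suc i) then show ?case using f[of i] by simp
  qed simp
  have "(\<Sum>i<n. g (c (Suc i)) - g (c i)) = g (c n) - g (c 0)"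
    by (rule sum_lessThan_telescope)
  then have "(\<Sum>i<n. 2 * f (c 0) * (g (c (Suc i)) - g (c i))) = 0"
    using closed by (simp flip: sum_distrib_left)
  then have "(\<Sum>i<n. edge_form f g (c i) (c (Suc i)))
      = (\<Sum>i<n. (f (c i) + f (c (Suc i)) - 2 * f (c 0)) * (g (c (Suc i)) - g (c i)))"
    by (simp add: edge_form_def left_diff_distrib sum_subtractf)
  also have "\<bar>\<dots>\<bar> \<le> (\<Sum>i<n. \<bar>(f (c i) + f (c (Suc i)) - 2 * f (c 0)) * (g (c (Suc i)) - g (c i))\<bar>)"
    by (rule sum_abs)
  also have "\<dots> \<le> (\<Sum>i<n. 2 * int n)"
  proof (rule sum_mono)
    fix i assume "i \<in> {..<n}"
    then have "\<bar>f (c i) + f (c (Suc i)) - 2 * f (c 0)\<bar> \<le> 2 * int n" "\<bar>g (c (Suc i)) - g (c i)\<bar> \<le> 1"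
      using near[of i] near[of "Suc i"] g[of i] by auto
    then show "\<bar>(f (c i) + f (c (Suc i)) - 2 * f (c 0)) * (g (c (Suc i)) - g (c i))\<bar> \<le> 2 * int n"
      using mult_mono[of "\<bar>f (c i) + f (c (Suc i)) - 2 * f (c 0)\<bar>" "2 * int n" "\<bar>g (c (Suc i)) - g (c i)\<bar>" 1]
      by (simp add: abs_mult)
  qed
  finally show ?thesis by (simp add: power2_eq_square)
qed

lemma edge_form_swap: "edge_form f g b a = - edge_form f g a b"
  by (simp add: edge_form_def algebra_simps)

context word_presentation
begin

lemma word_eq_cancel_right:
  assumes "v @ u \<approx> v' @ u" shows "v \<approx> v'"
proof -
  have l: "u \<in> lists X" "v \<in> lists X" "v' \<in> lists X"
    using word_eq_lists[OF assms] by (auto simp: lists_append_iff)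
  have *: "w @ u @ inv_word P u \<approx> w" if "w \<in> lists X" for w
    using word_eq_append[OF word_eq.refl[OF that] inv_word_right[OF l(1)]] by simp
  have "v @ u @ inv_word P u \<approx> v' @ u @ inv_word P u"
    using word_eq_append[OF assms word_eq.refl[OF inv_word_lists[OF l(1)]]] by simp
  then show ?thesis using * l word_eq.sym word_eq.trans by metis
qed

lemma lipschitz_word:
  assumes "lipschitz_on_edges cay f" "u \<in> lists X" "x \<in> X"
  shows "\<bar>f (cls u) - f (cls (u @ [x]))\<bar> \<le> 1"
  using assms(1) cay_edge[OF assms(2,3)] by (auto simp: lipschitz_on_edges_def)

lemma take_lists: "w \<in> lists A \<Longrightarrow> take i w \<in> lists A"
  by (metis append_in_lists_conv append_take_drop_id)

lemma nth_lists: "w \<in> lists A \<Longrightarrow> i < length w \<Longrightarrow> w ! i \<in> A"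
  by (metis in_lists_conv_set nth_mem)

lemma word_sum_short:
  assumes lip: "lipschitz_on_edges cay f" "lipschitz_on_edges cay g" and u: "u \<in> lists X"
    and w: "w \<approx> []"
  shows "\<bar>word_sum f g u w\<bar> \<le> 2 * int (length w) ^ 2"
proof -
  have wl: "w \<in> lists X" using word_eq_lists w by blast
  have step: "\<bar>k (cls (u @ take i w)) - k (cls (u @ take (Suc i) w))\<bar> \<le> 1"
    if "lipschitz_on_edges cay k" "i < length w" for k i
    using lipschitz_word[OF that(1), of "u @ take i w" "w ! i"] that wl u
    by (simp add: take_Suc_conv_app_nth take_lists nth_lists)
  have "cls (u @ w) = cls (u @ [])"
    using word_eq_append[OF word_eq.refl[OF u] w] cls_eq_iff u wl by (metis lists_append_iff)
  then show ?thesis unfolding word_sum_def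
    by (intro short_loop step lip) auto
qed

end

text \<open>The colours are forgotten: Stokes only uses that the label of every internal face is
  trivial in \<open>G\<close>.\<close>

locale labelled_diagram = word_presentation P R + plane_map \<Gamma>
  for P :: "'a pregroup" and R :: "'a list set" and \<Gamma> :: "'a diagram" +
  assumes label: "e \<in> A \<Longrightarrow> dlab \<Gamma> e \<in> X \<and> dlab \<Gamma> (rv e) = sg (dlab \<Gamma> e)"
    and face_trivial: "f \<in> int_faces \<Gamma> \<Longrightarrow> \<exists>e\<in>f. face_word \<Gamma> e \<approx> []"
begin

abbreviation "lab \<equiv> dlab \<Gamma>"

lemma funpow_nx_in: "e \<in> A \<Longrightarrow> (nx ^^ i) e \<in> A"
  by (induction i) (auto intro: nx_in)

lemma face_word_lists: "e \<in> A \<Longrightarrow> face_word \<Gamma> e \<in> lists X"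
  by (auto simp: in_lists_conv_set face_word_def label funpow_nx_in)

text \<open>Reading the label from the next dart rotates it, and rotation is conjugation in
  \<open>G\<close>.\<close>

lemma face_word_trivial:
  assumes "f \<in> int_faces \<Gamma>" "e \<in> f" shows "face_word \<Gamma> e \<approx> []"
proof -
  obtain e0 where e0: "e0 \<in> f" "face_word \<Gamma> e0 \<approx> []" using face_trivial assms by blast
  have f: "f = fc e0" "e0 \<in> A" using face_of[of f e0] e0 assms by (auto simp: int_face)
  have step: "face_word \<Gamma> (nx e) \<approx> []" if e: "e \<in> A" "face_word \<Gamma> e \<approx> []" for e
  proof (cases "face_word \<Gamma> e")
    case (Cons x w)
    then have "w @ [x] \<approx> []"
      using trivial_conj[of "[x]" w] face_word_lists[OF e(1)] e(2) by simp
    then show ?thesis using Cons by (simp add: face_word_nx)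
  qed (use e in \<open>simp add: face_word_nx\<close>)
  have "e \<in> A \<and> face_word \<Gamma> e \<approx> []" if "e \<in> orbit nx e0" for e
    using that by induction (use step f e0 nx_in in auto)
  then show ?thesis using f assms by simp
qed

text \<open>The map that takes a vertex \<open>v\<close> to the class of \<open>\<pi> v\<close>
  sends the dart \<open>e\<close> to an edge of the Cayley graph with the same label.\<close>

definition good :: "(nat \<Rightarrow> 'a list) \<Rightarrow> nat \<Rightarrow> bool" where
  "good \<pi> e \<longleftrightarrow> \<pi> (tl_v e) @ [lab e] \<approx> \<pi> (tl_v (rv e))"

lemma good_rv:
  assumes "good \<pi> e" "e \<in> A" shows "good \<pi> (rv e)"
proof -
  have l: "\<pi> (tl_v e) \<in> lists X" "lab e \<in> X"
    using word_eq_lists[OF assms(1)[unfolded good_def]] by auto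
  have "[lab e, sg (lab e)] \<approx> []" using l by (intro relator_trivial) auto
  then have "\<pi> (tl_v e) @ [lab e, sg (lab e)] \<approx> \<pi> (tl_v e) @ []"
    using word_eq_append word_eq.refl l by blast
  moreover have "(\<pi> (tl_v e) @ [lab e]) @ [sg (lab e)] \<approx> \<pi> (tl_v (rv e)) @ [sg (lab e)]"
    using assms(1) l inv_gen unfolding good_def by (intro word_eq_append word_eq.refl) auto
  ultimately have "\<pi> (tl_v (rv e)) @ [sg (lab e)] \<approx> \<pi> (tl_v e)"
    by simp (meson word_eq.sym word_eq.trans)
  then show ?thesis using assms(2) rv label by (simp add: good_def)
qed

lemma good_path:
  assumes "e \<in> A" "\<And>i. i < n \<Longrightarrow> good \<pi> ((nx ^^ i) e)" "\<pi> (tl_v e) \<in> lists X"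
  shows "\<pi> (tl_v e) @ map (\<lambda>i. lab ((nx ^^ i) e)) [0..<n] \<approx> \<pi> (tl_v ((nx ^^ n) e))"
  using assms(2)
proof (induction n)
  case 0 then show ?case using assms by (simp add: word_eq.refl)
next
  case (Suc n)
  have e: "(nx ^^ n) e \<in> A" using assms funpow_nx_in by blast
  have "(\<pi> (tl_v e) @ map (\<lambda>i. lab ((nx ^^ i) e)) [0..<n]) @ [lab ((nx ^^ n) e)]
      \<approx> \<pi> (tl_v ((nx ^^ n) e)) @ [lab ((nx ^^ n) e)]"
    using Suc e label by (intro word_eq_append word_eq.refl) auto
  moreover have "\<pi> (tl_v ((nx ^^ n) e)) @ [lab ((nx ^^ n) e)] \<approx> \<pi> (tl_v ((nx ^^ Suc n) e))"
    using Suc.prems[of n] tail[OF e] by (simp add: good_def)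
  ultimately show ?case by (simp add: word_eq.trans)
qed

text \<open>Reading labels along a spanning tree defines \<open>\<pi>\<close> and makes the tree
  edges good. If bad edges remained, \<open>tree_cotree\<close> would give an internal face with
  exactly one bad dart; but its label is trivial and all its other darts are good, so this dart is
  good as well.\<close>

lemma potential_exists:
  obtains \<pi> where "\<And>v. v \<in> V \<Longrightarrow> \<pi> v \<in> lists X" "\<And>e. e \<in> A \<Longrightarrow> good \<pi> e"
proof -
  obtain v0 p and h :: "nat \<Rightarrow> nat" where v0: "v0 \<in> V"
    and p': "\<forall>v\<in>V - {v0}. p v \<in> A \<and> tl_v (p v) = v \<and> Suc (h (tl_v (rv (p v)))) = h v"
    and cotree: "\<forall>B. B \<noteq> {} \<longrightarrow> B \<subseteq> A \<longrightarrow> (\<forall>e\<in>B. rv e \<in> B) \<longrightarrow> (\<forall>v\<in>V - {v0}. p v \<notin> B) \<longrightarrow>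
       (\<exists>f\<in>int_faces \<Gamma>. \<exists>d\<in>f. f \<inter> B = {d})"
    by (rule tree_cotree)
  note p = bspec[OF p']
  define par where "par v = tl_v (rv (p v))" for v
  \<comment> \<open>Recursion along the parents, with the height as the number of steps allowed:
    \<open>n = h v\<close> steps suffice to reach the root from \<open>v\<close>.\<close>
  define pot where "pot n = rec_nat (\<lambda>v. [])
    (\<lambda>_ F v. if v = v0 then [] else F (par v) @ [lab (rv (p v))]) n" for n
  have pot_Suc: "pot (Suc n) v = (if v = v0 then [] else pot n (par v) @ [lab (rv (p v))])" for n v
    by (simp add: pot_def)
  have pot_0: "pot 0 v = []" for v by (simp add: pot_def)
  define \<pi> where "\<pi> v = pot (h v) v" for v
  have \<pi>_step: "\<pi> v = \<pi> (par v) @ [lab (rv (p v))]" if "v \<in> V - {v0}" for v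
  proof -
    have "h v = Suc (h (par v))" using p[OF that] by (simp add: par_def)
    then show ?thesis using that by (simp add: \<pi>_def pot_Suc)
  qed
  have pot_lists: "pot n v \<in> lists X" if "v \<in> V" for n v
    using that
  proof (induction n arbitrary: v)
    case 0 then show ?case by (simp add: pot_0)
  next
    case (Suc n)
    show ?case
    proof (cases "v = v0")
      case False
      then have "rv (p v) \<in> A" using p Suc.prems rv by simp
      then show ?thesis using Suc.IH[of "par v"] False label tail by (simp add: pot_Suc par_def)
    qed (simp add: pot_Suc)
  qed
  then have lists: "\<pi> v \<in> lists X" if "v \<in> V" for v using that by (simp add: \<pi>_def)
  have tree: "good \<pi> (p v)" if v: "v \<in> V - {v0}" for v
  proof -
    have "good \<pi> (rv (p v))"
      using \<pi>_step[OF v] lists[of v] v p[OF v] rv by (simp add: good_def par_def word_eq.refl)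
    then show ?thesis using good_rv[of \<pi> "rv (p v)"] p[OF v] rv by simp
  qed
  define B where "B = {e \<in> A. \<not> good \<pi> e}"
  have "B = {}"
  proof (rule ccontr)
    assume "B \<noteq> {}"
    moreover have "rv e \<in> B" if "e \<in> B" for e
      using that good_rv[of \<pi> "rv e"] rv by (auto simp: B_def)
    moreover have "p v \<notin> B" if "v \<in> V - {v0}" for v using tree[OF that] by (simp add: B_def)
    moreover have "B \<subseteq> A" by (auto simp: B_def)
    ultimately obtain f d where f: "f \<in> int_faces \<Gamma>" "d \<in> f" "f \<inter> B = {d}"
      using cotree by metis
    have dA: "d \<in> A" and fd: "f = fc d" and bad: "\<not> good \<pi> d"
      using f face_of[of f d] by (auto simp: int_face B_def)
    obtain n where n: "card (fc d) = Suc n"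
      using orbit_cycle(1)[OF nx_perm, of d] by (cases "card (fc d)") auto
    have word: "face_word \<Gamma> d = lab d # map (\<lambda>i. lab ((nx ^^ i) (nx d))) [0..<n]" (is "_ = _ # ?rest")
      unfolding face_word_def n
      by (simp only: upt_conv_Cons[OF zero_less_Suc] list.map map_Suc_upt[symmetric] map_map funpow_0)
        (simp add: o_def funpow_swap1)
    have ret: "(nx ^^ n) (nx d) = d"
      using orbit_cycle(2)[OF nx_perm, of d] n by (simp add: funpow_swap1)
    have good_i: "good \<pi> ((nx ^^ i) (nx d))" if "i < n" for i
    proof -
      have "(nx ^^ Suc i) d \<noteq> (nx ^^ 0) d"
        using inj_onD[OF orbit_cycle(3)[OF nx_perm, of d], of "Suc i" 0] that n
        by (auto simp del: funpow.simps)
      moreover have "(nx ^^ Suc i) d \<in> f" using fd funpow_in_orbit[OF self_fc] by blast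
      moreover have "(nx ^^ Suc i) d \<in> A" using dA funpow_nx_in by blast
      ultimately have "good \<pi> ((nx ^^ Suc i) d)" using f(3) by (auto simp: B_def)
      then show ?thesis by (simp add: funpow_swap1)
    qed
    have head: "\<pi> (tl_v (nx d)) \<in> lists X" "\<pi> (tl_v d) \<in> lists X"
      using lists tail nx_in dA by blast+
    \<comment> \<open>The good darts of the face lead from the end of \<open>d\<close> back to its
      start. Cancelling their labels from the trivial label of the face leaves the condition that
      \<open>d\<close> is good.\<close>
    have "\<pi> (tl_v (nx d)) @ ?rest \<approx> \<pi> (tl_v d)"
      using good_path[of "nx d" n \<pi>] good_i nx_in dA head ret by simp
    moreover have "\<pi> (tl_v d) @ face_word \<Gamma> d \<approx> \<pi> (tl_v d) @ []"
      using face_word_trivial[OF f(1,2)] head by (intro word_eq_append word_eq.refl) auto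
    ultimately have "(\<pi> (tl_v d) @ [lab d]) @ ?rest \<approx> \<pi> (tl_v (nx d)) @ ?rest"
      unfolding word by simp (meson word_eq.sym word_eq.trans)
    then have "\<pi> (tl_v d) @ [lab d] \<approx> \<pi> (tl_v (nx d))" by (rule word_eq_cancel_right)
    then show False using bad tail dA by (simp add: good_def)
  qed
  then show thesis using that[of \<pi>] lists by (auto simp: B_def)
qed

text \<open>The group acts on its Cayley graph from the left, so a potential can be translated to
  take any prescribed value at \<open>a\<close>.\<close>

lemma potential_at:
  assumes "a \<in> V" "u \<in> lists X"
  obtains \<pi> where "\<And>v. v \<in> V \<Longrightarrow> \<pi> v \<in> lists X" "\<And>e. e \<in> A \<Longrightarrow> good \<pi> e" "\<pi> a \<approx> u"
proof -
  obtain \<pi> where l: "\<And>v. v \<in> V \<Longrightarrow> \<pi> v \<in> lists X" and g: "\<And>e. e \<in> A \<Longrightarrow> good \<pi> e"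
    using potential_exists by blast
  define t where "t = u @ inv_word P (\<pi> a)"
  have t: "t \<in> lists X" using assms l inv_word_lists by (simp add: t_def)
  show thesis
  proof (rule that[of "\<lambda>v. t @ \<pi> v"])
    show "good (\<lambda>v. t @ \<pi> v) e" if "e \<in> A" for e
      using word_eq_append[OF word_eq.refl[OF t] g[OF that, unfolded good_def]]
      by (simp add: good_def)
    have "u @ (inv_word P (\<pi> a) @ \<pi> a) \<approx> u @ []"
      using assms l inv_word_left by (intro word_eq_append word_eq.refl) auto
    then show "t @ \<pi> a \<approx> u" by (simp add: t_def)
  qed (use t l in auto)
qed

text \<open>The potential turns the walk around a face into the path in the Cayley graph that reads
  the label of the face.\<close>

lemma face_sum:
  assumes l: "\<And>v. v \<in> V \<Longrightarrow> \<pi> v \<in> lists X" and g: "\<And>e. e \<in> A \<Longrightarrow> good \<pi> e"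
    and e: "e \<in> A" and u: "\<pi> (tl_v e) \<approx> u"
  shows "(\<Sum>d\<in>fc e. edge_form f k (cls (\<pi> (tl_v d))) (cls (\<pi> (tl_v (rv d))))) = word_sum f k u (face_word \<Gamma> e)"
proof -
  define n where "n = card (fc e)"
  have pt: "cls (\<pi> (tl_v ((nx ^^ i) e))) = cls (u @ take i (face_word \<Gamma> e))" if "i \<le> n" for i
  proof -
    have tk: "take i (face_word \<Gamma> e) = map (\<lambda>i. lab ((nx ^^ i) e)) [0..<i]"
      using that by (simp add: face_word_def n_def take_map)
    have w: "\<pi> (tl_v e) @ take i (face_word \<Gamma> e) \<approx> \<pi> (tl_v ((nx ^^ i) e))"
      unfolding tk by (rule good_path) (use g e l tail funpow_nx_in in auto)
    have "take i (face_word \<Gamma> e) \<in> lists X" using take_lists face_word_lists[OF e] by blast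
    then have "u @ take i (face_word \<Gamma> e) \<approx> \<pi> (tl_v e) @ take i (face_word \<Gamma> e)"
      using u by (intro word_eq_append word_eq.refl) (auto intro: word_eq.sym)
    then have "u @ take i (face_word \<Gamma> e) \<approx> \<pi> (tl_v ((nx ^^ i) e))" using w word_eq.trans by blast
    then show ?thesis using cls_eq_iff word_eq_lists by metis
  qed
  have "(\<Sum>d\<in>fc e. edge_form f k (cls (\<pi> (tl_v d))) (cls (\<pi> (tl_v (rv d)))))
      = (\<Sum>i<n. edge_form f k (cls (\<pi> (tl_v ((nx ^^ i) e)))) (cls (\<pi> (tl_v (rv ((nx ^^ i) e))))))"
    using orbit_cycle(3,4)[OF nx_perm, of e] sum.reindex[of "\<lambda>i. (nx ^^ i) e" "{..<n}"]
    by (simp add: n_def o_def)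
  also have "\<dots> = (\<Sum>i<n. edge_form f k (cls (u @ take i (face_word \<Gamma> e))) (cls (u @ take (Suc i) (face_word \<Gamma> e))))"
  proof (rule sum.cong)
    fix i assume "i \<in> {..<n}"
    moreover have "tl_v (rv ((nx ^^ i) e)) = tl_v ((nx ^^ Suc i) e)"
      using tail[OF funpow_nx_in[OF e]] by simp
    ultimately show "edge_form f k (cls (\<pi> (tl_v ((nx ^^ i) e)))) (cls (\<pi> (tl_v (rv ((nx ^^ i) e)))))
        = edge_form f k (cls (u @ take i (face_word \<Gamma> e))) (cls (u @ take (Suc i) (face_word \<Gamma> e)))"
      using pt[of i] pt[of "Suc i"] by (simp del: funpow.simps)
  qed simp
  finally show ?thesis by (simp add: word_sum_def face_word_length n_def)
qed

text \<open>Stokes: as \<open>edge_form\<close> is antisymmetric, the sum over all darts vanishes, so the sum along the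
  boundary is the negative of the sum over the internal faces.\<close>

lemma boundary_sum_le_area:
  assumes lip: "lipschitz_on_edges cay f" "lipschitz_on_edges cay k" and u: "u \<in> lists X"
    and w: "boundary_word \<Gamma> w" "w \<noteq> []" and r: "\<And>f. f \<in> int_faces \<Gamma> \<Longrightarrow> card f \<le> r"
  shows "\<bar>word_sum f k u w\<bar> \<le> 2 * int r ^ 2 * int (area \<Gamma>)"
proof -
  obtain e0 where e0: "e0 \<in> dext \<Gamma>" "face_word \<Gamma> e0 = w" using w by (auto simp: boundary_word_def)
  then have "A \<noteq> {}" using ext by auto
  then have x: "dext \<Gamma> \<in> dfaces \<Gamma>" using ext by blast
  then have e0A: "e0 \<in> A" "dext \<Gamma> = fc e0" using face_of e0 by auto
  obtain \<pi> where l: "\<And>v. v \<in> V \<Longrightarrow> \<pi> v \<in> lists X" and g: "\<And>e. e \<in> A \<Longrightarrow> good \<pi> e"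
    and base: "\<pi> (tl_v e0) \<approx> u"
    using potential_at[of "tl_v e0" u] tail[OF e0A(1)] u by blast
  define \<kappa> where "\<kappa> d = edge_form f k (cls (\<pi> (tl_v d))) (cls (\<pi> (tl_v (rv d))))" for d
  have "sum \<kappa> A = (\<Sum>d\<in>A. \<kappa> (rv d))"
    by (rule sum.reindex_bij_witness[of _ rv rv]) (use rv in auto)
  also have "\<dots> = - sum \<kappa> A"
    unfolding sum_negf[symmetric] \<kappa>_def
  proof (rule sum.cong)
    fix d assume "d \<in> A"
    then show "edge_form f k (cls (\<pi> (tl_v (rv d)))) (cls (\<pi> (tl_v (rv (rv d)))))
        = - edge_form f k (cls (\<pi> (tl_v d))) (cls (\<pi> (tl_v (rv d))))"
      using rv edge_form_swap by simp
  qed simp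
  finally have total: "sum \<kappa> A = 0" by simp
  have "A = \<Union> (dfaces \<Gamma>)" using fc_face self_fc face_sub by blast
  then have "sum \<kappa> A = sum \<kappa> (\<Union> (dfaces \<Gamma>))" by simp
  also have "\<dots> = (\<Sum>F\<in>dfaces \<Gamma>. sum \<kappa> F)"
    using sum.Union_disjoint[of "dfaces \<Gamma>" \<kappa>] fin_face face_of by (metis (no_types) disjoint_iff o_apply)
  also have "\<dots> = sum \<kappa> (dext \<Gamma>) + (\<Sum>F\<in>int_faces \<Gamma>. sum \<kappa> F)"
    unfolding int_faces_def using x fin_faces by (simp add: sum.remove)
  finally have split: "sum \<kappa> (dext \<Gamma>) = - (\<Sum>F\<in>int_faces \<Gamma>. sum \<kappa> F)" using total by simp
  \<comment> \<open>The loop around a face has at most \<open>r\<close> edges, so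
    \<open>short_loop\<close> bounds its integral independently of the two functions.\<close>
  have small: "\<bar>sum \<kappa> F\<bar> \<le> 2 * int r ^ 2" if F: "F \<in> int_faces \<Gamma>" for F
  proof -
    obtain e where e: "e \<in> F" using F face_nonempty by (auto simp: int_face)
    then have eA: "e \<in> A" "F = fc e" using F face_of by (auto simp: int_face)
    have lu: "\<pi> (tl_v e) \<in> lists X" using l tail eA by blast
    have "sum \<kappa> F = word_sum f k (\<pi> (tl_v e)) (face_word \<Gamma> e)"
      using face_sum[OF l g eA(1) word_eq.refl[OF lu]] eA by (simp add: \<kappa>_def)
    then have "\<bar>sum \<kappa> F\<bar> \<le> 2 * int (card F) ^ 2"
      using word_sum_short[OF lip lu face_word_trivial[OF F e]] eA by (simp add: face_word_length)
    also have "\<dots> \<le> 2 * int r ^ 2" using r[OF F] by (simp add: power_mono)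
    finally show ?thesis .
  qed
  have "word_sum f k u w = sum \<kappa> (dext \<Gamma>)"
    using face_sum[OF l g e0A(1) base] e0 e0A by (simp add: \<kappa>_def)
  then have "\<bar>word_sum f k u w\<bar> \<le> (\<Sum>F\<in>int_faces \<Gamma>. \<bar>sum \<kappa> F\<bar>)"
    using split sum_abs[of "sum \<kappa>" "int_faces \<Gamma>"] by simp
  also have "\<dots> \<le> (\<Sum>F\<in>int_faces \<Gamma>. 2 * int r ^ 2)"
    by (rule sum_mono) (rule small)
  finally show ?thesis by (simp add: area_def mult.commute)
qed

end

section \<open>Counting faces by curvature\<close>

lemma geometric_quotient:
  assumes "r \<ge> 1" shows "(\<Sum>k<d. (real r - 1) ^ k) = geom_quotient r d"
  using assms geometric_sum[of "real r - 1" d] by (auto simp: geom_quotient_def)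

lemma geom_quotient_nonneg: "geom_quotient r d \<ge> 0"
proof (cases "r = 0")
  \<comment> \<open>For \<open>r = 0\<close> the quotient equals (1 - (-1)^d) / 2, which is 0 or
    1.\<close>
  case True
  then show ?thesis by (cases "even d") (auto simp: geom_quotient_def)
next
  case False
  then have "geom_quotient r d = (\<Sum>k<d. (real r - 1) ^ k)" using geometric_quotient[of r d] by simp
  also have "\<dots> \<ge> 0" using False by (intro sum_nonneg) auto
  finally show ?thesis .
qed

section \<open>Layers of the dual graph and the curvature count\<close>

context plane_map
begin

lemma dual_graph_connected:
  assumes "A \<noteq> {}" shows "connected_graph (dfaces \<Gamma>) (dual_graph \<Gamma>)"
proof
  show sub: "dual_graph \<Gamma> \<subseteq> dfaces \<Gamma> \<times> dfaces \<Gamma>" by (auto simp: dual_graph_def)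
  show sym: "sym (dual_graph \<Gamma>)"
  proof (rule symI)
    fix f g assume "(f, g) \<in> dual_graph \<Gamma>"
    then obtain e where e: "f \<in> dfaces \<Gamma>" "g \<in> dfaces \<Gamma>" "e \<in> f" "rv e \<in> g"
      by (auto simp: dual_graph_def)
    then have "rv (rv e) \<in> f" using rv[of e] face_of[of f e] by simp
    then show "(g, f) \<in> dual_graph \<Gamma>" using e by (auto simp: dual_graph_def)
  qed
  have "{(fc e, fc (rv e)) | e. e \<in> A} \<subseteq> dual_graph \<Gamma>"
    using fc_face rv self_fc unfolding dual_graph_def by blast
  then have x: "(dext \<Gamma>, f) \<in> (dual_graph \<Gamma>)\<^sup>*" if "f \<in> dfaces \<Gamma>" for f
    using dual_connected[OF that] rtrancl_mono by blast
  have "sym ((dual_graph \<Gamma>)\<^sup>*)" using sym by (rule sym_rtrancl)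
  then show "(f, g) \<in> (dual_graph \<Gamma>)\<^sup>*" if "f \<in> dfaces \<Gamma>" "g \<in> dfaces \<Gamma>" for f g
    using x that by (meson rtrancl_trans symD)
qed

definition layer :: "nat \<Rightarrow> nat set set" where
  "layer k = {f \<in> dfaces \<Gamma>. ext_dist \<Gamma> f = k}"

lemma layer_step:
  assumes "f \<in> layer (Suc k)"
  obtains e where "e \<in> f" "fc (rv e) \<in> layer k" "e \<in> A" "f = fc (rv (rv e))"
proof -
  have f: "f \<in> dfaces \<Gamma>" "ext_dist \<Gamma> f = Suc k" using assms by (auto simp: layer_def)
  then have ne: "A \<noteq> {}" by (auto simp: dfaces_def)
  interpret dual: connected_graph "dfaces \<Gamma>" "dual_graph \<Gamma>" by (rule dual_graph_connected[OF ne])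
  have x: "dext \<Gamma> \<in> dfaces \<Gamma>" using ext ne by blast
  have "(f, dext \<Gamma>) \<in> dual_graph \<Gamma> ^^ Suc k"
    using dual.relpow_dist[OF f(1) x] f(2) by (simp only: ext_dist_def)
  then obtain g where g: "(f, g) \<in> dual_graph \<Gamma>" "(g, dext \<Gamma>) \<in> dual_graph \<Gamma> ^^ k"
    by (meson relpow_Suc_D2)
  have gd: "g \<in> dfaces \<Gamma>" using g dual.E_sub by auto
  have "ext_dist \<Gamma> g \<le> k" using dual.dist_le[OF g(2)] by (simp add: ext_dist_def)
  moreover have "Suc k \<le> 1 + ext_dist \<Gamma> g"
    using dual.dist_triangle[OF f(1) gd x] dual.dist_edge[OF g(1)] f(2) by (simp add: ext_dist_def)
  ultimately have "g \<in> layer k" using gd by (simp add: layer_def)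
  moreover obtain e where e: "e \<in> f" "rv e \<in> g" using g by (auto simp: dual_graph_def)
  moreover have "fc (rv e) = g" using face_of[OF gd e(2)] by simp
  moreover have "e \<in> A" "f = fc e" using face_of[OF f(1) e(1)] by auto
  ultimately show thesis using that[of e] rv by simp
qed

lemma layer_0: "layer 0 \<subseteq> {dext \<Gamma>}"
proof
  fix f assume "f \<in> layer 0"
  then have f: "f \<in> dfaces \<Gamma>" "ext_dist \<Gamma> f = 0" by (auto simp: layer_def)
  then have ne: "A \<noteq> {}" by (auto simp: dfaces_def)
  interpret dual: connected_graph "dfaces \<Gamma>" "dual_graph \<Gamma>" by (rule dual_graph_connected[OF ne])
  have "dext \<Gamma> \<in> dfaces \<Gamma>" using ext ne by blast
  then show "f \<in> {dext \<Gamma>}" using dual.relpow_dist[OF f(1), of "dext \<Gamma>"] f(2) by (simp add: ext_dist_def)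
qed

lemma ext_layer: "A \<noteq> {} \<Longrightarrow> ext_dist \<Gamma> (dext \<Gamma>) = 0"
  using connected_graph.dist_refl[OF dual_graph_connected] by (simp add: ext_dist_def)

lemma fin_layer: "finite (layer k)"
  using fin_faces by (simp add: layer_def)

text \<open>Layer 1 is reached across the edges of the boundary. A face \<open>g\<close> of a later
  layer has at most \<open>r\<close> darts, and one of them, \<open>bk g\<close>, leads back to the
  previous layer, so at most \<open>r - 1\<close> lead on to the next.\<close>

lemma card_layer:
  assumes r: "\<And>f. f \<in> int_faces \<Gamma> \<Longrightarrow> card f \<le> r"
  shows "card (layer (Suc k)) \<le> card (dext \<Gamma>) * (r - 1) ^ k"
proof (induction k)
  case 0
  have "layer (Suc 0) \<subseteq> (\<lambda>e. fc (rv e)) ` dext \<Gamma>"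
  proof
    fix f assume "f \<in> layer (Suc 0)"
    then obtain e where e: "fc (rv e) \<in> layer 0" "f = fc (rv (rv e))" by (rule layer_step)
    then have "fc (rv e) = dext \<Gamma>" using layer_0 by blast
    then have "rv e \<in> dext \<Gamma>" using self_fc by blast
    then show "f \<in> (\<lambda>e. fc (rv e)) ` dext \<Gamma>" using e by blast
  qed
  moreover have "finite (dext \<Gamma>)" using ext fin_face by (cases "A = {}") auto
  ultimately show ?case using surj_card_le by simp
next
  case (Suc k)
  have "\<exists>e. e \<in> g \<and> fc (rv e) \<in> layer k" if "g \<in> layer (Suc k)" for g
    using layer_step[OF that] by blast
  then obtain bk where bk: "\<And>g. g \<in> layer (Suc k) \<Longrightarrow> bk g \<in> g \<and> fc (rv (bk g)) \<in> layer k"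
    by metis
  have "layer (Suc (Suc k)) \<subseteq> (\<Union>g\<in>layer (Suc k). (\<lambda>e. fc (rv e)) ` (g - {bk g}))"
  proof
    fix f assume f: "f \<in> layer (Suc (Suc k))"
    then obtain e where e: "fc (rv e) \<in> layer (Suc k)" "f = fc (rv (rv e))" by (rule layer_step)
    have "fc (rv (bk (fc (rv e)))) \<noteq> f" using bk[OF e(1)] f by (auto simp: layer_def)
    then have "rv e \<noteq> bk (fc (rv e))" using e(2) by auto
    then show "f \<in> (\<Union>g\<in>layer (Suc k). (\<lambda>e. fc (rv e)) ` (g - {bk g}))"
      using e self_fc[of "rv e"] by blast
  qed
  moreover have fg: "finite g" if "g \<in> layer (Suc k)" for g
    using that fin_face by (simp add: layer_def)
  ultimately have "card (layer (Suc (Suc k))) \<le> card (\<Union>g\<in>layer (Suc k). (\<lambda>e. fc (rv e)) ` (g - {bk g}))"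
    using fin_layer by (intro card_mono) auto
  also have "\<dots> \<le> (\<Sum>g\<in>layer (Suc k). card ((\<lambda>e. fc (rv e)) ` (g - {bk g})))"
    by (rule card_UN_le[OF fin_layer])
  also have "\<dots> \<le> (\<Sum>g\<in>layer (Suc k). r - 1)"
  proof (rule sum_mono)
    fix g assume g: "g \<in> layer (Suc k)"
    then have "A \<noteq> {}" by (auto simp: layer_def dfaces_def)
    then have "g \<in> int_faces \<Gamma>" using g ext_layer by (auto simp: layer_def int_face)
    then have "card (g - {bk g}) \<le> r - 1" using r[of g] bk[OF g] fg[OF g] by simp
    then show "card ((\<lambda>e. fc (rv e)) ` (g - {bk g})) \<le> r - 1"
      using card_image_le[of "g - {bk g}" "\<lambda>e. fc (rv e)"] fg[OF g] by simp
  qed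
  also have "\<dots> \<le> card (dext \<Gamma>) * (r - 1) ^ k * (r - 1)"
    using Suc.IH by simp
  finally show ?case by (simp add: mult_ac)
qed

lemma card_near_faces:
  assumes r: "\<And>f. f \<in> int_faces \<Gamma> \<Longrightarrow> card f \<le> r" and r1: "r \<ge> 1"
  shows "real (card {f \<in> int_faces \<Gamma>. ext_dist \<Gamma> f \<le> d}) \<le> real (card (dext \<Gamma>)) * geom_quotient r d"
proof -
  have "{f \<in> int_faces \<Gamma>. ext_dist \<Gamma> f \<le> d} \<subseteq> (\<Union>k\<in>{..<d}. layer (Suc k))"
  proof
    fix f assume f: "f \<in> {f \<in> int_faces \<Gamma>. ext_dist \<Gamma> f \<le> d}"
    then have "ext_dist \<Gamma> f \<noteq> 0" using layer_0 by (auto simp: layer_def int_face)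
    then obtain k where "ext_dist \<Gamma> f = Suc k" using not0_implies_Suc by blast
    then show "f \<in> (\<Union>k\<in>{..<d}. layer (Suc k))" using f by (auto simp: layer_def int_face)
  qed
  then have "card {f \<in> int_faces \<Gamma>. ext_dist \<Gamma> f \<le> d} \<le> card (\<Union>k\<in>{..<d}. layer (Suc k))"
    using fin_layer by (intro card_mono) auto
  also have "\<dots> \<le> (\<Sum>k<d. card (layer (Suc k)))" by (rule card_UN_le) simp
  also have "\<dots> \<le> (\<Sum>k<d. card (dext \<Gamma>) * (r - 1) ^ k)" by (intro sum_mono card_layer r)
  finally have "real (card {f \<in> int_faces \<Gamma>. ext_dist \<Gamma> f \<le> d}) \<le> real (\<Sum>k<d. card (dext \<Gamma>) * (r - 1) ^ k)"
    by (simp only: of_nat_le_iff)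
  also have "\<dots> = real (card (dext \<Gamma>)) * (\<Sum>k<d. (real r - 1) ^ k)"
    using r1 by (simp add: sum_distrib_left of_nat_diff)
  finally show ?thesis by (simp add: geometric_quotient[OF r1])
qed

lemma area_le_area_bound:
  assumes cover: "int_faces \<Gamma> = Red \<union> Green"
    and curv: "curvature_distribution \<Gamma> \<rho>"
    and pos: "\<epsilon> > 0" "lam \<ge> 0" "m \<ge> 0"
    and a: "\<forall>v\<in>V. \<rho> (Vertex v) \<le> 0" "\<forall>e\<in>dedges \<Gamma>. \<rho> (Edge e) \<le> 0" "\<forall>f\<in>Red. \<rho> (Face f) \<le> 0"
    and b: "\<forall>f\<in>Green. ext_dist \<Gamma> f \<ge> d + 1 \<longrightarrow> \<rho> (Face f) \<le> - \<epsilon>"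
    and c: "\<forall>f\<in>Green. ext_dist \<Gamma> f \<le> d \<longrightarrow> \<rho> (Face f) \<le> m"
    and dd: "real (area \<Gamma>) \<le> lam * real (card Green) + \<mu> * real (boundary_length \<Gamma>)"
    and r: "\<And>f. f \<in> int_faces \<Gamma> \<Longrightarrow> card f \<le> r" and r1: "r \<ge> 1"
  shows "real (area \<Gamma>) \<le> area_bound r d \<epsilon> lam \<mu> m (boundary_length \<Gamma>)"
proof -
  define near where "near = {f \<in> Green. ext_dist \<Gamma> f \<le> d}"
  define far where "far = {f \<in> Green. ext_dist \<Gamma> f \<ge> d + 1}"
  have fin_G: "finite Green" "finite Red" using cover fin_faces by (metis finite_Un)+
  have Green: "Green = near \<union> far" "near \<inter> far = {}" "finite near" "finite far"
    using fin_G by (auto simp: near_def far_def)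
  have "1 = (\<Sum>c\<in>cells \<Gamma>. \<rho> c)" using curv by (simp add: curvature_distribution_def)
  also have "\<dots> = (\<Sum>v\<in>V. \<rho> (Vertex v)) + (\<Sum>e\<in>dedges \<Gamma>. \<rho> (Edge e)) + (\<Sum>f\<in>int_faces \<Gamma>. \<rho> (Face f))"
    unfolding cells_def using fin fin_faces
    by (subst sum.union_disjoint; (subst sum.union_disjoint)?) (auto simp: sum.reindex inj_on_def)
  also have "\<dots> \<le> (\<Sum>f\<in>int_faces \<Gamma>. \<rho> (Face f))"
    using sum_nonpos[of V "\<lambda>v. \<rho> (Vertex v)"] sum_nonpos[of "dedges \<Gamma>" "\<lambda>e. \<rho> (Edge e)"] a by simp
  \<comment> \<open>\<open>Red\<close> and \<open>Green\<close> are not assumed to be disjoint; a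
    face in both is counted as green.\<close>
  also have "\<dots> = (\<Sum>f\<in>Green. \<rho> (Face f)) + (\<Sum>f\<in>Red - Green. \<rho> (Face f))"
    unfolding cover using fin_G by (subst sum.union_disjoint[symmetric]) (auto intro!: sum.cong)
  also have "\<dots> \<le> (\<Sum>f\<in>Green. \<rho> (Face f))"
    using sum_nonpos[of "Red - Green" "\<lambda>f. \<rho> (Face f)"] a by simp
  also have "\<dots> = (\<Sum>f\<in>near. \<rho> (Face f)) + (\<Sum>f\<in>far. \<rho> (Face f))"
    using Green by (simp add: sum.union_disjoint)
  also have "\<dots> \<le> (\<Sum>f\<in>near. m) + (\<Sum>f\<in>far. - \<epsilon>)"
    using b c by (intro add_mono sum_mono) (auto simp: near_def far_def)
  \<comment> \<open>The 1 at the beginning of the chain is the total curvature. After division it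
    becomes the term - 1 / \<epsilon> of the bound.\<close>
  finally have "\<epsilon> * real (card far) \<le> m * real (card near) - 1" by (simp add: mult.commute)
  then have far: "real (card far) \<le> (m * real (card near) - 1) / \<epsilon>"
    using pos by (simp add: pos_le_divide_eq mult.commute)
  have "card near \<le> card {f \<in> int_faces \<Gamma>. ext_dist \<Gamma> f \<le> d}"
    using cover fin_faces by (intro card_mono) (auto simp: near_def)
  then have near: "real (card near) \<le> real (card (dext \<Gamma>)) * geom_quotient r d"
    using card_near_faces[OF r r1, of d] by linarith
  have "real (card Green) = real (card near) + real (card far)"
    using Green by (simp add: card_Un_disjoint)
  also have "\<dots> \<le> real (card near) * (1 + m / \<epsilon>) - 1 / \<epsilon>"
    using far by (simp add: algebra_simps diff_divide_distrib)
  also have "\<dots> \<le> real (card (dext \<Gamma>)) * geom_quotient r d * (1 + m / \<epsilon>) - 1 / \<epsilon>"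
    using near pos by (intro diff_right_mono mult_right_mono) auto
  finally have "lam * real (card Green) \<le> lam * (real (card (dext \<Gamma>)) * geom_quotient r d * (1 + m / \<epsilon>) - 1 / \<epsilon>)"
    using pos by (intro mult_left_mono)
  then show ?thesis using dd by (simp add: area_bound_def boundary_length_def)
qed

lemma int_face_card_pos: "f \<in> int_faces \<Gamma> \<Longrightarrow> card f \<ge> 1"
  using face_nonempty fin_face by (simp add: int_face Suc_le_eq card_gt_0_iff)

text \<open>A red face has length 3 whatever the relators are, which accounts for the last
  assumption.\<close>

lemma coloured_face_card:
  assumes "coloured_diagram P S \<Gamma>" "f \<in> int_faces \<Gamma>"
    and "\<And>w. w \<in> S \<Longrightarrow> length w \<le> r" "r \<ge> 3 \<or> VP P = {}"
  shows "card f \<le> r"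
proof -
  have "f \<in> red_faces P \<Gamma> \<union> green_faces P S \<Gamma>" using assms by (auto simp: coloured_diagram_def)
  then obtain e where e: "e \<in> f" "face_word \<Gamma> e \<in> VP P \<union> sym_words P S"
    by (auto simp: red_faces_def green_faces_def)
  have "card f = length (face_word \<Gamma> e)"
    using face_of[of f e] assms e by (simp add: int_face face_word_length)
  moreover have "length (face_word \<Gamma> e) \<le> r"
    using e assms(3,4) by (auto simp: VP_def sym_words_def inv_word_def)
  ultimately show ?thesis by simp
qed

end

lemma interleaves_length: "v \<in> interleaves P w \<Longrightarrow> length v = length w"
  by (simp add: interleaves_def cyc_interleave_def)

lemma length_le_max_relator: "finite R \<Longrightarrow> w \<in> R \<Longrightarrow> length w \<le> max_relator_length R"
  by (simp add: max_relator_length_def)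

lemma interleaves_set_length:
  assumes "finite R" "w \<in> interleaves_set P R" shows "length w \<le> max_relator_length R"
  using assms length_le_max_relator by (fastforce simp: interleaves_set_def dest: interleaves_length)

lemma plane_map_coloured: "coloured_diagram P S \<Gamma> \<Longrightarrow> plane_map \<Gamma>"
  by unfold_locales (simp add: coloured_diagram_def)

section \<open>Fillings of words\<close>

text \<open>The constant is 2 * 3^2 from \<open>short_loop\<close>. A triangle is the price for
  replacing two letters by their product.\<close>

lemma triangle_form:
  fixes f g :: "'b \<Rightarrow> int"
  assumes "\<bar>f a - f b\<bar> \<le> 1" "\<bar>f b - f c\<bar> \<le> 1" "\<bar>f c - f a\<bar> \<le> 1"
    and "\<bar>g a - g b\<bar> \<le> 1" "\<bar>g b - g c\<bar> \<le> 1" "\<bar>g c - g a\<bar> \<le> 1"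
  shows "\<bar>edge_form f g a b + edge_form f g b c + edge_form f g c a\<bar> \<le> 18"
proof -
  define p where "p i = [a, b, c, a] ! i" for i
  have "\<bar>\<Sum>i<3. edge_form f g (p i) (p (Suc i))\<bar> \<le> 2 * int 3 ^ 2"
    by (rule short_loop) (use assms in \<open>auto simp: p_def less_Suc_eq eval_nat_numeral\<close>)
  then show ?thesis by (simp add: p_def eval_nat_numeral)
qed

text \<open>The constant is 2 * 4^2 from \<open>short_loop\<close>. Quadrangles are the pieces of
  the ladder between two interleaving paths.\<close>

lemma quadrangle_form:
  fixes f g :: "'b \<Rightarrow> int"
  assumes "\<bar>f a - f b\<bar> \<le> 1" "\<bar>f b - f c\<bar> \<le> 1" "\<bar>f c - f d\<bar> \<le> 1" "\<bar>f d - f a\<bar> \<le> 1"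
    and "\<bar>g a - g b\<bar> \<le> 1" "\<bar>g b - g c\<bar> \<le> 1" "\<bar>g c - g d\<bar> \<le> 1" "\<bar>g d - g a\<bar> \<le> 1"
  shows "\<bar>edge_form f g a b + edge_form f g b c + edge_form f g c d + edge_form f g d a\<bar> \<le> 32"
proof -
  define p where "p i = [a, b, c, d, a] ! i" for i
  have "\<bar>\<Sum>i<4. edge_form f g (p i) (p (Suc i))\<bar> \<le> 2 * int 4 ^ 2"
    by (rule short_loop) (use assms in \<open>auto simp: p_def less_Suc_eq eval_nat_numeral\<close>)
  then show ?thesis by (simp add: p_def eval_nat_numeral)
qed

context word_presentation
begin

lemma elt_word_idt: "elt_word idt = []"
  by (simp add: elt_word_def)

text \<open>Letter by letter, \<open>w\<close> is \<open>v\<close> with \<open>s i\<close> and its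
  inverse inserted between neighbours, so the inserted elements cancel in a prefix except at its two
  ends. Hence the words are conjugate by \<open>s 0\<close>, and the two paths stay within one edge
  of each other.\<close>

lemma interleave_conj:
  assumes "cyc_interleave P v w"
  obtains s where "\<And>i. i \<le> length v \<Longrightarrow> s i \<in> pcarrier P" "s (length v) = s 0"
    "\<And>i. i \<le> length v \<Longrightarrow> elt_word (s 0) @ take i w \<approx> take i v @ elt_word (s i)"
proof (cases "length v \<le> 1")
  case True
  then have "v = w" "w \<in> lists X" using assms by (auto simp: cyc_interleave_def)
  then show thesis
    by (intro that[of "\<lambda>_. idt"]) (auto simp: one_closed elt_word_def take_lists word_eq.refl)
next
  case False
  have l: "v \<in> lists X" "w \<in> lists X" "length w = length v"
    using assms by (auto simp: cyc_interleave_def)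
  obtain s where s: "\<And>i. i \<le> length v \<Longrightarrow> s i \<in> pcarrier P" "s (length v) = s 0"
    and st: "\<And>i. i < length v \<Longrightarrow> (sg (s i), v ! i) \<in> D \<and> (v ! i, s (Suc i)) \<in> D \<and>
       (mul (sg (s i)) (v ! i), s (Suc i)) \<in> D \<and> w ! i = mul (mul (sg (s i)) (v ! i)) (s (Suc i))"
  proof -
    have "\<exists>s. (\<forall>i\<le>length v. s i \<in> pcarrier P) \<and> s (length v) = s 0 \<and> (\<forall>i<length v.
       (sg (s i), v ! i) \<in> D \<and> (v ! i, s (Suc i)) \<in> D \<and>
       (mul (sg (s i)) (v ! i), s (Suc i)) \<in> D \<and> w ! i = mul (mul (sg (s i)) (v ! i)) (s (Suc i)))"
      using assms unfolding cyc_interleave_def if_not_P[OF False] by blast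
    then show thesis using that by blast
  qed
  have "elt_word (s 0) @ take i w \<approx> take i v @ elt_word (s i)" if "i \<le> length v" for i
    using that
  proof (induction i)
    case 0 then show ?case using s by (simp add: elt_word_lists word_eq.refl)
  next
    case (Suc i)
    then have i: "i < length v" by simp
    note D = st[OF i]
    have wi: "w ! i \<in> X" "v ! i \<in> X" using i l by (auto intro: nth_lists)
    have es: "elt_word (s i) \<in> lists X" "elt_word (s (Suc i)) \<in> lists X" "elt_word (sg (s i)) \<in> lists X"
      using s(1)[of i] s(1)[of "Suc i"] i by (auto intro: elt_word_lists sigma_closed)
    have tv: "take i v \<in> lists X" using take_lists l by blast
    have "elt_word (mul (sg (s i)) (v ! i)) @ elt_word (s (Suc i)) \<approx> [w ! i]"
      using elt_word_mult D elt_word_gen[OF wi(1)] by metis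
    moreover have "(elt_word (sg (s i)) @ [v ! i]) @ elt_word (s (Suc i))
        \<approx> elt_word (mul (sg (s i)) (v ! i)) @ elt_word (s (Suc i))"
      using elt_word_mult[of "sg (s i)" "v ! i"] D wi es
      by (intro word_eq_append word_eq.refl) (auto simp: elt_word_gen)
    ultimately have "elt_word (sg (s i)) @ [v ! i] @ elt_word (s (Suc i)) \<approx> [w ! i]"
      using word_eq.trans by fastforce
    then have 1: "(take i v @ elt_word (s i)) @ elt_word (sg (s i)) @ [v ! i] @ elt_word (s (Suc i))
        \<approx> (take i v @ elt_word (s i)) @ [w ! i]"
      using tv es by (intro word_eq_append word_eq.refl) auto
    have "elt_word (s i) @ elt_word (sg (s i)) \<approx> []"
      using elt_word_mult[of "s i" "sg (s i)"] P2[of "s i"] s(1)[of i] i elt_word_idt by simp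
    then have 2: "take i v @ (elt_word (s i) @ elt_word (sg (s i))) @ ([v ! i] @ elt_word (s (Suc i)))
        \<approx> take i v @ [] @ ([v ! i] @ elt_word (s (Suc i)))"
      using tv es wi by (intro word_eq_context) auto
    have 3: "(elt_word (s 0) @ take i w) @ [w ! i] \<approx> (take i v @ elt_word (s i)) @ [w ! i]"
      using word_eq_append[OF Suc.IH word_eq.refl, of "[w ! i]"] wi i by simp
    have "elt_word (s 0) @ take (Suc i) w \<approx> take (Suc i) v @ elt_word (s (Suc i))"
      using 1 2 3 i l by (simp add: take_Suc_conv_app_nth) (meson word_eq.sym word_eq.trans)
    then show ?case .
  qed
  with s that show thesis by blast
qed

lemma interleave_trivial:
  assumes "cyc_interleave P v w" "w \<approx> []" shows "v \<approx> []"
proof -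
  obtain s where s: "\<And>i. i \<le> length v \<Longrightarrow> s i \<in> pcarrier P" "s (length v) = s 0"
    "\<And>i. i \<le> length v \<Longrightarrow> elt_word (s 0) @ take i w \<approx> take i v @ elt_word (s i)"
    using interleave_conj[OF assms(1)] by blast
  have len: "length v = length w" using assms(1) by (simp add: cyc_interleave_def)
  have "elt_word (s 0) @ w \<approx> elt_word (s 0) @ []"
    using assms(2) s(1)[of 0] by (intro word_eq_append word_eq.refl) (auto intro: elt_word_lists)
  moreover have "elt_word (s 0) @ w \<approx> v @ elt_word (s 0)" using s(2) s(3)[of "length v"] len by simp
  ultimately have "v @ elt_word (s 0) \<approx> [] @ elt_word (s 0)"
    by simp (meson word_eq.sym word_eq.trans)
  then show ?thesis by (rule word_eq_cancel_right)
qed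

lemma word_sum_append: "word_sum f g u (a @ b) = word_sum f g u a + word_sum f g (u @ a) b"
proof (induction b rule: rev_induct)
  case (snoc x b)
  have "word_sum f g u (w @ [x]) = word_sum f g u w + edge_form f g (cls (u @ w)) (cls (u @ w @ [x]))" for u w
    by (simp add: word_sum_def)
  from this[of u "a @ b"] this[of "u @ a" b] snoc show ?case by simp
qed (simp add: word_sum_def)

lemma word_sum_cong:
  assumes "u \<approx> u'" "w \<in> lists X" shows "word_sum f g u w = word_sum f g u' w"
proof -
  have "cls (u @ take i w) = cls (u' @ take i w)" for i
    using word_eq_append[OF assms(1) word_eq.refl[OF take_lists[OF assms(2)]]] cls_eq_iff word_eq_lists by metis
  then show ?thesis by (simp add: word_sum_def)
qed

lemma word_sum_rotate:
  assumes "a @ b \<approx> []" "u \<in> lists X"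
  shows "word_sum f g u (a @ b) = word_sum f g (u @ a) (b @ a)"
proof -
  have l: "a \<in> lists X" "b \<in> lists X" using word_eq_lists[OF assms(1)] by (auto simp: lists_append_iff)
  have "u @ (a @ b) \<approx> u @ []" using assms by (intro word_eq_append word_eq.refl)
  then have "word_sum f g (u @ a @ b) a = word_sum f g u a" using word_sum_cong l by simp
  then show ?thesis by (simp add: word_sum_append)
qed

text \<open>The closed paths of \<open>v\<close> and \<open>w\<close> bound a ladder with
  \<open>length w\<close> quadrangles. Each quadrangle contributes at most 32, and the rungs cancel,
  as the last one coincides with the first.\<close>

lemma word_sum_interleave:
  assumes il: "cyc_interleave P v w" and w: "w \<approx> []" and u: "u \<in> lists X"
    and lip: "lipschitz_on_edges cay f" "lipschitz_on_edges cay g"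
  obtains u' where "u' \<in> lists X" "\<bar>word_sum f g u w\<bar> \<le> \<bar>word_sum f g u' v\<bar> + 32 * int (length w)"
proof -
  obtain s where s: "\<And>i. i \<le> length v \<Longrightarrow> s i \<in> pcarrier P"
    and conj: "\<And>i. i \<le> length v \<Longrightarrow> elt_word (s 0) @ take i w \<approx> take i v @ elt_word (s i)"
    using interleave_conj[OF il] by blast
  define n where "n = length v"
  have len: "length w = n" using il by (simp add: cyc_interleave_def n_def)
  have l: "v \<in> lists X" "w \<in> lists X" using il by (auto simp: cyc_interleave_def)
  define c where "c = elt_word (s 0)"
  have c: "c \<in> lists X" using s[of 0] by (simp add: c_def elt_word_lists)
  \<comment> \<open>Starting the path of \<open>v\<close> at this point makes \<open>s i\<close> the
    label of the rung at position \<open>i\<close>.\<close>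
  define u' where "u' = u @ inv_word P c"
  have u': "u' \<in> lists X" using u c by (simp add: u'_def inv_word_lists)
  define a where "a i = cls (u @ take i w)" for i
  define b where "b i = cls (u' @ take i v)" for i
  have tl: "take i v \<in> lists X" "take i w \<in> lists X" for i using l take_lists by auto
  have ab: "\<bar>k (a i) - k (b i)\<bar> \<le> 1" if k: "lipschitz_on_edges cay k" and i: "i \<le> n" for k i
  proof -
    have "u' @ (c @ take i w) \<approx> u' @ (take i v @ elt_word (s i))"
      using word_eq_append[OF word_eq.refl[OF u'] conj[of i]] i by (simp add: c_def n_def)
    moreover have "u @ (inv_word P c @ c) @ take i w \<approx> u @ [] @ take i w"
      using u tl c by (intro word_eq_context inv_word_left) auto
    ultimately have "u @ take i w \<approx> u' @ take i v @ elt_word (s i)"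
      unfolding u'_def by simp (meson word_eq.sym word_eq.trans)
    then have "a i = cls ((u' @ take i v) @ elt_word (s i))"
      using cls_eq_iff u tl by (simp add: a_def)
    then show ?thesis
      using lipschitz_word[OF k, of "u' @ take i v" "s i"] u' tl s[of i] i
      by (cases "s i = idt") (auto simp: elt_word_def b_def pgens_def n_def abs_minus_commute)
  qed
  have aa: "\<bar>k (a i) - k (a (Suc i))\<bar> \<le> 1" and bb: "\<bar>k (b i) - k (b (Suc i))\<bar> \<le> 1"
    if k: "lipschitz_on_edges cay k" and i: "i < n" for k i
    using lipschitz_word[OF k, of "u @ take i w" "w ! i"] lipschitz_word[OF k, of "u' @ take i v" "v ! i"]
      i len l u u' tl by (auto simp: a_def b_def take_Suc_conv_app_nth n_def nth_lists)
  have closed: "a n = a 0" "b n = b 0"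
  proof -
    have "u @ w \<approx> u @ []" "u' @ v \<approx> u' @ []"
      using word_eq_append[OF word_eq.refl[OF u] w]
        word_eq_append[OF word_eq.refl[OF u'] interleave_trivial[OF il w]] by auto
    then show "a n = a 0" "b n = b 0" using cls_eq_iff u u' l len by (auto simp: a_def b_def n_def)
  qed
  define q where "q i = edge_form f g (a i) (a (Suc i)) + edge_form f g (a (Suc i)) (b (Suc i))
      + edge_form f g (b (Suc i)) (b i) + edge_form f g (b i) (a i)" for i
  have q: "\<bar>q i\<bar> \<le> 32" if i: "i < n" for i
    unfolding q_def
    by (rule quadrangle_form)
      (use aa[OF lip(1) i] aa[OF lip(2) i] bb[OF lip(1) i] bb[OF lip(2) i] ab[OF lip(1), of i]
        ab[OF lip(2), of i] ab[OF lip(1), of "Suc i"] ab[OF lip(2), of "Suc i"] i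
        in \<open>auto simp: abs_minus_commute\<close>)
  have "word_sum f g u w = (\<Sum>i<n. edge_form f g (a i) (a (Suc i)))"
    by (simp add: word_sum_def a_def len)
  \<comment> \<open>A step along \<open>w\<close> is a quadrangle plus the parallel step along
    \<open>v\<close>, up to the difference of two consecutive rungs, which telescopes.\<close>
  also have "\<dots> = (\<Sum>i<n. q i + edge_form f g (b i) (b (Suc i))
      - (edge_form f g (a (Suc i)) (b (Suc i)) - edge_form f g (a i) (b i)))"
    by (rule sum.cong) (simp_all add: q_def edge_form_swap[of f g "b i" "a i" for i]
        edge_form_swap[of f g "b (Suc i)" "b i" for i])
  also have "\<dots> = sum q {..<n} + (\<Sum>i<n. edge_form f g (b i) (b (Suc i)))
      - (\<Sum>i<n. edge_form f g (a (Suc i)) (b (Suc i)) - edge_form f g (a i) (b i))"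
    by (simp add: sum.distrib sum_subtractf)
  also have "(\<Sum>i<n. edge_form f g (a (Suc i)) (b (Suc i)) - edge_form f g (a i) (b i)) = 0"
    using closed by (simp add: sum_lessThan_telescope[of "\<lambda>i. edge_form f g (a i) (b i)"])
  also have "(\<Sum>i<n. edge_form f g (b i) (b (Suc i))) = word_sum f g u' v"
    by (simp add: word_sum_def b_def n_def)
  finally have "\<bar>word_sum f g u w\<bar> \<le> \<bar>sum q {..<n}\<bar> + \<bar>word_sum f g u' v\<bar>" by linarith
  moreover have "\<bar>sum q {..<n}\<bar> \<le> (\<Sum>i<n. 32)"
    by (rule order_trans[OF sum_abs]) (rule sum_mono, use q in auto)
  ultimately show thesis using that[OF u'] len by simp
qed

text \<open>The reducible pair may consist of the last and the first letter, so it is brought to the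
  front by a cyclic permutation.\<close>

lemma not_cyc_P_reduced:
  assumes "w \<in> lists X" "\<not> cyc_P_reduced P w"
  obtains a b x y q where "w = a @ b" "b @ a = x # y # q" "(x, y) \<in> D"
proof -
  have len: "length w > 1" and nr: "\<not> P_reduced P w \<or> (last w, hd w) \<in> D"
    using assms by (auto simp: cyc_P_reduced_def)
  show thesis
  proof (cases "P_reduced P w")
    case False
    then obtain i where i: "Suc i < length w" "(w ! i, w ! Suc i) \<in> D"
      using assms(1) by (auto simp: P_reduced_def successively_conv_nth)
    have "drop i w = w ! i # w ! Suc i # drop (Suc (Suc i)) w"
      using i by (metis Cons_nth_drop_Suc Suc_lessD)
    moreover from this have "w = take i w @ w ! i # w ! Suc i # drop (Suc (Suc i)) w"
      by (metis append_take_drop_id)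
    ultimately show thesis using i
      by (intro that[of "take i w" "drop i w" "w ! i" "w ! Suc i" "drop (Suc (Suc i)) w @ take i w"]) simp_all
  next
    case True
    then have d: "(last w, hd w) \<in> D" using nr by simp
    obtain y q where yq: "w = y # q" using len by (cases w) auto
    then have "q \<noteq> []" using len by auto
    then have "w = (y # butlast q) @ [last q]" using yq by simp
    then show thesis using that[of "y # butlast q" "[last q]"] d yq \<open>q \<noteq> []\<close> by auto
  qed
qed

text \<open>The path that reads \<open>[x, y]\<close> is replaced by the edge of the product, or by
  a single point if the product is the identity. The difference is one triangle.\<close>

lemma word_sum_merge:
  assumes xy: "(x, y) \<in> D" and w: "x # y # q \<approx> []" and u: "u \<in> lists X"
    and lip: "lipschitz_on_edges cay f" "lipschitz_on_edges cay g"
  obtains w' where "w' \<approx> []" "length w' < length (x # y # q)"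
    "\<bar>word_sum f g u (x # y # q)\<bar> \<le> \<bar>word_sum f g u w'\<bar> + 18"
proof -
  have l: "x \<in> X" "y \<in> X" "q \<in> lists X" using word_eq_lists[OF w] by auto
  define t where "t = elt_word (mul x y)"
  have xyt: "[x, y] \<approx> t" using elt_word_mult[OF xy] l by (simp add: elt_word_gen t_def)
  have t: "t \<in> lists X" "length t < 2" using word_eq_lists[OF xyt] by (auto simp: t_def elt_word_def)
  have "[x, y] @ q \<approx> t @ q" using xyt l by (intro word_eq_append word_eq.refl)
  then have tq: "t @ q \<approx> []" using w word_eq.sym word_eq.trans by fastforce
  have uxy: "u @ [x, y] \<approx> u @ t" using xyt u by (intro word_eq_append word_eq.refl)
  then have eq: "cls (u @ [x, y]) = cls (u @ t)" using cls_eq_iff word_eq_lists by metis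
  have "word_sum f g u (x # y # q) = word_sum f g u [x, y] + word_sum f g (u @ [x, y]) q"
    using word_sum_append[of f g u "[x, y]" q] by simp
  also have "word_sum f g (u @ [x, y]) q = word_sum f g (u @ t) q" by (rule word_sum_cong[OF uxy l(3)])
  also have "word_sum f g u [x, y] = (edge_form f g (cls u) (cls (u @ [x]))
      + edge_form f g (cls (u @ [x])) (cls (u @ t)) + edge_form f g (cls (u @ t)) (cls u)) + word_sum f g u t"
  proof -
    have "word_sum f g u t = edge_form f g (cls u) (cls (u @ t))"
      by (auto simp: t_def elt_word_def word_sum_def edge_form_def)
    then show ?thesis
      using eq by (simp add: word_sum_def edge_form_swap[of f g "cls (u @ t)" "cls u"])
  qed
  finally have sum: "word_sum f g u (x # y # q) = (edge_form f g (cls u) (cls (u @ [x]))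
      + edge_form f g (cls (u @ [x])) (cls (u @ t)) + edge_form f g (cls (u @ t)) (cls u)) + word_sum f g u (t @ q)"
    by (simp add: word_sum_append)
  have small: "\<bar>k (cls u) - k (cls (u @ [x]))\<bar> \<le> 1" "\<bar>k (cls (u @ [x])) - k (cls (u @ t))\<bar> \<le> 1"
    "\<bar>k (cls (u @ t)) - k (cls u)\<bar> \<le> 1" if k: "lipschitz_on_edges cay k" for k
  proof -
    show "\<bar>k (cls u) - k (cls (u @ [x]))\<bar> \<le> 1" by (rule lipschitz_word[OF k u l(1)])
    show "\<bar>k (cls (u @ [x])) - k (cls (u @ t))\<bar> \<le> 1"
      using lipschitz_word[OF k, of "u @ [x]" y] u l eq by simp
    show "\<bar>k (cls (u @ t)) - k (cls u)\<bar> \<le> 1"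
    proof (cases "mul x y = idt")
      case False
      then have "mul x y \<in> X" using mult_closed[OF xy] by (simp add: pgens_def)
      then show ?thesis
        using lipschitz_word[OF k u, of "mul x y"] by (simp add: t_def elt_word_gen abs_minus_commute)
    qed (simp add: t_def elt_word_def)
  qed
  have "\<bar>edge_form f g (cls u) (cls (u @ [x])) + edge_form f g (cls (u @ [x])) (cls (u @ t))
      + edge_form f g (cls (u @ t)) (cls u)\<bar> \<le> 18"
    by (intro triangle_form small lip)
  then show thesis using that[OF tq] sum t(2) by simp
qed

text \<open>Induction on the length. A word that is not cyclically reduced loses at least one letter
  at the cost of 18, which the allowance of \<open>M + 32\<close> for this letter covers. For a
  cyclically reduced word the 32 per letter pays for the passage to the interleaving word
  \<open>v\<close>.\<close>

lemma linear_filling_of_cyc_reduced: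
  assumes cyc: "\<And>w. w \<noteq> [] \<Longrightarrow> cyc_P_reduced P w \<Longrightarrow> w \<approx> [] \<Longrightarrow>
    \<exists>v\<in>interleaves P w. \<forall>f g u. lipschitz_on_edges cay f \<longrightarrow> lipschitz_on_edges cay g \<longrightarrow> u \<in> lists X \<longrightarrow>
      \<bar>word_sum f g u v\<bar> \<le> int (M * length w)"
  shows "linear_filling cay (M + 32)"
proof (rule linear_fillingI)
  fix f g u w
  assume lip: "lipschitz_on_edges cay f" "lipschitz_on_edges cay g" and "u \<in> lists X" "w \<approx> []"
  then show "\<bar>word_sum f g u w\<bar> \<le> int ((M + 32) * length w)"
  proof (induction "length w" arbitrary: u w rule: less_induct)
    case less
    note u = \<open>u \<in> lists X\<close> and w = \<open>w \<approx> []\<close>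
    consider "w = []" | "w \<noteq> []" "cyc_P_reduced P w" | "\<not> cyc_P_reduced P w" by blast
    then show ?case
    proof cases
      case 1 then show ?thesis by (simp add: word_sum_def)
    next
      case 2
      then obtain v where v: "cyc_interleave P v w"
        "\<And>u. u \<in> lists X \<Longrightarrow> \<bar>word_sum f g u v\<bar> \<le> int (M * length w)"
        using cyc[OF 2 w] lip by (auto simp: interleaves_def)
      obtain u' where "u' \<in> lists X" "\<bar>word_sum f g u w\<bar> \<le> \<bar>word_sum f g u' v\<bar> + 32 * int (length w)"
        by (rule word_sum_interleave[OF v(1) w u lip])
      with v(2)[of u'] show ?thesis by (simp add: algebra_simps)
    next
      case 3
      then obtain a b x y q where ab: "w = a @ b" "b @ a = x # y # q" "(x, y) \<in> D"
        using not_cyc_P_reduced word_eq_lists[OF w] by metis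
      have l: "a \<in> lists X" "b \<in> lists X" using word_eq_lists[OF w] ab by (auto simp: lists_append_iff)
      have ba: "x # y # q \<approx> []" using trivial_conj[OF l] w ab by simp
      have ua: "u @ a \<in> lists X" using u l by simp
      obtain w' where w': "w' \<approx> []" "length w' < length (x # y # q)"
        "\<bar>word_sum f g (u @ a) (x # y # q)\<bar> \<le> \<bar>word_sum f g (u @ a) w'\<bar> + 18"
        by (rule word_sum_merge[OF ab(3) ba ua lip])
      have len: "length (x # y # q) = length w" using arg_cong[OF ab(2), of length] ab(1) by simp
      have "\<bar>word_sum f g (u @ a) w'\<bar> \<le> int ((M + 32) * length w')"
        using less.hyps[OF _ lip ua w'(1)] w'(2) len by simp
      also have "\<dots> \<le> int ((M + 32) * (length w - 1))"
        using w'(2) len by (simp only: of_nat_le_iff) (rule mult_le_mono2, simp)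
      finally have "\<bar>word_sum f g u w\<bar> \<le> int ((M + 32) * (length w - 1)) + 18"
        using w'(3) word_sum_rotate[of a b u f g] w u ab by simp
      also have "\<dots> \<le> int ((M + 32) * length w)"
      proof -
        obtain k where "length w = Suc k" using len by (cases "length w") auto
        then show ?thesis by simp
      qed
      finally show ?thesis .
    qed
  qed
qed

text \<open>Interleaves of a relator are conjugate to it in \<open>G\<close>; thus the green faces
  of diagrams over the enlarged set of relators also become closed paths in the Cayley graph of
  \<open>G\<close>.\<close>

lemma interleaves_set_trivial:
  assumes "w \<in> sym_words P (interleaves_set P R)" shows "w \<approx> []"
proof -
  have triv: "v \<approx> []" if v: "v \<in> interleaves_set P R" for v
  proof -
    obtain w where w: "w \<in> R" "cyc_interleave P v w"
      using v by (auto simp: interleaves_set_def interleaves_def)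
    then have "w \<approx> []" by (intro relator_trivial) auto
    then show ?thesis by (rule interleave_trivial[OF w(2)])
  qed
  then show ?thesis using assms trivial_inv_word by (auto simp: sym_words_def)
qed

lemma labelled_diagram_of_coloured:
  assumes "coloured_diagram P (interleaves_set P R) \<Gamma>"
  shows "labelled_diagram P R \<Gamma>"
proof -
  interpret plane_map \<Gamma> by (rule plane_map_coloured[OF assms])
  show ?thesis
  proof
    show "\<exists>e\<in>f. face_word \<Gamma> e \<approx> []" if "f \<in> int_faces \<Gamma>" for f
    proof -
      have "f \<in> red_faces P \<Gamma> \<union> green_faces P (interleaves_set P R) \<Gamma>"
        using assms that by (auto simp: coloured_diagram_def)
      then show ?thesis
        using interleaves_set_trivial relator_trivial unfolding red_faces_def green_faces_def by blast
    qed
  qed (use assms in \<open>auto simp: coloured_diagram_def\<close>)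
qed

end

section \<open>Spurs and trivial interleaving\<close>

definition point_diagram :: "'a diagram" where
  "point_diagram = \<lparr>dverts = {0}, ddarts = {}, dinv = id, dtail = (\<lambda>_. 0), dnext = id,
     dlab = (\<lambda>_. undefined), dext = {}\<rparr>"

lemma point_diagram:
  "coloured_diagram P S point_diagram" "boundary_word point_diagram []" "area point_diagram = 0"
  by (simp_all add: coloured_diagram_def planar_map_def point_diagram_def dedges_def dfaces_def
      int_faces_def red_faces_def green_faces_def boundary_word_def area_def permutes_def)

text \<open>A new edge is hung into the external face at the tail of \<open>e0\<close>. Its dart
  \<open>a\<close> leads there from the new vertex \<open>z\<close>, and \<open>b\<close> leads
  back. The dart formerly followed by \<open>e0\<close> is now followed by \<open>b\<close>, so that
  the boundary read from \<open>a\<close> is the old one enclosed in \<open>x\<close> and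
  \<open>y\<close>.\<close>

definition add_spur :: "'a diagram \<Rightarrow> nat \<Rightarrow> nat \<Rightarrow> nat \<Rightarrow> nat \<Rightarrow> 'a \<Rightarrow> 'a \<Rightarrow> 'a diagram" where
  "add_spur \<Gamma> e0 z a b x y = \<lparr>dverts = insert z (dverts \<Gamma>), ddarts = insert a (insert b (ddarts \<Gamma>)),
     dinv = (dinv \<Gamma>)(a := b, b := a), dtail = (dtail \<Gamma>)(a := z, b := dtail \<Gamma> e0),
     dnext = (\<lambda>e. if e = a then e0 else if e = b then a else if dnext \<Gamma> e = e0 then b else dnext \<Gamma> e),
     dlab = (dlab \<Gamma>)(a := x, b := y), dext = insert a (insert b (dext \<Gamma>))\<rparr>"

locale spur = plane_map \<Gamma> for \<Gamma> :: "'a diagram" +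
  fixes e0 z a b :: nat and x y :: 'a
  assumes e0: "e0 \<in> dext \<Gamma>" and z: "z \<notin> V" and ab: "a \<notin> A" "b \<notin> A" "a \<noteq> b"
begin

abbreviation "\<Gamma>' \<equiv> add_spur \<Gamma> e0 z a b x y"
abbreviation "nx' \<equiv> dnext \<Gamma>'"
abbreviation "rv' \<equiv> dinv \<Gamma>'"
abbreviation "tl' \<equiv> dtail \<Gamma>'"

lemma ext_face: "dext \<Gamma> \<in> dfaces \<Gamma>" "dext \<Gamma> = fc e0" "e0 \<in> A"
proof -
  have "A \<noteq> {}" using e0 ext by auto
  then show "dext \<Gamma> \<in> dfaces \<Gamma>" using ext by blast
  then show "dext \<Gamma> = fc e0" "e0 \<in> A" using face_of e0 by auto
qed

lemma nx'_simps: "nx' a = e0" "nx' b = a" "e \<in> A \<Longrightarrow> nx' e = (if nx e = e0 then b else nx e)"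
  and rv'_simps: "rv' a = b" "rv' b = a" "e \<in> A \<Longrightarrow> rv' e = rv e"
  and tl'_simps: "tl' a = z" "tl' b = tl_v e0" "e \<in> A \<Longrightarrow> tl' e = tl_v e"
  and darts': "ddarts \<Gamma>' = insert a (insert b A)" and verts': "dverts \<Gamma>' = insert z V"
  and ext': "dext \<Gamma>' = insert a (insert b (dext \<Gamma>))"
  and lab'_simps: "dlab \<Gamma>' a = x" "dlab \<Gamma>' b = y" "e \<in> A \<Longrightarrow> dlab \<Gamma>' e = dlab \<Gamma> e"
  using ab by (auto simp: add_spur_def)

lemma nx_fixed: "e \<notin> A \<Longrightarrow> nx e = e"
  using nx_permutes by (simp add: permutes_def)

lemma nx_inj: "nx e = nx e' \<Longrightarrow> e = e'"
  using permutes_inj[OF nx_permutes] by (simp add: inj_def)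

lemma nx'_permutes: "nx' permutes insert a (insert b A)"
proof (rule bij_imp_permutes)
  have sub: "nx' ` insert a (insert b A) \<subseteq> insert a (insert b A)"
    using nx'_simps nx_in ext_face by auto
  have "inj_on nx' (insert a (insert b A))"
  proof (rule inj_onI)
    fix e e' assume e: "e \<in> insert a (insert b A)" "e' \<in> insert a (insert b A)" "nx' e = nx' e'"
    have "nx e \<in> A" if "e \<in> A" for e using nx_in that .
    then show "e = e'" using e nx'_simps ab nx_inj[of e e'] ext_face(3) by (auto split: if_splits)
  qed
  then show "bij_betw nx' (insert a (insert b A)) (insert a (insert b A))"
    using endo_inj_surj[OF _ sub] fin by (simp add: bij_betw_def)
  show "nx' e = e" if "e \<notin> insert a (insert b A)" for e
    using that nx_fixed[of e] ext_face(3) by (auto simp: add_spur_def)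
qed

lemma nx'_perm: "permutation nx'"
  unfolding permutation_permutes
  by (rule exI[of _ "insert a (insert b A)"]) (use nx'_permutes fin(3) in blast)

lemma other_face:
  assumes "e \<in> A" "fc e \<noteq> dext \<Gamma>"
  shows "orbit nx' e = fc e" "face_word \<Gamma>' e = face_word \<Gamma> e"
proof -
  have same: "nx' s = nx s" if s: "s \<in> fc e" for s
  proof -
    have "nx s \<noteq> e0" using fc_nx[of s] fc_eqI[OF s] assms ext_face(2) by metis
    moreover have "s \<in> A" using s fc_sub assms by blast
    ultimately show ?thesis using nx'_simps by simp
  qed
  show orb: "orbit nx' e = fc e" by (rule orbit_cong[OF self_fc same])
  have "(nx' ^^ i) e = (nx ^^ i) e \<and> (nx ^^ i) e \<in> fc e" for i
    by (induction i) (use same self_fc in \<open>auto intro: orbit.step\<close>)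
  moreover have "fc e \<subseteq> A" using fc_sub assms by blast
  ultimately show "face_word \<Gamma>' e = face_word \<Gamma> e"
    using lab'_simps(3) by (auto simp: face_word_def orb subset_iff)
qed

lemma ext_walk:
  defines "n \<equiv> card (fc e0)"
  shows "i < n \<Longrightarrow> (nx' ^^ Suc i) a = (nx ^^ i) e0" "(nx' ^^ Suc n) a = b" "(nx' ^^ Suc (Suc n)) a = a"
proof -
  have A: "(nx ^^ i) e0 \<in> A" for i by (induction i) (use ext_face nx_in in auto)
  show walk: "(nx' ^^ Suc i) a = (nx ^^ i) e0" if "i < n" for i
    using that
  proof (induction i)
    case 0 then show ?case using nx'_simps by simp
  next
    case (Suc i)
    have "(nx ^^ Suc i) e0 \<noteq> e0"
      using inj_onD[OF orbit_cycle(3)[OF nx_perm, of e0], of "Suc i" 0] Suc.prems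
      by (auto simp: n_def simp del: funpow.simps(2))
    then have "nx' ((nx ^^ i) e0) = (nx ^^ Suc i) e0" using nx'_simps(3)[OF A[of i]] by simp
    then show ?case using Suc by simp
  qed
  obtain k where k: "n = Suc k" using orbit_cycle(1)[OF nx_perm, of e0] by (cases n) (auto simp: n_def)
  have "nx ((nx ^^ k) e0) = e0" using orbit_cycle(2)[OF nx_perm, of e0] k by (simp add: n_def)
  then have "nx' ((nx ^^ k) e0) = b" using nx'_simps(3)[OF A[of k]] by simp
  then show b: "(nx' ^^ Suc n) a = b" using walk[of k] k by simp
  then show "(nx' ^^ Suc (Suc n)) a = a" using nx'_simps by simp
qed

lemma ext_orbit: "orbit nx' a = insert a (insert b (dext \<Gamma>))"
proof -
  define n where "n = card (fc e0)"
  have "orbit nx' a = {(nx' ^^ m) a | m. m < Suc (Suc n)}"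
    by (rule orbit_altdef_bounded) (use ext_walk(3) in \<open>auto simp: n_def\<close>)
  also have "\<dots> = (\<lambda>m. (nx' ^^ m) a) ` {..<Suc (Suc n)}" by auto
  also have "{..<Suc (Suc n)} = insert 0 (insert (Suc n) (Suc ` {..<n}))"
    unfolding lessThan_Suc[of "Suc n"] lessThan_Suc_eq_insert_0[of n] by (rule insert_commute)
  also have "(\<lambda>m. (nx' ^^ m) a) ` \<dots> = insert a (insert b ((\<lambda>i. (nx ^^ i) e0) ` {..<n}))"
    using ext_walk(1,2) by (simp add: image_image n_def del: funpow.simps(2) cong: image_cong_simp)
  also have "(\<lambda>i. (nx ^^ i) e0) ` {..<n} = dext \<Gamma>"
    using orbit_cycle(4)[OF nx_perm, of e0] ext_face by (simp add: n_def)
  finally show ?thesis .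
qed

lemma ext_word: "face_word \<Gamma>' a = x # face_word \<Gamma> e0 @ [y]"
proof -
  define n where "n = card (fc e0)"
  have finx: "finite (dext \<Gamma>)" "a \<notin> dext \<Gamma>" "b \<notin> dext \<Gamma>"
    using fin_face face_sub ext_face ab by blast+
  then have card: "card (orbit nx' a) = Suc (Suc n)"
    using ab ext_face(2) by (simp add: ext_orbit n_def)
  have A: "(nx ^^ i) e0 \<in> A" for i by (induction i) (use ext_face nx_in in auto)
  have "face_word \<Gamma>' a = map (\<lambda>i. dlab \<Gamma>' ((nx' ^^ i) a)) ([0] @ map Suc [0..<n] @ [Suc n])"
  proof -
    have "[0..<Suc (Suc n)] = 0 # [Suc 0..<Suc (Suc n)]" by (rule upt_conv_Cons) simp
    also have "[Suc 0..<Suc (Suc n)] = map Suc [0..<Suc n]" by (rule map_Suc_upt[symmetric])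
    finally have "[0..<Suc (Suc n)] = [0] @ map Suc [0..<n] @ [Suc n]" by simp
    then show ?thesis unfolding face_word_def card by simp
  qed
  also have "\<dots> = x # map (\<lambda>i. dlab \<Gamma> ((nx ^^ i) e0)) [0..<n] @ [y]"
    using ext_walk(1,2) lab'_simps A by (simp add: n_def del: funpow.simps(2))
  finally show ?thesis by (simp add: face_word_def n_def)
qed

lemma faces': "dfaces \<Gamma>' = insert (dext \<Gamma>') (int_faces \<Gamma>)"
proof -
  have 1: "orbit nx' e = dext \<Gamma>'" if "e \<in> dext \<Gamma>'" for e
    using orbit_cyclic_eq3[OF cyclic_on_orbit'[OF nx'_perm, of a], of e] that
    unfolding ext' ext_orbit by simp
  have 2: "orbit nx' e = fc e" if "e \<in> A" "fc e \<noteq> dext \<Gamma>" for e using other_face that by blast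
  have "orbit nx' ` insert a (insert b A) = insert (dext \<Gamma>') (fc ` {e \<in> A. fc e \<noteq> dext \<Gamma>})"
  proof -
    have "insert a (insert b A) = dext \<Gamma>' \<union> {e \<in> A. fc e \<noteq> dext \<Gamma>}"
      using ext' face_sub[OF ext_face(1)] self_fc by auto
    then have "orbit nx' ` insert a (insert b A) = orbit nx' ` dext \<Gamma>' \<union> orbit nx' ` {e \<in> A. fc e \<noteq> dext \<Gamma>}"
      by (simp only: image_Un)
    moreover have "orbit nx' ` dext \<Gamma>' = {dext \<Gamma>'}" using 1 ext' by auto
    moreover have "orbit nx' ` {e \<in> A. fc e \<noteq> dext \<Gamma>} = fc ` {e \<in> A. fc e \<noteq> dext \<Gamma>}"
      using 2 by (intro image_cong) auto
    ultimately show ?thesis by simp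
  qed
  moreover have "fc ` {e \<in> A. fc e \<noteq> dext \<Gamma>} = int_faces \<Gamma>" by (auto simp: int_faces_def dfaces_def)
  ultimately show ?thesis by (simp add: dfaces_def[of \<Gamma>'] darts')
qed

lemma int_faces': "int_faces \<Gamma>' = int_faces \<Gamma>"
proof -
  have "dext \<Gamma>' \<notin> int_faces \<Gamma>" using face_sub ab by (auto simp: ext' int_face)
  then show ?thesis by (simp add: int_faces_def[of \<Gamma>'] faces')
qed

lemma face_word': "f \<in> int_faces \<Gamma> \<Longrightarrow> e \<in> f \<Longrightarrow> face_word \<Gamma>' e = face_word \<Gamma> e"
  using other_face(2)[of e] face_of[of f e] by (simp add: int_face)

lemma edges': "dedges \<Gamma>' = insert {a, b} (dedges \<Gamma>)"
proof -
  have "(\<lambda>e. {e, rv' e}) ` A = dedges \<Gamma>" unfolding dedges_def using rv'_simps by (intro image_cong) auto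
  then show ?thesis using rv'_simps by (auto simp: dedges_def[of \<Gamma>'] darts')
qed

text \<open>In the rotation around the tail of \<open>e0\<close> the dart \<open>b\<close> is
  inserted just before \<open>e0\<close>; all other rotations are unchanged, and \<open>a\<close> is
  the only dart at \<open>z\<close>.\<close>

lemma vertex_orbit':
  assumes "e \<in> ddarts \<Gamma>'" "e' \<in> ddarts \<Gamma>'" "tl' e = tl' e'"
  shows "e' \<in> orbit (nx' \<circ> rv') e"
proof -
  define \<rho> where "\<rho> = nx \<circ> rv"
  define \<rho>' where "\<rho>' = nx' \<circ> rv'"
  have rot: "\<rho>' e = (if \<rho> e = e0 then b else \<rho> e)" if "e \<in> A" for e
    using that nx'_simps(3)[of "rv e"] rv'_simps(3)[of e] rv by (simp add: \<rho>_def \<rho>'_def)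
  have rot_ab: "\<rho>' a = a" "\<rho>' b = e0" using nx'_simps rv'_simps by (simp_all add: \<rho>'_def)
  have \<rho>_in: "\<rho> e \<in> A" if "e \<in> A" for e using that rv nx_in by (simp add: \<rho>_def)
  have one: "\<rho> e \<in> orbit \<rho>' e" if "e \<in> A" for e
    using orbit.base[of \<rho>' e] orbit.step[of b \<rho>' e] rot[OF that] rot_ab by (auto split: if_splits)
  have old: "s \<in> orbit \<rho>' e \<and> s \<in> A" if e: "e \<in> A" and s: "s \<in> orbit \<rho> e" for e s
    using s
  proof induction
    case base then show ?case using one \<rho>_in e by blast
  next
    case (step s) then show ?case using one[of s] \<rho>_in orbit_trans by metis
  qed
  have old': "e' \<in> orbit \<rho>' e" if "e \<in> A" "e' \<in> A" "tl_v e = tl_v e'" for e e'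
    using old[OF that(1)] vertex_orbit[OF that] by (simp add: \<rho>_def)
  \<comment> \<open>The dart \<open>l\<close> precedes \<open>e0\<close> on the old boundary; its
    reverse is the dart after which \<open>b\<close> is inserted.\<close>
  obtain l where l: "l \<in> A" "nx l = e0"
    using permutes_image[OF nx_permutes] ext_face(3) by (metis imageE)
  have l': "rv l \<in> A" "tl_v (rv l) = tl_v e0" "\<rho>' (rv l) = b"
    using l rv tail rot[of "rv l"] by (auto simp: \<rho>_def)
  have to_b: "b \<in> orbit \<rho>' e" if "e \<in> A" "tl_v e = tl_v e0" for e
    using orbit.step[OF old'[OF that(1) l'(1)]] l' that by simp
  have b_e0: "e0 \<in> orbit \<rho>' b" using orbit.base[of \<rho>' b] rot_ab by simp
  have from_b: "e \<in> orbit \<rho>' b" if "e \<in> A" "tl_v e = tl_v e0" for e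
    using orbit_trans[OF old'[OF ext_face(3) that(1)] b_e0] that by simp
  have b_b: "b \<in> orbit \<rho>' b" using orbit_trans[OF to_b[OF ext_face(3)] b_e0] by simp
  have a_a: "a \<in> orbit \<rho>' a" using orbit.base[of \<rho>' a] rot_ab by simp
  have not_z: "tl_v e \<noteq> z" if "e \<in> A" for e using tail[OF that] z by auto
  have "e \<in> A \<or> e = a \<or> e = b" "e' \<in> A \<or> e' = a \<or> e' = b" using assms darts' by auto
  then consider "e \<in> A" "e' \<in> A" | "e \<in> A" "e' = b" | "e = b" "e' \<in> A" | "e = b" "e' = b" | "e = a" "e' = a"
    using assms(3) tl'_simps(1,2) tl'_simps(3)[of e] tl'_simps(3)[of e'] not_z[of e] not_z[of e']
      not_z[OF ext_face(3)] by (elim disjE) simp_all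
  then have "e' \<in> orbit \<rho>' e"
  proof cases
    case 1 then show ?thesis using old'[of e e'] assms(3) tl'_simps(3)[of e] tl'_simps(3)[of e'] by simp
  next
    case 2 then show ?thesis using to_b[of e] assms(3) tl'_simps(2) tl'_simps(3)[of e] by simp
  next
    case 3 then show ?thesis using from_b[of e'] assms(3) tl'_simps(2) tl'_simps(3)[of e'] by simp
  next
    case 4 then show ?thesis using b_b by simp
  next
    case 5 then show ?thesis using a_a by simp
  qed
  then show ?thesis by (simp only: \<rho>'_def)
qed

lemma planar': "planar_map \<Gamma>'"
proof -
  have tails: "tl' e \<in> insert z V \<and> tl' (nx' e) = tl' (rv' e)" if "e \<in> insert a (insert b A)" for e
    using that nx'_simps rv'_simps tl'_simps tail[of e] rv[of e] nx_in[of e] ext_face(3) tail[OF ext_face(3)] by auto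
  have invol: "rv' e \<noteq> e \<and> rv' (rv' e) = e \<and> rv' e \<in> insert a (insert b A)" if "e \<in> insert a (insert b A)" for e
    using that rv'_simps rv ab by auto
  have rvp: "rv' permutes insert a (insert b A)"
  proof (rule bij_imp_permutes)
    show "bij_betw rv' (insert a (insert b A)) (insert a (insert b A))"
      by (rule bij_betw_byWitness[of _ rv']) (use invol in auto)
    show "rv' e = e" if "e \<notin> insert a (insert b A)" for e
      using that rv_fixed[of e] by (auto simp: add_spur_def)
  qed
  define rel where "rel = {(tl' e, tl' (rv' e)) | e. e \<in> insert a (insert b A)}"
  have sub: "{(tl_v e, tl_v (rv e)) | e. e \<in> A} \<subseteq> rel"
  proof clarify
    fix e assume e: "e \<in> A"
    then have "(tl_v e, tl_v (rv e)) = (tl' e, tl' (rv' e))" using tl'_simps rv'_simps rv by simp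
    then show "(tl_v e, tl_v (rv e)) \<in> rel" using e unfolding rel_def by blast
  qed
  have old: "(u, v) \<in> rel\<^sup>*" if "u \<in> V" "v \<in> V" for u v
    using vertex_conn[OF that] rtrancl_mono[OF sub] by blast
  have t0: "tl_v e0 \<in> V" using tail ext_face by blast
  have "(tl' a, tl' (rv' a)) \<in> rel" "(tl' b, tl' (rv' b)) \<in> rel" unfolding rel_def by blast+
  then have za: "(z, tl_v e0) \<in> rel" "(tl_v e0, z) \<in> rel" using tl'_simps rv'_simps by auto
  have conn: "(u, v) \<in> rel\<^sup>*" if "u \<in> insert z V" "v \<in> insert z V" for u v
  proof -
    have "(u, tl_v e0) \<in> rel\<^sup>*" using that old t0 za by auto
    moreover have "(tl_v e0, v) \<in> rel\<^sup>*" using that old t0 za by auto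
    ultimately show ?thesis by (rule rtrancl_trans)
  qed
  \<comment> \<open>One vertex and one edge are added and no internal face, so the Euler
    characteristic is kept.\<close>
  have "{a, b} \<notin> dedges \<Gamma>" using ab by (auto simp: dedges_def doubleton_eq_iff)
  then have "int (card (dverts \<Gamma>')) - int (card (dedges \<Gamma>')) + int (card (int_faces \<Gamma>')) = 1"
    using euler fin fin_faces z by (simp add: edges' verts' int_faces')
  then show ?thesis
    unfolding planar_map_def
    using vertex_orbit' tails invol rvp nx'_permutes conn fin faces'
    by (auto simp: darts' verts' rel_def)
qed

lemma coloured':
  assumes col: "coloured_diagram P S \<Gamma>" and xy: "x \<in> pgens P" "y = psigma P x" "y \<in> pgens P" "psigma P y = x"
  shows "coloured_diagram P S \<Gamma>'"
proof -
  have "\<forall>e\<in>ddarts \<Gamma>'. dlab \<Gamma>' e \<in> pgens P \<and> dlab \<Gamma>' (rv' e) = psigma P (dlab \<Gamma>' e)"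
  proof
    fix e assume "e \<in> ddarts \<Gamma>'"
    then consider "e = a" | "e = b" | "e \<in> A" using darts' by blast
    then show "dlab \<Gamma>' e \<in> pgens P \<and> dlab \<Gamma>' (rv' e) = psigma P (dlab \<Gamma>' e)"
    proof cases
      case 1 then show ?thesis using xy(1) xy(2)[symmetric] lab'_simps rv'_simps by simp
    next
      case 2 then show ?thesis using xy(3,4) lab'_simps rv'_simps by simp
    next
      case 3
      then show ?thesis using col lab'_simps(3) rv'_simps(3) rv[of e] by (simp add: coloured_diagram_def)
    qed
  qed
  moreover have "red_faces P \<Gamma>' = red_faces P \<Gamma>" "green_faces P S \<Gamma>' = green_faces P S \<Gamma>"
    using face_word' by (auto simp: red_faces_def green_faces_def int_faces')
  ultimately show ?thesis using planar' col by (simp add: coloured_diagram_def int_faces')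
qed

end

lemma (in pregroup) spur_exists:
  assumes col: "coloured_diagram P S \<Gamma>" and u: "boundary_word \<Gamma> u" "u \<noteq> []" and x: "x \<in> X"
  obtains \<Gamma>' where "coloured_diagram P S \<Gamma>'" "boundary_word \<Gamma>' (x # u @ [sg x])" "area \<Gamma>' = area \<Gamma>"
proof -
  interpret plane_map \<Gamma> by (rule plane_map_coloured[OF col])
  obtain e0 where e0: "e0 \<in> dext \<Gamma>" "face_word \<Gamma> e0 = u" using u by (auto simp: boundary_word_def)
  obtain z where z: "z \<notin> dverts \<Gamma>" using ex_new_if_finite[OF infinite_UNIV_nat fin(1)] by blast
  obtain a where a: "a \<notin> ddarts \<Gamma>" using ex_new_if_finite[OF infinite_UNIV_nat fin(3)] by blast
  have "finite (insert a (ddarts \<Gamma>))" using fin by simp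
  then obtain b where b: "b \<notin> insert a (ddarts \<Gamma>)" using ex_new_if_finite[OF infinite_UNIV_nat] by blast
  interpret sp: spur \<Gamma> e0 z a b x "sg x" by unfold_locales (use e0 z a b in auto)
  show thesis
  proof (rule that)
    show "coloured_diagram P S (add_spur \<Gamma> e0 z a b x (sg x))"
      using sp.coloured'[OF col] x inv_gen sigma_sigma gen_carrier by simp
    show "boundary_word (add_spur \<Gamma> e0 z a b x (sg x)) (x # u @ [sg x])"
      using sp.ext_word e0 sp.ext' unfolding boundary_word_def by blast
    show "area (add_spur \<Gamma> e0 z a b x (sg x)) = area \<Gamma>" by (simp add: area_def sp.int_faces')
  qed
qed

section \<open>Trivial interleaving and \<sigma>-reduced words\<close>

context pregroup
begin

lemma cyc_reduced_sigma_reduced: "cyc_P_reduced P w \<Longrightarrow> sigma_reduced P w"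
proof -
  assume w: "cyc_P_reduced P w"
  have "successively (\<lambda>x y. y \<noteq> sg x) w"
  proof (cases "length w \<le> 1")
    case True
    then show ?thesis by (auto simp: successively_conv_nth)
  next
    case False
    then have s: "w \<in> lists X" "successively (\<lambda>x y. (x, y) \<notin> D) w" using w by (auto simp: cyc_P_reduced_def P_reduced_def)
    show ?thesis unfolding successively_conv_nth
    proof (intro allI impI)
      fix i assume i: "Suc i < length w"
      then have "w ! i \<in> X" using s(1) by (auto simp: in_lists_conv_set)
      then have "(w ! i, sg (w ! i)) \<in> D" using P2 gen_carrier by blast
      moreover have "(w ! i, w ! Suc i) \<notin> D" using s(2) i by (simp add: successively_conv_nth)
      ultimately show "w ! Suc i \<noteq> sg (w ! i)" by auto
    qed
  qed
  then show ?thesis using w by (simp add: sigma_reduced_def cyc_P_reduced_def)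
qed

text \<open>A proper product \<open>z\<close> of \<open>x\<close> and \<open>y\<close> allows a
  letter to absorb a factor \<open>y\<close> from its cyclic neighbour. Words with three letters
  leave room to do this with a \<sigma>-reduced result that differs from the original word.\<close>

lemma VP_empty:
  assumes triv: "\<And>w. sigma_reduced P w \<Longrightarrow> interleaves P w = {w}"
  shows "VP P = {}"
proof (rule ccontr)
  assume "VP P \<noteq> {}"
  then obtain x y where xy: "x \<in> X" "y \<in> X" "(x, y) \<in> D" "x \<noteq> sg y" by (auto simp: VP_def)
  define z where "z = mul x y"
  have c: "x \<in> pcarrier P" "y \<in> pcarrier P" "sg x \<in> pcarrier P" "sg y \<in> pcarrier P"
    using xy gen_carrier sigma_closed by auto
  have z: "z \<in> X" "z \<in> pcarrier P" using mult_gen xy gen_carrier by (auto simp: z_def)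
  have sz: "sg z \<in> X" "sg z \<in> pcarrier P" "sg (sg z) = z" using z inv_gen sigma_closed sigma_sigma by auto
  have xz: "x \<noteq> z"
  proof
    assume "x = z"
    have "(sg x, x) \<in> D" "(x, y) \<in> D" using P2 c xy by auto
    moreover have "(mul (sg x) x, y) \<in> D" using P1 P2 c by simp
    ultimately have "mul (mul (sg x) x) y = mul (sg x) z" using P4 by (simp add: z_def)
    then have "y = idt" using P1 P2 c \<open>x = z\<close> by simp
    then show False using xy by (simp add: pgens_def)
  qed
  have contra: False if "cyc_interleave P v w" "sigma_reduced P w" "v \<noteq> w" for v w
    using triv[OF that(2)] that by (auto simp: interleaves_def)
  show False
  proof (cases "\<exists>u\<in>X. u \<noteq> z \<and> u \<noteq> sg z")
    case True
    then obtain u where u: "u \<in> X" "u \<noteq> z" "u \<noteq> sg z" by blast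
    have uc: "u \<in> pcarrier P" using u gen_carrier by blast
    have "z \<noteq> sg u" using u sigma_sigma uc by metis
    then have red: "sigma_reduced P [sg z, u, z]" using u z sz by (simp add: sigma_reduced_def)
    have yx: "(sg y, sg x) \<in> D" "mul (sg y) (sg x) = sg z" using P3 xy by (auto simp: z_def)
    \<comment> \<open>The factor \<open>y\<close> is passed only across the junction of the last and
      the first letter: \<open>x\<close> becomes \<open>z\<close> and \<open>sg x\<close> becomes
      \<open>sg z\<close>, while \<open>u\<close> is unchanged and keeps the two ends apart.\<close>
    have "cyc_interleave P [sg x, u, x] [sg z, u, z]"
      unfolding cyc_interleave_def
      using xy z sz u uc c yx inv_gen inv_one P1 one_closed
      by (auto simp: less_Suc_eq z_def[symmetric] intro!: exI[of _ "\<lambda>i. if i = 0 \<or> i = 3 then y else idt"])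
    then show False using contra red xz by blast
  next
    \<comment> \<open>Now \<open>z\<close> and \<open>sg z\<close> are the only letters. It follows
      that \<open>x\<close> and \<open>y\<close> agree and that the square of \<open>x\<close> is
      \<open>sg x\<close>, as in the cyclic group of order three.\<close>
    case False
    have "sg x \<in> X" using xy inv_gen by blast
    then have "x = sg z" using False xy xz by blast
    moreover have "sg z = z \<or> y = sg z \<or> y = z" using False xy by blast
    moreover have "y \<noteq> z"
    proof
      assume "y = z"
      have "(x, y) \<in> D" "(y, sg y) \<in> D" "(x, mul y (sg y)) \<in> D" using P1 P2 c xy by auto
      then have "mul (mul x y) (sg y) = mul x (mul y (sg y))" using P4 by blast
      moreover have "mul x y = y" by (rule HOL.trans[OF z_def[symmetric] \<open>y = z\<close>[symmetric]])
      moreover have "mul y (sg y) = idt" "mul x idt = x" using P1 P2 c by blast+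
      ultimately have "x = idt" by simp
      then show False using xy by (simp add: pgens_def)
    qed
    ultimately have "y = x" "sg x = z" using xz sz xy by auto
    then have x2: "(x, x) \<in> D" "mul x x = sg x" "x \<noteq> sg x" using xy by (auto simp: z_def)
    have s2: "(sg x, sg x) \<in> D" "mul (sg x) (sg x) = x" using P3[OF x2(1)] x2 sigma_sigma c by auto
    have red: "sigma_reduced P [x, x, x]" using xy x2 by (auto simp: sigma_reduced_def)
    \<comment> \<open>With \<open>s\<close> equal to 1, \<open>sg x\<close>, \<open>x\<close>, 1 the
      three letters become \<open>sg x\<close> times \<open>sg x\<close>, then \<open>x\<close>
      times \<open>sg x\<close> times \<open>x\<close>, then again \<open>sg x\<close> times
      \<open>sg x\<close>; each of these products is \<open>x\<close>.\<close>
    have "cyc_interleave P [sg x, sg x, sg x] [x, x, x]"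
      unfolding cyc_interleave_def
      using xy c x2 s2 inv_gen inv_one P1 P2 one_closed sigma_sigma
      by (auto simp: less_Suc_eq intro!: exI[of _ "\<lambda>i. if i = 1 then sg x else if i = 2 then x else idt"])
    from contra[OF this red] show False using x2(3) by auto
  qed
qed

text \<open>If \<open>VP P\<close> is empty, two letters can only be multiplied if they are inverse
  to each other.\<close>

lemma sigma_reduced_P_reduced:
  assumes VP: "VP P = {}" and w: "sigma_reduced P w" shows "P_reduced P w"
proof -
  have "(w ! i, w ! Suc i) \<notin> D" if i: "Suc i < length w" for i
  proof
    assume d: "(w ! i, w ! Suc i) \<in> D"
    have X: "w ! i \<in> X" "w ! Suc i \<in> X" using w i by (auto simp: sigma_reduced_def in_lists_conv_set)
    then have "w ! i = sg (w ! Suc i)" using VP d by (auto simp: VP_def)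
    then have "w ! Suc i = sg (w ! i)" using sigma_sigma X gen_carrier by simp
    then show False using w i by (simp add: sigma_reduced_def successively_conv_nth)
  qed
  then show ?thesis using w by (simp add: P_reduced_def sigma_reduced_def successively_conv_nth)
qed

end

context word_presentation
begin

text \<open>A \<sigma>-reduced word is \<open>P\<close>-reduced here, so it fails to be cyclically
  reduced only if its first and last letters are inverse. These are stripped off, and a spur
  restores them in the diagram of the remaining word. The area stays the same while the boundary
  grows, hence the monotone bound.\<close>

lemma sigma_reduced_diagram:
  fixes F :: "nat \<Rightarrow> real"
  assumes VP: "VP P = {}" and mono: "mono F" and F0: "F 0 \<ge> 0"
    and cyc: "\<And>u. u \<noteq> [] \<Longrightarrow> cyc_P_reduced P u \<Longrightarrow> u \<approx> [] \<Longrightarrow>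
      \<exists>\<Gamma>. coloured_diagram P S \<Gamma> \<and> boundary_word \<Gamma> u \<and> real (area \<Gamma>) \<le> F (length u)"
    and w: "sigma_reduced P w" "w \<approx> []"
  shows "\<exists>\<Gamma>. coloured_diagram P S \<Gamma> \<and> boundary_word \<Gamma> w \<and> real (area \<Gamma>) \<le> F (length w)"
  using w
proof (induction "length w" arbitrary: w rule: less_induct)
  case less
  consider "w = []" | "w \<noteq> []" "cyc_P_reduced P w" | "\<not> cyc_P_reduced P w" by blast
  then show ?case
  proof cases
    case 1
    have "real (area (point_diagram :: 'a diagram)) \<le> F (length w)" using 1 F0 by (simp add: point_diagram(3))
    then show ?thesis using point_diagram(1,2) 1 by metis
  next
    case 2 then show ?thesis using cyc less by blast
  next
    case 3
    have wl: "w \<in> lists X" using less.prems by (simp add: sigma_reduced_def)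
    have len: "length w > 1" and d: "(last w, hd w) \<in> D"
      using 3 wl sigma_reduced_P_reduced[OF VP] less.prems by (auto simp: cyc_P_reduced_def)
    obtain x q where xq: "w = x # q" using len by (cases w) auto
    then obtain u y where uy: "q = u @ [y]" using len by (cases q rule: rev_cases) auto
    have X: "x \<in> X" "y \<in> X" "u \<in> lists X" using wl xq uy by auto
    have "(y, x) \<in> D" using d xq uy by simp
    then have y: "y = sg x" using VP X by (auto simp: VP_def)
    have w: "w = x # u @ [sg x]" using xq uy y by simp
    \<comment> \<open>Otherwise \<open>w\<close> would be a letter followed by its inverse. The spur
      needs a dart of the external face to be attached to.\<close>
    have "u \<noteq> []" using less.prems(1) w by (auto simp: sigma_reduced_def)
    have "sigma_reduced P u"
      using less.prems(1) X unfolding w sigma_reduced_def by (auto simp: successively_Cons successively_append_iff)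
    moreover have "u \<approx> []"
    proof -
      have "[sg x] @ ([x] @ u) \<approx> []"
        using trivial_conj[of "[x] @ u" "[sg x]"] less.prems(2) w X inv_gen by simp
      then have "([sg x] @ [x]) @ u \<approx> []" by simp
      moreover have "[sg x, x] \<approx> []" using inv_word_left[of "[x]"] X by (simp add: inv_word_def)
      then have "[sg x, x] @ u \<approx> [] @ u" using X by (intro word_eq_append word_eq.refl)
      ultimately show ?thesis using word_eq.sym word_eq.trans by fastforce
    qed
    ultimately obtain \<Gamma> where G: "coloured_diagram P S \<Gamma>" "boundary_word \<Gamma> u" "real (area \<Gamma>) \<le> F (length u)"
      using less.hyps[of u] w by auto
    obtain \<Gamma>' where G': "coloured_diagram P S \<Gamma>'" "boundary_word \<Gamma>' w" "area \<Gamma>' = area \<Gamma>"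
      using spur_exists[OF G(1,2) \<open>u \<noteq> []\<close> X(1)] unfolding w by blast
    have "F (length u) \<le> F (length w)" using w by (intro monoD[OF mono]) simp
    then show ?thesis using G' G by (intro exI[of _ \<Gamma>']) simp
  qed
qed

lemma min_area_le: "coloured_diagram P S \<Gamma> \<Longrightarrow> boundary_word \<Gamma> w \<Longrightarrow> min_area P S w \<le> area \<Gamma>"
  unfolding min_area_def by (rule Least_le) blast

end

section \<open>The area bound as a function of the boundary length\<close>

lemma area_bound_mono:
  assumes "\<epsilon> > 0" "lam \<ge> 0" "\<mu> \<ge> 0" "m \<ge> 0"
  shows "mono (\<lambda>n. max (area_bound r d \<epsilon> lam \<mu> m n) 1)"
proof (rule monoI)
  fix n k :: nat assume nk: "n \<le> k"
  have "real n * geom_quotient r d * (1 + m / \<epsilon>) \<le> real k * geom_quotient r d * (1 + m / \<epsilon>)"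
    using nk assms geom_quotient_nonneg[of r d] by (intro mult_right_mono) auto
  then have "lam * (real n * geom_quotient r d * (1 + m / \<epsilon>) - 1 / \<epsilon>)
      \<le> lam * (real k * geom_quotient r d * (1 + m / \<epsilon>) - 1 / \<epsilon>)"
    using assms by (intro mult_left_mono) auto
  moreover have "\<mu> * real n \<le> \<mu> * real k" using nk assms by (intro mult_left_mono) auto
  ultimately show "max (area_bound r d \<epsilon> lam \<mu> m n) 1 \<le> max (area_bound r d \<epsilon> lam \<mu> m k) 1"
    unfolding area_bound_def by linarith
qed

lemma area_bound_linear:
  assumes "\<epsilon> > 0" "lam \<ge> 0" "\<mu> \<ge> 0" "m \<ge> 0"
  obtains C :: nat where "\<forall>n\<ge>1. max (area_bound r d \<epsilon> lam \<mu> m n) 1 \<le> real (C * n)"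
proof -
  define c where "c = lam * (geom_quotient r d * (1 + m / \<epsilon>)) + \<mu>"
  define C where "C = nat \<lceil>max c 1\<rceil>"
  have C: "c \<le> real C" "1 \<le> C" unfolding C_def by linarith+
  have "max (area_bound r d \<epsilon> lam \<mu> m n) 1 \<le> real (C * n)" if n: "n \<ge> 1" for n
  proof -
    have "area_bound r d \<epsilon> lam \<mu> m n = c * real n - lam / \<epsilon>"
      by (simp add: area_bound_def c_def algebra_simps)
    also have "\<dots> \<le> c * real n" using assms by simp
    also have "\<dots> \<le> real C * real n" using C by (intro mult_right_mono) auto
    finally have "area_bound r d \<epsilon> lam \<mu> m n \<le> real (C * n)" by simp
    moreover have "1 \<le> C * n" using C n by (metis mult_le_mono mult_1)
    then have "1 \<le> real (C * n)" by linarith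
    ultimately show ?thesis by simp
  qed
  then show thesis using that by blast
qed

lemma (in plane_map) boundary_length_word:
  assumes "boundary_word \<Gamma> w" "w \<noteq> []" shows "boundary_length \<Gamma> = length w"
proof -
  obtain e where e: "e \<in> dext \<Gamma>" "face_word \<Gamma> e = w" using assms by (auto simp: boundary_word_def)
  then have "A \<noteq> {}" using ext by auto
  then have "dext \<Gamma> = fc e" using ext face_of e by blast
  then show ?thesis using e face_word_length[of e] by (simp add: boundary_length_def)
qed

text \<open>The count of layers needs \<open>r\<close> to bound the length of every internal face,
  and red triangles have length 3; hence the guard \<open>r \<ge> 3\<close> or
  \<open>VP P = {}\<close> on the explicit bounds. Hyperbolicity only needs some linear bound and is
  derived with \<open>max r 3\<close>. If interleaving is trivial on all \<sigma>-reduced words,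
  \<open>VP P\<close> is empty and the guard holds. If it is trivial on cyclically
  \<open>P\<close>-reduced words, the bound is given for the minimal areas of these words. Condition
  (e) asks for diagrams of nonempty words; the empty word is filled by
  \<open>point_diagram\<close>.\<close>

theorem theorem5p9:
  fixes P :: "'a pregroup" and R :: "'a list set"
    and K :: "'a diagram set" and \<Psi> :: "'a diagram \<Rightarrow> cell \<Rightarrow> real"
    and \<epsilon> lam \<mu> m :: real and d r :: nat
  assumes pres: "pregroup_presentation P R"
    and r_def: "r = max_relator_length R"
    and diagrams: "\<forall>\<Gamma>\<in>K. coloured_diagram P (interleaves_set P R) \<Gamma>"
    and scheme: "curvature_scheme K \<Psi>"
    and bounds: "\<epsilon> > 0" "lam \<ge> 0" "\<mu> \<ge> 0" "m \<ge> 0" "d > 0"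
    and cond_a: "\<forall>\<Gamma>\<in>K. (\<forall>v\<in>dverts \<Gamma>. \<Psi> \<Gamma> (Vertex v) \<le> 0) \<and>
              (\<forall>e\<in>dedges \<Gamma>. \<Psi> \<Gamma> (Edge e) \<le> 0) \<and>
              (\<forall>f\<in>red_faces P \<Gamma>. \<Psi> \<Gamma> (Face f) \<le> 0)"
    and cond_b: "\<forall>\<Gamma>\<in>K. \<forall>f\<in>green_faces P (interleaves_set P R) \<Gamma>.
              ext_dist \<Gamma> f \<ge> d + 1 \<longrightarrow> \<Psi> \<Gamma> (Face f) \<le> - \<epsilon>"
    and cond_c: "\<forall>\<Gamma>\<in>K. area \<Gamma> > 1 \<longrightarrow> (\<forall>f\<in>green_faces P (interleaves_set P R) \<Gamma>.
              ext_dist \<Gamma> f \<le> d \<longrightarrow> \<Psi> \<Gamma> (Face f) \<le> m)"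
    and cond_d: "\<forall>\<Gamma>\<in>K. real (area \<Gamma>) \<le>
              lam * real (card (green_faces P (interleaves_set P R) \<Gamma>))
              + \<mu> * real (boundary_length \<Gamma>)"
  shows "(r \<ge> 3 \<or> VP P = {} \<longrightarrow>
            (\<forall>\<Gamma>\<in>K. area \<Gamma> > 1 \<longrightarrow>
               real (area \<Gamma>) \<le> area_bound r d \<epsilon> lam \<mu> m (boundary_length \<Gamma>))) \<and>
         ((\<forall>w. w \<noteq> [] \<and> cyc_P_reduced P w \<and> word_eq P R w [] \<longrightarrow>
              (\<exists>\<Gamma>\<in>K. \<exists>w'\<in>interleaves P w. boundary_word \<Gamma> w')) \<longrightarrow>
            hyperbolic_group (pres_group P R) \<and>
            ((\<forall>w. sigma_reduced P w \<longrightarrow> interleaves P w = {w}) \<longrightarrow>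
               (\<forall>n. real (pregroup_dehn P R n) \<le> max (area_bound r d \<epsilon> lam \<mu> m n) 1)) \<and>
            ((r \<ge> 3 \<or> VP P = {}) \<and> (\<forall>w. cyc_P_reduced P w \<longrightarrow> interleaves P w = {w}) \<longrightarrow>
               (\<forall>w. cyc_P_reduced P w \<and> word_eq P R w [] \<longrightarrow>
                  real (min_area P R w) \<le> max (area_bound r d \<epsilon> lam \<mu> m (length w)) 1)))"
proof -
  interpret pregroup P using pres by (simp add: pregroup_presentation_def)
  have finP: "finite (pcarrier P)" and finR: "finite R" and cycR: "\<forall>w\<in>R. cyc_P_reduced P w"
    using pres by (auto simp: pregroup_presentation_def)
  interpret word_presentation P R
    by unfold_locales (use cycR in \<open>auto simp: cyc_P_reduced_def\<close>)
  define S where "S = interleaves_set P R"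
  have lenS: "length w \<le> r" if "w \<in> S" for w
    using interleaves_set_length[OF finR] that by (simp add: S_def r_def)
  \<comment> \<open>The general \<open>k\<close> is taken as \<open>r\<close> for the explicit
    bounds and as \<open>max r 3\<close> for hyperbolicity.\<close>
  have bound: "real (area \<Gamma>) \<le> area_bound k d \<epsilon> lam \<mu> m (boundary_length \<Gamma>)"
    if K: "\<Gamma> \<in> K" and area: "area \<Gamma> > 1" and k: "r \<le> k" "k \<ge> 3 \<or> VP P = {}" for \<Gamma> k
  proof -
    have col: "coloured_diagram P S \<Gamma>" using diagrams K by (simp add: S_def)
    interpret plane_map \<Gamma> by (rule plane_map_coloured[OF col])
    have card: "card f \<le> k" if "f \<in> int_faces \<Gamma>" for f
      by (rule coloured_face_card[OF col that _ k(2)]) (use lenS k(1) le_trans in blast)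
    have "int_faces \<Gamma> \<noteq> {}" using area by (auto simp: area_def)
    then have k1: "k \<ge> 1" using int_face_card_pos card le_trans by blast
    show ?thesis
    proof (rule area_le_area_bound[of "red_faces P \<Gamma>" "green_faces P S \<Gamma>" "\<Psi> \<Gamma>"])
      show "int_faces \<Gamma> = red_faces P \<Gamma> \<union> green_faces P S \<Gamma>"
        using col by (simp add: coloured_diagram_def)
      show "curvature_distribution \<Gamma> (\<Psi> \<Gamma>)" using scheme K by (simp add: curvature_scheme_def)
    qed (use K area bounds cond_a cond_b cond_c cond_d card k1 in \<open>auto simp: S_def\<close>)
  qed
  have bound1: "real (area \<Gamma>) \<le> max (area_bound k d \<epsilon> lam \<mu> m (length w)) 1"
    if K: "\<Gamma> \<in> K" and k: "r \<le> k" "k \<ge> 3 \<or> VP P = {}" and w: "boundary_word \<Gamma> w" "w \<noteq> []" for \<Gamma> k w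
  proof (cases "area \<Gamma> > 1")
    case True
    interpret plane_map \<Gamma> using diagrams K plane_map_coloured by blast
    show ?thesis using bound[OF K True k] boundary_length_word[OF w] by simp
  qed auto
  have part1: "\<forall>\<Gamma>\<in>K. area \<Gamma> > 1 \<longrightarrow>
      real (area \<Gamma>) \<le> area_bound r d \<epsilon> lam \<mu> m (boundary_length \<Gamma>)" if "r \<ge> 3 \<or> VP P = {}"
    using bound[OF _ _ le_refl that] by blast
  have part2: "hyperbolic_group (pres_group P R) \<and>
            ((\<forall>w. sigma_reduced P w \<longrightarrow> interleaves P w = {w}) \<longrightarrow>
               (\<forall>n. real (pregroup_dehn P R n) \<le> max (area_bound r d \<epsilon> lam \<mu> m n) 1)) \<and>
            ((r \<ge> 3 \<or> VP P = {}) \<and> (\<forall>w. cyc_P_reduced P w \<longrightarrow> interleaves P w = {w}) \<longrightarrow>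
               (\<forall>w. cyc_P_reduced P w \<and> word_eq P R w [] \<longrightarrow>
                  real (min_area P R w) \<le> max (area_bound r d \<epsilon> lam \<mu> m (length w)) 1))"
    if e: "\<forall>w. w \<noteq> [] \<and> cyc_P_reduced P w \<and> word_eq P R w [] \<longrightarrow>
              (\<exists>\<Gamma>\<in>K. \<exists>w'\<in>interleaves P w. boundary_word \<Gamma> w')"
  proof -
    define k where "k = max r 3"
    obtain C :: nat where C: "\<forall>n\<ge>1. max (area_bound k d \<epsilon> lam \<mu> m n) 1 \<le> real (C * n)"
      by (rule area_bound_linear[OF bounds(1-4)])
    \<comment> \<open>Each face contributes at most \<open>2 * k ^ 2\<close> to the integral, there
      are at most \<open>C\<close> faces per letter, and 32 per letter is the cost of
      interleaving.\<close>
    have "linear_filling cay (2 * k ^ 2 * C + 32)"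
    proof (rule linear_filling_of_cyc_reduced)
      fix w assume w: "w \<noteq> []" "cyc_P_reduced P w" "w \<approx> []"
      then obtain \<Gamma> v where G: "\<Gamma> \<in> K" "v \<in> interleaves P w" "boundary_word \<Gamma> v" using e by blast
      have col: "coloured_diagram P (interleaves_set P R) \<Gamma>" using diagrams G by blast
      interpret labelled_diagram P R \<Gamma> by (rule labelled_diagram_of_coloured[OF col])
      have len: "length v = length w" by (rule interleaves_length[OF G(2)])
      then have v: "v \<noteq> []" using w by auto
      have card: "card f \<le> k" if "f \<in> int_faces \<Gamma>" for f
        by (rule coloured_face_card[OF col that]) (use lenS in \<open>auto simp: k_def S_def le_max_iff_disj\<close>)
      have "real (area \<Gamma>) \<le> max (area_bound k d \<epsilon> lam \<mu> m (length v)) 1"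
        using bound1[OF G(1) _ _ G(3) v] by (simp add: k_def)
      also have "\<dots> \<le> real (C * length w)" using C len v by (auto simp: Suc_le_eq)
      finally have area: "area \<Gamma> \<le> C * length w" by (simp only: of_nat_le_iff)
      have "\<bar>word_sum f g u v\<bar> \<le> int (2 * k ^ 2 * C * length w)"
        if "lipschitz_on_edges cay f" "lipschitz_on_edges cay g" "u \<in> lists X" for f g u
      proof -
        have "\<bar>word_sum f g u v\<bar> \<le> 2 * int k ^ 2 * int (area \<Gamma>)"
          by (rule boundary_sum_le_area[OF that G(3) v card])
        also have "\<dots> \<le> 2 * int k ^ 2 * int (C * length w)"
          using area by (intro mult_left_mono) (auto simp only: of_nat_le_iff, simp)
        finally show ?thesis by (simp add: mult.assoc)
      qed
      then show "\<exists>v\<in>interleaves P w. \<forall>f g u. lipschitz_on_edges cay f \<longrightarrow> lipschitz_on_edges cay g \<longrightarrow>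
          u \<in> lists X \<longrightarrow> \<bar>word_sum f g u v\<bar> \<le> int (2 * k ^ 2 * C * length w)"
        using G(2) by blast
    qed
    then have hyp: "hyperbolic_group (pres_group P R)" by (rule hyperbolic_of_linear_filling[OF finP])
    \<comment> \<open>Relators are cyclically \<open>P\<close>-reduced, so trivial interleaving adds
      no relators, and the diagrams in \<open>K\<close> are diagrams over the original
      presentation.\<close>
    have S_eq: "S = R" if triv: "\<And>w. cyc_P_reduced P w \<Longrightarrow> interleaves P w = {w}"
      using triv cycR by (auto simp: S_def interleaves_set_def)
    have cyc: "\<exists>\<Gamma>. coloured_diagram P R \<Gamma> \<and> boundary_word \<Gamma> w \<and>
        real (area \<Gamma>) \<le> max (area_bound r d \<epsilon> lam \<mu> m (length w)) 1"
      if triv: "\<And>w. cyc_P_reduced P w \<Longrightarrow> interleaves P w = {w}" and r3: "r \<ge> 3 \<or> VP P = {}"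
        and w: "w \<noteq> []" "cyc_P_reduced P w" "w \<approx> []" for w
    proof -
      obtain \<Gamma> v where G: "\<Gamma> \<in> K" "v \<in> interleaves P w" "boundary_word \<Gamma> v" using e w by blast
      then have bw: "boundary_word \<Gamma> w" using triv w by auto
      have "coloured_diagram P R \<Gamma>" using diagrams G S_eq[OF triv] by (auto simp: S_def)
      with bw bound1[OF G(1) _ r3 bw w(1)] show ?thesis by blast
    qed
    have trivial_word: "min_area P S [] = 0" for S :: "'a list set"
      using min_area_le[OF point_diagram(1)[of P S] point_diagram(2)] by (simp add: point_diagram(3))
    have min_bound: "\<forall>w. cyc_P_reduced P w \<and> word_eq P R w [] \<longrightarrow>
        real (min_area P R w) \<le> max (area_bound r d \<epsilon> lam \<mu> m (length w)) 1"
      if h: "(r \<ge> 3 \<or> VP P = {}) \<and> (\<forall>w. cyc_P_reduced P w \<longrightarrow> interleaves P w = {w})"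
    proof (intro allI impI)
      fix w assume w: "cyc_P_reduced P w \<and> word_eq P R w []"
      show "real (min_area P R w) \<le> max (area_bound r d \<epsilon> lam \<mu> m (length w)) 1"
      proof (cases "w = []")
        case False
        have "interleaves P v = {v}" if "cyc_P_reduced P v" for v using h that by blast
        then obtain \<Gamma> where G: "coloured_diagram P R \<Gamma>" "boundary_word \<Gamma> w"
          "real (area \<Gamma>) \<le> max (area_bound r d \<epsilon> lam \<mu> m (length w)) 1"
          using cyc[OF _ conjunct1[OF h] False conjunct1[OF w] conjunct2[OF w]] by blast
        with min_area_le[OF G(1,2)] show ?thesis by linarith
      qed (simp add: trivial_word)
    qed
    have dehn: "\<forall>n. real (pregroup_dehn P R n) \<le> max (area_bound r d \<epsilon> lam \<mu> m n) 1"
      if triv: "\<forall>w. sigma_reduced P w \<longrightarrow> interleaves P w = {w}"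
    proof
      fix n
      have VP: "VP P = {}" using triv by (intro VP_empty) blast
      define F where "F = (\<lambda>n. max (area_bound r d \<epsilon> lam \<mu> m n) 1)"
      have mono: "mono F" unfolding F_def by (rule area_bound_mono[OF bounds(1-4)])
      define Q where "Q = {w. sigma_reduced P w \<and> word_eq P R w [] \<and> length w \<le> n}"
      have le: "real (min_area P R w) \<le> F n" if w: "w \<in> Q" for w
      proof -
        have "\<exists>\<Gamma>. coloured_diagram P R \<Gamma> \<and> boundary_word \<Gamma> w \<and> real (area \<Gamma>) \<le> F (length w)"
        proof (rule sigma_reduced_diagram[OF VP mono])
          show "0 \<le> F 0" by (simp add: F_def)
          show "\<exists>\<Gamma>. coloured_diagram P R \<Gamma> \<and> boundary_word \<Gamma> u \<and> real (area \<Gamma>) \<le> F (length u)"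
            if "u \<noteq> []" "cyc_P_reduced P u" "u \<approx> []" for u
            unfolding F_def
          proof (rule cyc[OF _ disjI2[OF VP] that])
            show "interleaves P v = {v}" if "cyc_P_reduced P v" for v
              using triv cyc_reduced_sigma_reduced[OF that] by blast
          qed
        qed (use w in \<open>auto simp: Q_def\<close>)
        then obtain \<Gamma> where G: "coloured_diagram P R \<Gamma>" "boundary_word \<Gamma> w" "real (area \<Gamma>) \<le> F (length w)"
          by blast
        \<comment> \<open>The Dehn function takes the maximum over all words of length at most
          \<open>n\<close>, so the bound has to be monotone.\<close>
        have "F (length w) \<le> F n" using w by (intro monoD[OF mono]) (simp add: Q_def)
        with G min_area_le[OF G(1,2)] show ?thesis by linarith
      qed
      have "Q \<subseteq> {w. set w \<subseteq> X \<and> length w \<le> n}"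
        by (auto simp: Q_def sigma_reduced_def in_lists_conv_set)
      moreover have "finite X" using finP by (simp add: pgens_def)
      ultimately have "finite Q" using finite_lists_length_le finite_subset by blast
      moreover have "[] \<in> Q" by (simp add: Q_def sigma_reduced_def word_eq.refl)
      ultimately have "Max (min_area P R ` Q) \<in> min_area P R ` Q" by (intro Max_in) auto
      then obtain w where "w \<in> Q" "Max (min_area P R ` Q) = min_area P R w" by blast
      moreover have "pregroup_dehn P R n = Max (min_area P R ` Q)"
        unfolding pregroup_dehn_def Q_def by (simp add: setcompr_eq_image)
      ultimately show "real (pregroup_dehn P R n) \<le> max (area_bound r d \<epsilon> lam \<mu> m n) 1"
        using le[of w] by (simp add: F_def)
    qed
    show ?thesis
      by (rule conjI[OF hyp conjI[OF impI[OF dehn] impI[OF min_bound]]])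
  qed
  show ?thesis by (rule conjI[OF impI[OF part1] impI[OF part2]])
qed

end
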